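(* Let $\rho_N'$ be the $N$-qubit cat state after the independent Pauli channel with probabilities $\pi_0,\pi_1,\pi_2,\pi_3$ has acted on every qubit. Let $a=\pi_0+\pi_3$, $b=\pi_1+\pi_2$, $c=\pi_0-\pi_3$, $d=\pi_1-\pi_2$, $\Delta=|c^N+d^N|$ and $2\lambda_{k,N-k}=a^kb^{N-k}+b^ka^{N-k}$. Let $Q(N,k)$ be the (integer) quotient of $(N-k)/k$. For any given $k$ in a bipartite cut $k:(N-k)$, with $1\le k\le\lfloor N/2\rfloor$, if the distillability condition $\Delta>2\lambda_{k,N-k}$ is satisfied, then $\rho_N'$ is $M$-qubit cat state distillable, where the maximum possible value of $M$ is $$\max M=\begin{cases}N/k & \text{if } N \text{ is divisible by } k,\\ 1+Q(N,k) & \text{if } N \text{ is not divisible by } k.\end{cases}$$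
   Context: Setting: $\pi_0,\pi_1,\pi_2,\pi_3\ge 0$ with $\sum_{i=0}^3\pi_i=1$. The single-qubit channel is $S(\rho)=\pi_0\rho+\sum_{i=1}^3\pi_i\sigma_i\rho\sigma_i$, where $\sigma_1,\sigma_2,\sigma_3$ are the Pauli matrices $\sigma_x,\sigma_y,\sigma_z$. The $n$-qubit cat (GHZ) state is $|\Psi\rangle_n=\frac{1}{\sqrt2}(|0\rangle^{\otimes n}+|1\rangle^{\otimes n})$, and $\rho_N'=S^{\otimes N}(|\Psi\rangle_N\langle\Psi|)$. A bipartite cut $k:(N-k)$ is a division of the $N$ qubits into $k$ qubits on one side and $N-k$ on the other. Given a partition of the qubits into $M$ groups ($2\le M\le N$), each group is regarded as a single party holding all of its qubits. The state is $M$-qubit cat state distillable if, for some partition into $M$ groups, the $M$ parties can obtain the $M$-qubit cat state (one qubit per party) from copies of $\rho_N'$ by local operations (local to each group) and classical communication. *)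

theory Defs
  imports Complex_Main "HOL-Library.FuncSet"
begin

text \<open>
  An operator on a tensor product of finite-dimensional spaces is given by its entries in a
  product basis. The subsystems have labels of type \<open>'s\<close>, the basis vectors of each subsystem
  have labels of type \<open>'b\<close>; row and column indices assign a basis label to each subsystem.
  Only entries whose indices range over the intended basis matter.
\<close>

type_synonym ('s, 'b) oper = "('s \<Rightarrow> 'b) \<Rightarrow> ('s \<Rightarrow> 'b) \<Rightarrow> complex"

text \<open>\<open>(K \<otimes> I) \<rho> (K \<otimes> I)\<^sup>\<dagger>\<close>, where \<open>K\<close> acts on subsystem \<open>s\<close>, whose basis before the action is \<open>B\<close>.\<close>

definition local_kraus ::
  "'s \<Rightarrow> 'b set \<Rightarrow> ('b \<Rightarrow> 'b \<Rightarrow> complex) \<Rightarrow> ('s, 'b) oper \<Rightarrow> ('s, 'b) oper" where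
  "local_kraus s B K \<rho> =
     (\<lambda>x y. \<Sum>i\<in>B. \<Sum>j\<in>B. K (x s) i * \<rho> (x(s := i)) (y(s := j)) * cnj (K (y s) j))"


subsection \<open>Cat states under independent Pauli noise\<close>

definition pauli :: "nat \<Rightarrow> nat \<Rightarrow> nat \<Rightarrow> complex" where
  "pauli k i j =
     [[[1, 0], [0, 1]],
      [[0, 1], [1, 0]],
      [[0, - \<i>], [\<i>, 0]],
      [[1, 0], [0, - 1]]] ! k ! i ! j"

definition pauli_probs :: "(nat \<Rightarrow> real) \<Rightarrow> bool" where
  "pauli_probs p \<longleftrightarrow> (\<forall>i<4. 0 \<le> p i) \<and> (\<Sum>i<4. p i) = 1"

definition pauli_channel :: "(nat \<Rightarrow> real) \<Rightarrow> 's \<Rightarrow> ('s, nat) oper \<Rightarrow> ('s, nat) oper" where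
  "pauli_channel p q \<rho> =
     (\<lambda>x y. \<Sum>i<4. complex_of_real (p i) * local_kraus q {0, 1} (pauli i) \<rho> x y)"

definition cat_vec :: "nat \<Rightarrow> (nat \<Rightarrow> nat) \<Rightarrow> complex" where
  "cat_vec N x =
     complex_of_real (1 / sqrt 2) * ((\<Prod>q<N. of_bool (x q = 0)) + (\<Prod>q<N. of_bool (x q = 1)))"

definition cat_state :: "nat \<Rightarrow> (nat, nat) oper" where
  "cat_state N = (\<lambda>x y. cat_vec N x * cnj (cat_vec N y))"

definition noisy_cat :: "(nat \<Rightarrow> real) \<Rightarrow> nat \<Rightarrow> (nat, nat) oper" where
  "noisy_cat p N = fold (pauli_channel p) [0..<N] (cat_state N)"


subsection \<open>Local operations and classical communication\<close>

text \<open>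
  \<open>locc P B B' \<Lambda>\<close>: the map \<open>\<Lambda>\<close> is implemented by a finite deterministic (trace-preserving)
  LOCC protocol among the parties \<open>P\<close>; party \<open>p\<close> has local basis \<open>B p\<close> at the start and \<open>B' p\<close>
  at the end. In each step one party performs a local measurement with Kraus operators \<open>K m\<close>,
  possibly into a space of another dimension (basis \<open>C m\<close>), and announces the outcome \<open>m\<close>, on
  which the rest of the protocol may depend. At the end the record of outcomes is discarded.
\<close>

inductive locc ::
  "'s set \<Rightarrow> ('s \<Rightarrow> 'b set) \<Rightarrow> ('s \<Rightarrow> 'b set) \<Rightarrow> (('s, 'b) oper \<Rightarrow> ('s, 'b) oper) \<Rightarrow> bool"
  for P :: "'s set" where
  stop: "locc P B B (\<lambda>\<rho>. \<rho>)"
| step: "locc P B B' (\<lambda>\<rho> x y. \<Sum>m<r. \<Lambda> m (local_kraus p (B p) (K m) \<rho>) x y)"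
  if "p \<in> P"
    and "\<And>m. m < r \<Longrightarrow> finite (C m)"
    and "\<And>i j. i \<in> B p \<Longrightarrow> j \<in> B p \<Longrightarrow>
           (\<Sum>m<(r::nat). \<Sum>l\<in>C m. cnj (K m l i) * K m l j) = (if i = j then 1 else 0)"
    and "\<And>m. m < r \<Longrightarrow> locc P (B(p := C m)) B' (\<Lambda> m)"


subsection \<open>Distillability of cat states\<close>

text \<open>Qubit \<open>q\<close> of copy \<open>c\<close> is labelled \<open>(c, q)\<close>.\<close>

definition tensor_power :: "nat \<Rightarrow> (nat, nat) oper \<Rightarrow> (nat \<times> nat, nat) oper" where
  "tensor_power n \<rho> = (\<lambda>x y. \<Prod>c<n. \<rho> (\<lambda>q. x (c, q)) (\<lambda>q. y (c, q)))"

text \<open>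
  Party \<open>g\<close> holds, in every copy, the qubits \<open>q < N\<close> with \<open>grp q = g\<close>. Its basis labels are the
  bit assignments to all qubits it holds.
\<close>

definition party_basis ::
  "nat \<Rightarrow> nat \<Rightarrow> (nat \<Rightarrow> nat) \<Rightarrow> nat \<Rightarrow> (nat \<times> nat \<Rightarrow> nat) set" where
  "party_basis n N grp g = ({..<n} \<times> {q. q < N \<and> grp q = g}) \<rightarrow>\<^sub>E {0, 1}"

definition distribute ::
  "(nat \<Rightarrow> nat) \<Rightarrow> (nat \<times> nat, nat) oper \<Rightarrow> (nat, nat \<times> nat \<Rightarrow> nat) oper" where
  "distribute grp \<rho> =
     (\<lambda>x y. \<rho> (\<lambda>(c, q). x (grp q) (c, q)) (\<lambda>(c, q). y (grp q) (c, q)))"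

text \<open>
  The overlap of \<open>\<rho>\<close> with the cat state of \<open>M\<close> parties holding one qubit each, the qubit of
  party \<open>g\<close> being labelled \<open>(0, g)\<close>.
\<close>

definition cat_fidelity :: "nat \<Rightarrow> (nat, nat \<times> nat \<Rightarrow> nat) oper \<Rightarrow> real" where
  "cat_fidelity M \<rho> =
     Re (\<Sum>x\<in>Pi\<^sub>E {..<M} (party_basis 1 M id). \<Sum>y\<in>Pi\<^sub>E {..<M} (party_basis 1 M id).
           cnj (cat_vec M (\<lambda>g. x g (0, g))) * \<rho> x y * cat_vec M (\<lambda>g. y g (0, g)))"

text \<open>
  Distillation is understood in the usual asymptotic sense: finitely many copies suffice to
  reach any fidelity below one. The groups are the fibres of \<open>grp\<close>, nonempty by surjectivity.
\<close>

definition cat_distillable :: "nat \<Rightarrow> nat \<Rightarrow> (nat, nat) oper \<Rightarrow> bool" where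
  "cat_distillable M N \<rho> \<longleftrightarrow> 2 \<le> M \<and>
     (\<exists>grp. grp ` {..<N} = {..<M} \<and>
        (\<forall>\<epsilon>>0. \<exists>n \<Lambda>. locc {..<M} (party_basis n N grp) (party_basis 1 M id) \<Lambda> \<and>
                      cat_fidelity M (\<Lambda> (distribute grp (tensor_power n \<rho>))) \<ge> 1 - \<epsilon>))"


subsection \<open>The distillability condition\<close>

definition Delta :: "(nat \<Rightarrow> real) \<Rightarrow> nat \<Rightarrow> real" where
  "Delta p N = \<bar>(p 0 - p 3) ^ N + (p 1 - p 2) ^ N\<bar>"

definition lam :: "(nat \<Rightarrow> real) \<Rightarrow> nat \<Rightarrow> nat \<Rightarrow> real" where
  "lam p i j = ((p 0 + p 3) ^ i * (p 1 + p 2) ^ j + (p 1 + p 2) ^ i * (p 0 + p 3) ^ j) / 2"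

definition max_parties :: "nat \<Rightarrow> nat \<Rightarrow> nat" where
  "max_parties N k = (if k dvd N then N div k else 1 + (N - k) div k)"

end

theory Submission imports Defs
begin

text \<open>
  Since \<open>max_parties N k = N div k\<close>, the qubits can be split into that many groups of size at least
  \<open>k\<close>, and \<open>lam p j (N - j)\<close> decreases in \<open>j\<close> up to the middle; so the coherence
  \<open>\<mu> = Delta p N / 2\<close> exceeds every diagonal entry between the two constant bit strings.
  Each party first projects onto equal bits on all its qubits in a block of \<open>n\<^sub>1\<close> copies, which turns
  each entry into its \<open>n\<^sub>1\<close>-th power, and then maps the bits of \<open>n\<^sub>2\<close> blocks to their parity, which
  suppresses phase errors. With \<open>n\<^sub>2\<close> of the order of \<open>(lam p N 0 / \<mu>) ^ n\<^sub>1\<close> the phase error vanishes,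
  while the accumulated bit error is of the order of \<open>(lam p k (N - k) / \<mu>) ^ n\<^sub>1\<close>. The filter succeeds
  with positive probability, so it is repeated on fresh copies until it does.

  With more groups, one of them has fewer than \<open>k\<close> qubits. For suitable probabilities with
  \<open>p 1 = p 2\<close> the state then has positive partial transpose across this group although
  \<open>Delta p N > 2 * lam p k (N - k)\<close>. LOCC preserves this property, and it bounds the overlap with a
  cat state by \<open>1 / 2\<close>.
\<close>

subsection \<open>Local operations in the Heisenberg picture\<close>

text \<open>Only one number of the final state matters, its overlap with the cat state. Protocols
  are therefore built backwards: an observable is pulled through the rounds, and the maps stay
  hidden behind an existential. The obstacle is that \<open>locc\<close> admits only
  trace-preserving protocols, whereas the filter is a single Kraus operator per party; it has to be
  scaled by \<open>sqrt \<kappa>\<close> and completed by failure outcomes. If any party fails, all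
  parties discard the whole block, so failure contributes the block identity minus the success
  effect, whoever failed. The value \<open>v\<close> of the fidelity becomes \<open>\<kappa> ^ M *
  F\<^sub>0 + (1 - \<kappa> ^ M * T\<^sub>0) * v\<close> after one more trial, with fixed point
  \<open>F\<^sub>0 / T\<^sub>0\<close>; a tiny success rate is harmless. An even
  \<open>n\<^sub>1\<close> makes all powered entries nonnegative, whatever the sign of the
  coherence, so that dropping terms bounds the sums from the required side.\<close>

lemma sum_PiE_upd:
  assumes "p \<in> P"
  shows "(\<Sum>x\<in>Pi\<^sub>E P (B(p := C)). \<Sum>i\<in>B p. f x (x(p := i))) =
         (\<Sum>x\<in>Pi\<^sub>E P B. \<Sum>l\<in>C. f (x(p := l)) x)"
proof -
  have *: "x(p := l) \<in> Pi\<^sub>E P (B'(p := L))" if "x \<in> Pi\<^sub>E P B'" "l \<in> L" for x B' l L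
    using that assms by (auto simp: PiE_iff extensional_def)
  show ?thesis
    unfolding sum.cartesian_product
  proof (rule sum.reindex_bij_witness
          [where j = "\<lambda>(x, i). (x(p := i), x p)" and i = "\<lambda>(x, l). (x(p := l), x p)"],
         goal_cases)
    case (2 a)
    then show ?case using *[of "fst a" "B(p := C)" "snd a" "B p"] PiE_mem[of "fst a" P "B(p := C)" p] assms
      by (cases a) simp
  next
    case (4 b)
    then show ?case using *[of "fst b" B "snd b" C] PiE_mem[of "fst b" P B p] assms
      by (cases b) simp
  qed auto
qed

text \<open>\<open>Q\<close> is the observable \<open>R\<close> pulled back along some LOCC map. The
  pairing multiplies entries at equal indices, so \<open>R\<close> and \<open>Q\<close> are the
  transposes of the usual operators.\<close>

definition effect ::
  "'s set \<Rightarrow> ('s \<Rightarrow> 'b set) \<Rightarrow> ('s, 'b) oper \<Rightarrow> ('s \<Rightarrow> 'b set) \<Rightarrow> ('s, 'b) oper \<Rightarrow> bool" where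
  "effect P B' R B Q \<longleftrightarrow>
     (\<exists>\<Lambda>. locc P B B' \<Lambda> \<and>
        (\<forall>\<rho>. (\<Sum>x\<in>Pi\<^sub>E P B'. \<Sum>y\<in>Pi\<^sub>E P B'. R x y * \<Lambda> \<rho> x y) =
              (\<Sum>x\<in>Pi\<^sub>E P B. \<Sum>y\<in>Pi\<^sub>E P B. Q x y * \<rho> x y)))"

lemma effect_refl: "effect P B R B R"
  unfolding effect_def by (blast intro: locc.stop)

lemma effect_cong:
  assumes "effect P B' R B Q"
    and "\<And>x y. x \<in> Pi\<^sub>E P B \<Longrightarrow> y \<in> Pi\<^sub>E P B \<Longrightarrow> Q x y = Q' x y"
  shows "effect P B' R B Q'"
proof -
  have "(\<Sum>x\<in>Pi\<^sub>E P B. \<Sum>y\<in>Pi\<^sub>E P B. Q x y * \<rho> x y) =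
        (\<Sum>x\<in>Pi\<^sub>E P B. \<Sum>y\<in>Pi\<^sub>E P B. Q' x y * \<rho> x y)" for \<rho>
    using assms(2) by (intro sum.cong refl) auto
  with assms(1) show ?thesis
    unfolding effect_def by simp
qed

text \<open>The sums are rearranged so that the label of \<open>p\<close> before the action becomes
  the outer index; the bracket is then the dual of the Kraus operator applied to
  \<open>Q\<close>.\<close>

lemma local_kraus_adjoint:
  assumes "p \<in> P"
  shows "(\<Sum>x\<in>Pi\<^sub>E P (B(p := C)). \<Sum>y\<in>Pi\<^sub>E P (B(p := C)). Q x y * local_kraus p (B p) K \<rho> x y) =
         (\<Sum>x\<in>Pi\<^sub>E P B. \<Sum>y\<in>Pi\<^sub>E P B.
            (\<Sum>l\<in>C. \<Sum>l'\<in>C. K l (x p) * cnj (K l' (y p)) * Q (x(p := l)) (y(p := l'))) * \<rho> x y)"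
    (is "?L = ?R")
proof -
  let ?X = "Pi\<^sub>E P (B(p := C))" and ?Y = "Pi\<^sub>E P B"
  define g where "g x x' y y' = Q x y * (K (x p) (x' p) * \<rho> x' y' * cnj (K (y p) (y' p)))"
    for x x' y y'
  have "?L = (\<Sum>x\<in>?X. \<Sum>y\<in>?X. \<Sum>i\<in>B p. \<Sum>j\<in>B p. g x (x(p := i)) y (y(p := j)))"
    unfolding local_kraus_def g_def by (simp add: sum_distrib_left)
  also have "\<dots> = (\<Sum>x\<in>?X. \<Sum>i\<in>B p. \<Sum>y\<in>?X. \<Sum>j\<in>B p. g x (x(p := i)) y (y(p := j)))"
    by (rule sum.cong[OF refl sum.swap])
  also have "\<dots> = (\<Sum>x\<in>?X. \<Sum>i\<in>B p. \<Sum>y\<in>?Y. \<Sum>l'\<in>C. g x (x(p := i)) (y(p := l')) y)"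
    by (rule sum.cong[OF refl], rule sum.cong[OF refl], rule sum_PiE_upd, rule assms)
  also have "\<dots> = (\<Sum>x\<in>?Y. \<Sum>l\<in>C. \<Sum>y\<in>?Y. \<Sum>l'\<in>C. g (x(p := l)) x (y(p := l')) y)"
    by (rule sum_PiE_upd[where f = "\<lambda>x x'. \<Sum>y\<in>?Y. \<Sum>l'\<in>C. g x x' (y(p := l')) y", OF assms])
  also have "\<dots> = (\<Sum>x\<in>?Y. \<Sum>y\<in>?Y. \<Sum>l\<in>C. \<Sum>l'\<in>C. g (x(p := l)) x (y(p := l')) y)"
    by (rule sum.cong[OF refl sum.swap])
  also have "\<dots> = ?R"
    unfolding g_def by (simp add: sum_distrib_left sum_distrib_right mult_ac)
  finally show ?thesis .
qed

text \<open>Outcomes may be indexed by any finite set, which is enumerated here because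
  \<open>locc\<close> expects an initial segment of the naturals. Later measurements can thus be
  labelled by their natural data.\<close>

lemma effect_step:
  assumes "p \<in> P" and "finite I" and "\<And>i. i \<in> I \<Longrightarrow> finite (C i)"
    and complete: "\<And>z z'. z \<in> B p \<Longrightarrow> z' \<in> B p \<Longrightarrow>
           (\<Sum>i\<in>I. \<Sum>l\<in>C i. cnj (K i l z) * K i l z') = (if z = z' then 1 else 0)"
    and eff: "\<And>i. i \<in> I \<Longrightarrow> effect P B' R (B(p := C i)) (Q i)"
  shows "effect P B' R B
           (\<lambda>x y. \<Sum>i\<in>I. \<Sum>l\<in>C i. \<Sum>l'\<in>C i.
              K i l (x p) * cnj (K i l' (y p)) * Q i (x(p := l)) (y(p := l')))"
proof -
  obtain e where e: "bij_betw e {..<card I} I"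
    using ex_bij_betw_nat_finite[OF \<open>finite I\<close>] atLeast0LessThan by metis
  have eI: "e m \<in> I" if "m < card I" for m
    using e that by (auto simp: bij_betw_def)
  have reindex: "(\<Sum>m<card I. F (e m)) = sum F I" for F :: "_ \<Rightarrow> complex"
    by (rule sum.reindex_bij_betw[OF e])
  have "\<forall>i\<in>I. \<exists>\<Lambda>. locc P (B(p := C i)) B' \<Lambda> \<and>
     (\<forall>\<rho>. (\<Sum>x\<in>Pi\<^sub>E P B'. \<Sum>y\<in>Pi\<^sub>E P B'. R x y * \<Lambda> \<rho> x y) =
       (\<Sum>x\<in>Pi\<^sub>E P (B(p := C i)). \<Sum>y\<in>Pi\<^sub>E P (B(p := C i)). Q i x y * \<rho> x y))"
    using eff unfolding effect_def by blast
  from bchoice[OF this] obtain \<Lambda> where \<Lambda>: "\<And>i. i \<in> I \<Longrightarrow> locc P (B(p := C i)) B' (\<Lambda> i)"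
    and pull: "\<And>i \<rho>. i \<in> I \<Longrightarrow> (\<Sum>x\<in>Pi\<^sub>E P B'. \<Sum>y\<in>Pi\<^sub>E P B'. R x y * \<Lambda> i \<rho> x y) =
       (\<Sum>x\<in>Pi\<^sub>E P (B(p := C i)). \<Sum>y\<in>Pi\<^sub>E P (B(p := C i)). Q i x y * \<rho> x y)"
    by blast
  define L where "L = (\<lambda>\<rho> x y. \<Sum>m<card I. \<Lambda> (e m) (local_kraus p (B p) (K (e m)) \<rho>) x y)"
  have "locc P B B' L"
    unfolding L_def
  proof (rule locc.step[where C = "\<lambda>m. C (e m)"])
    show "(\<Sum>m<card I. \<Sum>l\<in>C (e m). cnj (K (e m) l i) * K (e m) l j) = (if i = j then 1 else 0)"
      if "i \<in> B p" "j \<in> B p" for i j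
      using complete[OF that] reindex[of "\<lambda>m. \<Sum>l\<in>C m. cnj (K m l i) * K m l j"] by simp
  qed (use assms eI \<Lambda> in auto)
  moreover have "(\<Sum>x\<in>Pi\<^sub>E P B'. \<Sum>y\<in>Pi\<^sub>E P B'. R x y * L \<rho> x y) =
      (\<Sum>x\<in>Pi\<^sub>E P B. \<Sum>y\<in>Pi\<^sub>E P B. (\<Sum>i\<in>I. \<Sum>l\<in>C i. \<Sum>l'\<in>C i.
         K i l (x p) * cnj (K i l' (y p)) * Q i (x(p := l)) (y(p := l'))) * \<rho> x y)" for \<rho>
  proof -
    have "(\<Sum>x\<in>Pi\<^sub>E P B'. \<Sum>y\<in>Pi\<^sub>E P B'. R x y * L \<rho> x y) =
        (\<Sum>x\<in>Pi\<^sub>E P B'. \<Sum>y\<in>Pi\<^sub>E P B'. \<Sum>i\<in>I. R x y * \<Lambda> i (local_kraus p (B p) (K i) \<rho>) x y)"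
    proof (intro sum.cong refl)
      fix x y
      show "R x y * L \<rho> x y = (\<Sum>i\<in>I. R x y * \<Lambda> i (local_kraus p (B p) (K i) \<rho>) x y)"
        unfolding L_def using reindex[of "\<lambda>i. \<Lambda> i (local_kraus p (B p) (K i) \<rho>) x y"]
        by (simp only: sum_distrib_left)
    qed
    also have "\<dots> = (\<Sum>x\<in>Pi\<^sub>E P B'. \<Sum>i\<in>I. \<Sum>y\<in>Pi\<^sub>E P B'. R x y * \<Lambda> i (local_kraus p (B p) (K i) \<rho>) x y)"
      by (rule sum.cong[OF refl sum.swap])
    also have "\<dots> = (\<Sum>i\<in>I. \<Sum>x\<in>Pi\<^sub>E P B'. \<Sum>y\<in>Pi\<^sub>E P B'. R x y * \<Lambda> i (local_kraus p (B p) (K i) \<rho>) x y)"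
      by (rule sum.swap)
    also have "\<dots> = (\<Sum>i\<in>I. \<Sum>x\<in>Pi\<^sub>E P B. \<Sum>y\<in>Pi\<^sub>E P B.
         (\<Sum>l\<in>C i. \<Sum>l'\<in>C i. K i l (x p) * cnj (K i l' (y p)) * Q i (x(p := l)) (y(p := l'))) * \<rho> x y)"
      by (rule sum.cong[OF refl]) (simp add: pull local_kraus_adjoint[OF \<open>p \<in> P\<close>])
    also have "\<dots> = (\<Sum>x\<in>Pi\<^sub>E P B. \<Sum>i\<in>I. \<Sum>y\<in>Pi\<^sub>E P B.
         (\<Sum>l\<in>C i. \<Sum>l'\<in>C i. K i l (x p) * cnj (K i l' (y p)) * Q i (x(p := l)) (y(p := l'))) * \<rho> x y)"
      by (rule sum.swap)
    also have "\<dots> = (\<Sum>x\<in>Pi\<^sub>E P B. \<Sum>y\<in>Pi\<^sub>E P B. \<Sum>i\<in>I.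
         (\<Sum>l\<in>C i. \<Sum>l'\<in>C i. K i l (x p) * cnj (K i l' (y p)) * Q i (x(p := l)) (y(p := l'))) * \<rho> x y)"
      by (rule sum.cong[OF refl sum.swap])
    finally show ?thesis
      by (simp add: sum_distrib_right)
  qed
  ultimately show ?thesis
    unfolding effect_def by blast
qed

text \<open>The Kraus operators read off \<open>\<tau>\<close> and keep \<open>\<pi>\<close>;
  injectivity of the pair makes them complete. Forgetting the outcome is a partial trace, hence the
  Kronecker delta in \<open>\<tau>\<close>.\<close>

lemma effect_trace_out:
  assumes "p \<in> P" and "finite (B p)" and "finite V" and "\<pi> ` B p \<subseteq> V"
    and inj: "inj_on (\<lambda>z. (\<pi> z, \<tau> z)) (B p)"
    and eff: "effect P B' R (B(p := V)) Q"
  shows "effect P B' R B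
           (\<lambda>x y. of_bool (\<tau> (x p) = \<tau> (y p)) * Q (x(p := \<pi> (x p))) (y(p := \<pi> (y p))))"
proof -
  define K where "K w l z = (of_bool (l = \<pi> z \<and> w = \<tau> z) :: complex)" for w l z
  have fin: "finite (\<tau> ` B p)" using assms by simp
  have K: "K w l z = (if w = \<tau> z then (if l = \<pi> z then 1 else 0) else 0)" for w l z
    by (simp add: K_def)
  have "effect P B' R B (\<lambda>x y. \<Sum>w\<in>\<tau> ` B p. \<Sum>l\<in>V. \<Sum>l'\<in>V.
              K w l (x p) * cnj (K w l' (y p)) * Q (x(p := l)) (y(p := l')))"
  proof (rule effect_step[OF assms(1) fin])
    fix z z' assume z: "z \<in> B p" "z' \<in> B p"
    have "(\<Sum>w\<in>\<tau> ` B p. \<Sum>l\<in>V. cnj (K w l z) * K w l z') =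
          (\<Sum>w\<in>\<tau> ` B p. if w = \<tau> z then \<Sum>l\<in>V. if l = \<pi> z then K w l z' else 0 else 0)"
      by (intro sum.cong refl) (auto simp: K intro!: sum.cong)
    also have "\<dots> = K (\<tau> z) (\<pi> z) z'"
      using z assms(3,4) fin by auto
    also have "\<dots> = (if z = z' then 1 else 0)"
      using inj_onD[OF inj _ z] by (auto simp: K_def)
    finally show "(\<Sum>w\<in>\<tau> ` B p. \<Sum>l\<in>V. cnj (K w l z) * K w l z') = (if z = z' then 1 else 0)" .
  qed (use assms eff in auto)
  then show ?thesis
  proof (rule effect_cong)
    fix x y assume "x \<in> Pi\<^sub>E P B" "y \<in> Pi\<^sub>E P B"
    then have xy: "x p \<in> B p" "y p \<in> B p" using \<open>p \<in> P\<close> by auto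
    have "(\<Sum>w\<in>\<tau> ` B p. \<Sum>l\<in>V. \<Sum>l'\<in>V. K w l (x p) * cnj (K w l' (y p)) * Q (x(p := l)) (y(p := l'))) =
       (\<Sum>w\<in>\<tau> ` B p. if w = \<tau> (x p) then \<Sum>l\<in>V. if l = \<pi> (x p) then \<Sum>l'\<in>V. if l' = \<pi> (y p)
          then (if w = \<tau> (y p) then Q (x(p := l)) (y(p := l')) else 0) else 0 else 0 else 0)"
      by (intro sum.cong refl) (auto simp: K intro!: sum.cong)
    also have "\<dots> = of_bool (\<tau> (x p) = \<tau> (y p)) * Q (x(p := \<pi> (x p))) (y(p := \<pi> (y p)))"
      using xy assms(3,4) fin by (auto simp: image_subset_iff intro!: sum.neutral)
    finally show "(\<Sum>w\<in>\<tau> ` B p. \<Sum>l\<in>V. \<Sum>l'\<in>V.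
        K w l (x p) * cnj (K w l' (y p)) * Q (x(p := l)) (y(p := l'))) =
        of_bool (\<tau> (x p) = \<tau> (y p)) * Q (x(p := \<pi> (x p))) (y(p := \<pi> (y p)))" .
  qed
qed

lemma effect_trace_out_all:
  assumes "finite S" and "S \<subseteq> P"
    and "\<And>g. g \<in> S \<Longrightarrow> finite (B g)" and "\<And>g. g \<in> S \<Longrightarrow> finite (V g)"
    and "\<And>g. g \<in> S \<Longrightarrow> \<pi> g ` B g \<subseteq> V g"
    and "\<And>g. g \<in> S \<Longrightarrow> inj_on (\<lambda>z. (\<pi> g z, \<tau> g z)) (B g)"
    and "effect P B' R (\<lambda>g. if g \<in> S then V g else B g) Q"
  shows "effect P B' R B
           (\<lambda>x y. of_bool (\<forall>g\<in>S. \<tau> g (x g) = \<tau> g (y g)) *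
              Q (\<lambda>g. if g \<in> S then \<pi> g (x g) else x g) (\<lambda>g. if g \<in> S then \<pi> g (y g) else y g))"
  using assms
proof (induction S arbitrary: B rule: finite_induct)
  case empty
  then show ?case by simp
next
  case (insert p S)
  have "(\<lambda>g. if g \<in> S then V g else (B(p := V p)) g) = (\<lambda>g. if g \<in> insert p S then V g else B g)"
    using insert.hyps by (auto simp: fun_eq_iff)
  then have "effect P B' R (B(p := V p))
           (\<lambda>x y. of_bool (\<forall>g\<in>S. \<tau> g (x g) = \<tau> g (y g)) *
              Q (\<lambda>g. if g \<in> S then \<pi> g (x g) else x g) (\<lambda>g. if g \<in> S then \<pi> g (y g) else y g))"
    using insert.prems insert.hyps by (intro insert.IH) (auto split: if_splits)
  then have "effect P B' R B
     (\<lambda>x y. of_bool (\<tau> p (x p) = \<tau> p (y p)) *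
        (of_bool (\<forall>g\<in>S. \<tau> g ((x(p := \<pi> p (x p))) g) = \<tau> g ((y(p := \<pi> p (y p))) g)) *
         Q (\<lambda>g. if g \<in> S then \<pi> g ((x(p := \<pi> p (x p))) g) else (x(p := \<pi> p (x p))) g)
           (\<lambda>g. if g \<in> S then \<pi> g ((y(p := \<pi> p (y p))) g) else (y(p := \<pi> p (y p))) g)))"
    using insert.prems by (intro effect_trace_out[where V = "V p"]) auto
  moreover have "(\<lambda>g. if g \<in> S then \<pi> g ((x(p := \<pi> p (x p))) g) else (x(p := \<pi> p (x p))) g) =
      (\<lambda>g. if g \<in> insert p S then \<pi> g (x g) else x g)" for x
    using insert.hyps by auto
  moreover have "(\<forall>g\<in>S. \<tau> g ((x(p := \<pi> p (x p))) g) = \<tau> g ((y(p := \<pi> p (y p))) g)) \<longleftrightarrow>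
      (\<forall>g\<in>S. \<tau> g (x g) = \<tau> g (y g))" for x y
    using insert.hyps by auto
  ultimately show ?case
    by (elim effect_cong) auto
qed

section \<open>Probabilistic filters and their failure outcomes\<close>

text \<open>This supplies the failure outcomes of a filter: \<open>\<kappa>\<close> times the
  indicator is the square of the success operator, and the rows \<open>r i\<close> factor what
  remains of the identity. The bound on \<open>\<kappa>\<close> makes the remainder diagonally
  dominant.\<close>

lemma rank_one_completion:
  fixes h :: "'u \<Rightarrow> 'l" and \<kappa> :: real
  assumes "finite U" and "D \<subseteq> U" and "0 \<le> \<kappa>" and "\<kappa> * card U \<le> 1"
  shows "\<exists>r :: bool \<times> 'u \<times> 'u \<Rightarrow> 'u \<Rightarrow> real. \<forall>u\<in>U. \<forall>u'\<in>U.
    (\<Sum>i\<in>UNIV \<times> U \<times> U. r i u * r i u') =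
    of_bool (u = u') - \<kappa> * of_bool (u \<in> D \<and> u' \<in> D \<and> h u = h u')"
proof -
  define E where "E s t \<longleftrightarrow> s \<in> D \<and> t \<in> D \<and> h s = h t" for s t
  define deg where "deg s = (\<Sum>t\<in>U. of_bool (E s t) :: real)" for s
  \<comment> \<open>The rows come from writing the Laplacian of the graph \<open>E\<close> as the sum of the
      squares \<open>(e\<^sub>s - e\<^sub>t)(e\<^sub>s - e\<^sub>t)\<^sup>T\<close> over its edges.\<close>
  define r where "r i u = (case i of (b, s, t) \<Rightarrow>
     if b then of_bool (s = t) * sqrt (1 - \<kappa> * deg s) * of_bool (u = s)
     else sqrt (\<kappa> / 2) * of_bool (E s t) * (of_bool (u = s) - of_bool (u = t)))" for i u
  have deg_le: "\<kappa> * deg s \<le> 1" for s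
  proof -
    have "deg s \<le> card U"
      unfolding deg_def using sum_bounded_above[of U "\<lambda>t. of_bool (E s t) :: real" 1] by simp
    then show ?thesis
      using assms(3,4) mult_left_mono[of "deg s" "card U" \<kappa>] by simp
  qed
  \<comment> \<open>The factor \<open>1 / 2\<close> compensates for the sum over ordered pairs,
    which meets each edge twice.\<close>
  have half: "sqrt (\<kappa> / 2) * (sqrt (\<kappa> / 2) * 2) = \<kappa>"
    using assms(3) by (simp flip: mult.assoc)
  have E_sym: "E s t = E t s" for s t by (auto simp: E_def)
  have "(\<Sum>i\<in>UNIV \<times> U \<times> U. r i u * r i u') = of_bool (u = u') - \<kappa> * of_bool (E u u')"
    if u: "u \<in> U" "u' \<in> U" for u u'
  proof -
    have diag: "(\<Sum>s\<in>U. \<Sum>t\<in>U. r (True, s, t) u * r (True, s, t) u') =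
        of_bool (u = u') * (1 - \<kappa> * deg u)"
    proof -
      have "(\<Sum>s\<in>U. \<Sum>t\<in>U. r (True, s, t) u * r (True, s, t) u') =
          (\<Sum>s\<in>U. \<Sum>t\<in>U. if t = s then (if s = u then of_bool (u = u') * (1 - \<kappa> * deg u) else 0) else 0)"
        by (intro sum.cong refl) (auto simp: r_def deg_le)
      then show ?thesis using u assms(1) by simp
    qed
    have edge: "(\<Sum>t\<in>U. r (False, s, t) u * r (False, s, t) u') =
      \<kappa> / 2 * (of_bool (s = u \<and> u = u') * deg u - of_bool (s = u) * of_bool (E u u')
        - of_bool (s = u') * of_bool (E u u') + of_bool (u = u') * of_bool (E s u))" for s
    proof -
      have "(\<Sum>t\<in>U. r (False, s, t) u * r (False, s, t) u') =
        (\<Sum>t\<in>U. \<kappa> / 2 * (of_bool (s = u \<and> u = u') * of_bool (E s t)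
          - (if t = u' then of_bool (s = u) * of_bool (E s u') else 0)
          - (if t = u then of_bool (s = u') * of_bool (E s u) else 0)
          + (if t = u then of_bool (u = u') * of_bool (E s u) else 0)))"
        by (intro sum.cong refl) (auto simp: r_def half)
      also have "\<dots> = \<kappa> / 2 * (of_bool (s = u \<and> u = u') * deg s
          - of_bool (s = u) * of_bool (E s u') - of_bool (s = u') * of_bool (E s u)
          + of_bool (u = u') * of_bool (E s u))"
        using u assms(1)
        by (simp only: sum_distrib_left[symmetric] sum.distrib sum_subtractf deg_def
            sum.delta if_True)
      finally show ?thesis by (auto simp: E_sym)
    qed
    have "(\<Sum>s\<in>U. \<Sum>t\<in>U. r (False, s, t) u * r (False, s, t) u') =
        \<kappa> * (of_bool (u = u') * deg u - of_bool (E u u'))"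
    proof -
      have "(\<Sum>s\<in>U. \<Sum>t\<in>U. r (False, s, t) u * r (False, s, t) u') =
        (\<Sum>s\<in>U. \<kappa> / 2 * ((if s = u then of_bool (u = u') * deg u else 0)
          - (if s = u then of_bool (E u u') else 0)
          - (if s = u' then of_bool (E u u') else 0) + of_bool (u = u') * of_bool (E u s)))"
        by (intro sum.cong refl) (auto simp: edge E_sym)
      also have "\<dots> = \<kappa> / 2 * (of_bool (u = u') * deg u - of_bool (E u u') - of_bool (E u u')
          + of_bool (u = u') * deg u)"
        using u assms(1)
        by (simp only: sum_distrib_left[symmetric] sum.distrib sum_subtractf deg_def
            sum.delta if_True)
      finally show ?thesis by (simp add: algebra_simps)
    qed
    with diag show ?thesis
      by (simp add: sum.cartesian_product'[symmetric] UNIV_bool algebra_simps sum.cartesian_product')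
  qed
  then show ?thesis
    unfolding E_def by blast
qed

text \<open>A label splits into the earlier copies \<open>\<pi> z\<close> and the block
  \<open>\<tau> z\<close> to be filtered. Success maps \<open>z\<close> coherently to
  \<open>\<phi> z\<close>, which retains exactly \<open>\<pi> z\<close> and
  \<open>h (\<tau> z)\<close>; failure retains only \<open>\<pi> z\<close>.\<close>

lemma effect_filter:
  fixes h :: "'u \<Rightarrow> 'l" and \<kappa> :: real
  assumes "p \<in> P" and "finite (B p)" and "finite C" and "finite V" and "finite U"
    and "\<pi> ` B p \<subseteq> V" and "\<tau> ` B p \<subseteq> U" and "D \<subseteq> U"
    and inj: "inj_on (\<lambda>z. (\<pi> z, \<tau> z)) (B p)"
    and \<phi>: "\<phi> ` B p \<subseteq> C"
    and \<phi>_eq: "\<And>z z'. z \<in> B p \<Longrightarrow> z' \<in> B p \<Longrightarrow> \<phi> z = \<phi> z' \<longleftrightarrow> \<pi> z = \<pi> z' \<and> h (\<tau> z) = h (\<tau> z')"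
    and \<kappa>: "0 \<le> \<kappa>" "\<kappa> * card U \<le> 1"
    and success: "effect P B' R (B(p := C)) Q"
    and failure: "effect P B' R (B(p := V)) Q'"
  shows "effect P B' R B (\<lambda>x y.
      complex_of_real \<kappa> * of_bool (\<tau> (x p) \<in> D \<and> \<tau> (y p) \<in> D) * Q (x(p := \<phi> (x p))) (y(p := \<phi> (y p))) +
      (of_bool (\<tau> (x p) = \<tau> (y p)) -
         complex_of_real \<kappa> * of_bool (\<tau> (x p) \<in> D \<and> \<tau> (y p) \<in> D \<and> h (\<tau> (x p)) = h (\<tau> (y p)))) *
      Q' (x(p := \<pi> (x p))) (y(p := \<pi> (y p))))"
proof -
  obtain r :: "bool \<times> 'u \<times> 'u \<Rightarrow> 'u \<Rightarrow> real" where r: "\<And>u u'. u \<in> U \<Longrightarrow> u' \<in> U \<Longrightarrow>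
      (\<Sum>i\<in>UNIV \<times> U \<times> U. r i u * r i u') =
      of_bool (u = u') - \<kappa> * of_bool (u \<in> D \<and> u' \<in> D \<and> h u = h u')"
    using rank_one_completion[OF \<open>finite U\<close> \<open>D \<subseteq> U\<close> \<kappa>, of h] by blast
  have rc: "(\<Sum>i\<in>UNIV \<times> U \<times> U. complex_of_real (r i u) * r i u') =
      of_bool (u = u') - \<kappa> * of_bool (u \<in> D \<and> u' \<in> D \<and> h u = h u')"
    if "u \<in> U" "u' \<in> U" for u u'
    using arg_cong[OF r[OF that], of complex_of_real] by simp
  have fin: "finite ((UNIV :: bool set) \<times> U \<times> U)"
    using \<open>finite U\<close> by (intro finite_cartesian_product) simp_all
  \<comment> \<open>\<open>None\<close> is the success outcome; each \<open>Some j\<close> is a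
    failure outcome that applies the row \<open>r j\<close> to the block.\<close>
  define I where "I = insert None (Some ` ((UNIV :: bool set) \<times> U \<times> U))"
  define CC where "CC i = (case i of None \<Rightarrow> C | Some _ \<Rightarrow> V)" for i :: "(bool \<times> 'u \<times> 'u) option"
  define QQ where "QQ i = (case i of None \<Rightarrow> Q | Some _ \<Rightarrow> Q')" for i :: "(bool \<times> 'u \<times> 'u) option"
  define K where "K i l z = complex_of_real (case i of
      None \<Rightarrow> if l = \<phi> z then sqrt \<kappa> * of_bool (\<tau> z \<in> D) else 0
    | Some j \<Rightarrow> if l = \<pi> z then r j (\<tau> z) else 0)" for i l z
  have sumI: "(\<Sum>i\<in>I. F i) = F None + (\<Sum>j\<in>UNIV \<times> U \<times> U. F (Some j))" for F :: "_ \<Rightarrow> complex"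
    unfolding I_def using fin by (subst sum.insert) (auto simp: sum.reindex)
  have in_U: "\<tau> z \<in> U" "\<pi> z \<in> V" "\<phi> z \<in> C" if "z \<in> B p" for z
    using that assms by auto
  have sq: "complex_of_real (sqrt \<kappa>) * complex_of_real (sqrt \<kappa>) = \<kappa>"
    using \<kappa> by (simp flip: of_real_mult)
  have "effect P B' R B (\<lambda>x y. \<Sum>i\<in>I. \<Sum>l\<in>CC i. \<Sum>l'\<in>CC i.
              K i l (x p) * cnj (K i l' (y p)) * QQ i (x(p := l)) (y(p := l')))"
  proof (rule effect_step[OF assms(1)])
    fix z z' assume z: "z \<in> B p" "z' \<in> B p"
    have "(\<Sum>l\<in>C. cnj (K None l z) * K None l z') =
       (\<Sum>l\<in>C. if l = \<phi> z then complex_of_real \<kappa> * of_bool (\<tau> z \<in> D \<and> \<tau> z' \<in> D \<and> \<phi> z = \<phi> z') else 0)"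
      by (intro sum.cong refl) (auto simp: K_def sq)
    also have "\<dots> = complex_of_real \<kappa> * of_bool (\<tau> z \<in> D \<and> \<tau> z' \<in> D \<and> \<phi> z = \<phi> z')"
      using in_U[OF z(1)] \<open>finite C\<close> by simp
    finally have 1: "(\<Sum>l\<in>C. cnj (K None l z) * K None l z') = \<dots>" .
    have "(\<Sum>l\<in>V. cnj (K (Some j) l z) * K (Some j) l z') =
       (\<Sum>l\<in>V. if l = \<pi> z then of_bool (\<pi> z = \<pi> z') * (complex_of_real (r j (\<tau> z)) * r j (\<tau> z')) else 0)" for j
      by (intro sum.cong refl) (auto simp: K_def)
    then have 2: "(\<Sum>l\<in>V. cnj (K (Some j) l z) * K (Some j) l z') =
       of_bool (\<pi> z = \<pi> z') * (complex_of_real (r j (\<tau> z)) * r j (\<tau> z'))" for j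
      using in_U[OF z(1)] \<open>finite V\<close> by simp
    have "(\<Sum>i\<in>I. \<Sum>l\<in>CC i. cnj (K i l z) * K i l z') =
        complex_of_real \<kappa> * of_bool (\<tau> z \<in> D \<and> \<tau> z' \<in> D \<and> \<phi> z = \<phi> z') +
        of_bool (\<pi> z = \<pi> z') * (of_bool (\<tau> z = \<tau> z')
          - \<kappa> * of_bool (\<tau> z \<in> D \<and> \<tau> z' \<in> D \<and> h (\<tau> z) = h (\<tau> z')))"
      unfolding sumI using rc[of "\<tau> z" "\<tau> z'"] in_U[OF z(1)] in_U[OF z(2)]
      by (simp add: CC_def 1 2 sum_distrib_left[symmetric])
    also have "\<dots> = (if z = z' then 1 else 0)"
      using \<phi>_eq[OF z] inj_onD[OF inj _ z] by (auto simp: of_bool_def)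
    finally show "(\<Sum>i\<in>I. \<Sum>l\<in>CC i. cnj (K i l z) * K i l z') = (if z = z' then 1 else 0)" .
  qed (use assms fin in \<open>auto simp: I_def CC_def QQ_def\<close>)
  then show ?thesis
  proof (rule effect_cong)
    fix x y assume "x \<in> Pi\<^sub>E P B" "y \<in> Pi\<^sub>E P B"
    then have xy: "x p \<in> B p" "y p \<in> B p" using \<open>p \<in> P\<close> by auto
    have "(\<Sum>l\<in>C. \<Sum>l'\<in>C. K None l (x p) * cnj (K None l' (y p)) * QQ None (x(p := l)) (y(p := l'))) =
       (\<Sum>l\<in>C. if l = \<phi> (x p) then \<Sum>l'\<in>C. if l' = \<phi> (y p) then
          complex_of_real \<kappa> * of_bool (\<tau> (x p) \<in> D \<and> \<tau> (y p) \<in> D) * Q (x(p := l)) (y(p := l')) else 0 else 0)"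
      by (intro sum.cong refl) (auto simp: K_def QQ_def sq cong: if_cong intro!: sum.cong)
    also have "\<dots> = complex_of_real \<kappa> * of_bool (\<tau> (x p) \<in> D \<and> \<tau> (y p) \<in> D) * Q (x(p := \<phi> (x p))) (y(p := \<phi> (y p)))"
      using in_U[OF xy(1)] in_U[OF xy(2)] \<open>finite C\<close> by (simp only: sum.delta if_True)
    finally have 1: "(\<Sum>l\<in>C. \<Sum>l'\<in>C. K None l (x p) * cnj (K None l' (y p)) *
        QQ None (x(p := l)) (y(p := l'))) = \<dots>" .
    have 2: "(\<Sum>l\<in>V. \<Sum>l'\<in>V. K (Some j) l (x p) * cnj (K (Some j) l' (y p)) *
        QQ (Some j) (x(p := l)) (y(p := l'))) =
       complex_of_real (r j (\<tau> (x p))) * r j (\<tau> (y p)) * Q' (x(p := \<pi> (x p))) (y(p := \<pi> (y p)))" for j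
    proof -
      have "(\<Sum>l\<in>V. \<Sum>l'\<in>V. K (Some j) l (x p) * cnj (K (Some j) l' (y p)) *
          QQ (Some j) (x(p := l)) (y(p := l'))) =
       (\<Sum>l\<in>V. if l = \<pi> (x p) then \<Sum>l'\<in>V. if l' = \<pi> (y p) then
          complex_of_real (r j (\<tau> (x p))) * r j (\<tau> (y p)) * Q' (x(p := l)) (y(p := l')) else 0 else 0)"
        by (intro sum.cong refl) (auto simp: K_def QQ_def intro!: sum.cong)
      then show ?thesis
        using in_U[OF xy(1)] in_U[OF xy(2)] \<open>finite V\<close> by (simp only: sum.delta if_True)
    qed
    show "(\<Sum>i\<in>I. \<Sum>l\<in>CC i. \<Sum>l'\<in>CC i. K i l (x p) * cnj (K i l' (y p)) * QQ i (x(p := l)) (y(p := l'))) =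
      complex_of_real \<kappa> * of_bool (\<tau> (x p) \<in> D \<and> \<tau> (y p) \<in> D) * Q (x(p := \<phi> (x p))) (y(p := \<phi> (y p))) +
      (of_bool (\<tau> (x p) = \<tau> (y p)) -
         complex_of_real \<kappa> * of_bool (\<tau> (x p) \<in> D \<and> \<tau> (y p) \<in> D \<and> h (\<tau> (x p)) = h (\<tau> (y p)))) *
      Q' (x(p := \<pi> (x p))) (y(p := \<pi> (y p)))"
      unfolding sumI using rc[of "\<tau> (x p)" "\<tau> (y p)"] in_U[OF xy(1)] in_U[OF xy(2)]
      by (simp add: CC_def 1 2 sum_distrib_right[symmetric])
  qed
qed

lemma if_eq_restrict:
  "x \<in> Pi\<^sub>E P B \<Longrightarrow> (\<lambda>g. if g \<in> P then f g (x g) else x g) = (\<lambda>g\<in>P. f g (x g))"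
  by (auto simp: PiE_iff extensional_def)

text \<open>The parties filter in turn; as soon as one fails, all others discard their blocks and
  the protocol behind \<open>Q'\<close> takes over. Discarding erases which party failed, so the
  failure terms telescope to the block identity minus the success effect.\<close>

lemma effect_trial:
  fixes h :: "'s \<Rightarrow> 'u \<Rightarrow> 'b" and \<kappa> :: real
  assumes P: "finite P"
    and fin: "\<And>g. g \<in> P \<Longrightarrow> finite (B g)" "\<And>g. g \<in> P \<Longrightarrow> finite (V g)"
      "\<And>g. g \<in> P \<Longrightarrow> finite (U g)" "\<And>g. g \<in> P \<Longrightarrow> finite (B' g)"
    and outside: "\<And>g. g \<notin> P \<Longrightarrow> B g = B' g" "\<And>g. g \<notin> P \<Longrightarrow> V g = B' g"
    and D: "\<And>g. g \<in> P \<Longrightarrow> D g \<subseteq> U g"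
    and bij: "\<And>g. g \<in> P \<Longrightarrow> bij_betw (\<lambda>z. (\<pi> g z, \<tau> g z)) (B g) (V g \<times> U g)"
    and h: "\<And>g u. g \<in> P \<Longrightarrow> u \<in> U g \<Longrightarrow> h g u \<in> B' g"
    and c: "\<And>g u. g \<in> P \<Longrightarrow> u \<in> U g \<Longrightarrow> c g (h g u) \<in> U g \<and> h g (c g (h g u)) = h g u"
    and \<kappa>: "0 \<le> \<kappa>" "\<And>g. g \<in> P \<Longrightarrow> \<kappa> * card (U g) \<le> 1"
    and eff: "effect P B' R V Q'"
  shows "effect P B' R B (\<lambda>x y.
      complex_of_real \<kappa> ^ card P *
        of_bool ((\<forall>g\<in>P. \<tau> g (x g) \<in> D g \<and> \<tau> g (y g) \<in> D g) \<and> (\<forall>g\<in>P. \<pi> g (x g) = \<pi> g (y g))) *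
        R (\<lambda>g\<in>P. h g (\<tau> g (x g))) (\<lambda>g\<in>P. h g (\<tau> g (y g))) +
      (of_bool (\<forall>g\<in>P. \<tau> g (x g) = \<tau> g (y g)) - complex_of_real \<kappa> ^ card P *
        of_bool (\<forall>g\<in>P. \<tau> g (x g) \<in> D g \<and> \<tau> g (y g) \<in> D g \<and> h g (\<tau> g (x g)) = h g (\<tau> g (y g)))) *
        Q' (\<lambda>g\<in>P. \<pi> g (x g)) (\<lambda>g\<in>P. \<pi> g (y g)))"
proof -
  \<comment> \<open>After a successful measurement the party keeps its outcome \<open>l\<close> as the canonical chunk \<open>c g l\<close>,
      so that all label sets stay fixed while the parties take their turns.\<close>
  define junk where "junk g z = (if \<tau> g z = c g (h g (\<tau> g z)) then None else Some (\<tau> g z))" for g z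
  define \<phi> where "\<phi> g z = inv_into (B g) (\<lambda>z. (\<pi> g z, \<tau> g z)) (\<pi> g z, c g (h g (\<tau> g z)))" for g z
  have in_VU: "\<pi> g z \<in> V g" "\<tau> g z \<in> U g" if "g \<in> P" "z \<in> B g" for g z
    using bij_betwE[OF bij[OF that(1)]] that(2) by auto
  have inj: "inj_on (\<lambda>z. (\<pi> g z, \<tau> g z)) (B g)" if "g \<in> P" for g
    using bij[OF that] by (rule bij_betw_imp_inj_on)
  have \<phi>: "\<phi> g z \<in> B g" "\<pi> g (\<phi> g z) = \<pi> g z" "\<tau> g (\<phi> g z) = c g (h g (\<tau> g z))"
    if "g \<in> P" "z \<in> B g" for g z
  proof -
    have *: "(\<pi> g z, c g (h g (\<tau> g z))) \<in> (\<lambda>z. (\<pi> g z, \<tau> g z)) ` B g"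
      using bij_betw_imp_surj_on[OF bij[OF that(1)]] in_VU[OF that] c[OF that(1)] by auto
    show "\<phi> g z \<in> B g" unfolding \<phi>_def by (rule inv_into_into[OF *])
    show "\<pi> g (\<phi> g z) = \<pi> g z" "\<tau> g (\<phi> g z) = c g (h g (\<tau> g z))"
      using f_inv_into_f[OF *] unfolding \<phi>_def by auto
  qed
  have h\<phi>: "h g (\<tau> g (\<phi> g z)) = h g (\<tau> g z)" "junk g (\<phi> g z) = None" if "g \<in> P" "z \<in> B g" for g z
    using \<phi>[OF that] c[OF that(1) in_VU(2)[OF that]] by (auto simp: junk_def)
  define hh where "hh x = (\<lambda>g\<in>P. h g (\<tau> g (x g)))" for x
  define pp where "pp x = (\<lambda>g\<in>P. \<pi> g (x g))" for x
  define X where "X F x y \<longleftrightarrow> (\<forall>g\<in>F. \<tau> g (x g) \<in> D g \<and> \<tau> g (y g) \<in> D g) \<and>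
      (\<forall>g\<in>P. \<pi> g (x g) = \<pi> g (y g)) \<and> (\<forall>g\<in>P - F. junk g (x g) = junk g (y g))" for F x y
  define Y where "Y F x y \<longleftrightarrow> (\<forall>g\<in>P - F. \<tau> g (x g) = \<tau> g (y g)) \<and>
      (\<forall>g\<in>F. \<tau> g (x g) \<in> D g \<and> \<tau> g (y g) \<in> D g \<and> h g (\<tau> g (x g)) = h g (\<tau> g (y g)))" for F x y
  define Q where "Q F x y = complex_of_real \<kappa> ^ card F * of_bool (X F x y) * R (hh x) (hh y) +
      (of_bool (\<forall>g\<in>P. \<tau> g (x g) = \<tau> g (y g)) - complex_of_real \<kappa> ^ card F * of_bool (Y F x y)) *
        Q' (pp x) (pp y)" for F x y
  \<comment> \<open>\<open>Q F\<close> is the effect when the parties in \<open>F\<close> have yet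
    to filter and the others are taken to have succeeded. The inserted party acts before those in
    \<open>F\<close>, so the induction runs backwards in time.\<close>
  have "effect P B' R B (Q F)" if "finite F" "F \<subseteq> P" for F
    using that
  proof (induction F rule: finite_induct)
    case empty
    have B': "(\<lambda>g. if g \<in> P then B' g else B g) = B'"
      using outside by (auto simp: fun_eq_iff)
    have "effect P B' R B (\<lambda>x y. of_bool (\<forall>g\<in>P. (\<pi> g (x g), junk g (x g)) = (\<pi> g (y g), junk g (y g))) *
        R (\<lambda>g. if g \<in> P then h g (\<tau> g (x g)) else x g) (\<lambda>g. if g \<in> P then h g (\<tau> g (y g)) else y g))"
    proof (rule effect_trace_out_all[OF P, where V = B' and Q = R
          and \<pi> = "\<lambda>g z. h g (\<tau> g z)" and \<tau> = "\<lambda>g z. (\<pi> g z, junk g z)"])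
      \<comment> \<open>If \<open>junk\<close> is \<open>None\<close>, the block is recovered from
        its \<open>h\<close> value through \<open>c\<close>; otherwise \<open>junk\<close> stores
        the block itself.\<close>
      show "inj_on (\<lambda>z. (h g (\<tau> g z), \<pi> g z, junk g z)) (B g)" if "g \<in> P" for g
      proof (rule inj_onI)
        fix z z' assume "z \<in> B g" "z' \<in> B g"
          "(h g (\<tau> g z), \<pi> g z, junk g z) = (h g (\<tau> g z'), \<pi> g z', junk g z')"
        then show "z = z'"
          using inj_onD[OF inj[OF that], of z z'] by (auto simp: junk_def split: if_splits)
      qed
      show "effect P B' R (\<lambda>g. if g \<in> P then B' g else B g) R"
        unfolding B' by (rule effect_refl)
      show "P \<subseteq> P" ..
      show "finite (B g)" if "g \<in> P" for g by (rule fin(1)[OF that])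
      show "finite (B' g)" if "g \<in> P" for g by (rule fin(4)[OF that])
      show "(\<lambda>z. h g (\<tau> g z)) ` B g \<subseteq> B' g" if "g \<in> P" for g
        using h[OF that in_VU(2)[OF that]] by blast
    qed
    then show ?case
    proof (rule effect_cong)
      fix x y assume xy: "x \<in> Pi\<^sub>E P B" "y \<in> Pi\<^sub>E P B"
      have "(\<lambda>g. if g \<in> P then h g (\<tau> g (x g)) else x g) = hh x"
        "(\<lambda>g. if g \<in> P then h g (\<tau> g (y g)) else y g) = hh y"
        unfolding hh_def by (fact if_eq_restrict[OF xy(1)] if_eq_restrict[OF xy(2)])+
      then show "of_bool (\<forall>g\<in>P. (\<pi> g (x g), junk g (x g)) = (\<pi> g (y g), junk g (y g))) *
        R (\<lambda>g. if g \<in> P then h g (\<tau> g (x g)) else x g) (\<lambda>g. if g \<in> P then h g (\<tau> g (y g)) else y g) = Q {} x y"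
        by (auto simp: Q_def X_def Y_def)
    qed
  next
    case (insert p F)
    then have p: "p \<in> P" and F: "F \<subseteq> P" by auto
    \<comment> \<open>After a failure the label of \<open>p\<close> is already reduced to its
      earlier copies, so only the remaining parties trace out their blocks.\<close>
    define Qf where "Qf x y = of_bool (\<forall>g\<in>P - {p}. \<tau> g (x g) = \<tau> g (y g)) *
       Q' (\<lambda>g. if g \<in> P - {p} then \<pi> g (x g) else x g) (\<lambda>g. if g \<in> P - {p} then \<pi> g (y g) else y g)" for x y
    have "(\<lambda>g. if g \<in> P - {p} then V g else (B(p := V p)) g) = V"
      using outside p by (auto simp: fun_eq_iff)
    then have "effect P B' R (B(p := V p)) Qf"
      unfolding Qf_def using P fin in_VU inj eff
      by (intro effect_trace_out_all[where V = V and \<pi> = \<pi> and \<tau> = \<tau> and Q = Q']) auto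
    moreover have "effect P B' R (B(p := B p)) (Q F)"
      using insert.IH[OF F] by simp
    ultimately have "effect P B' R B (\<lambda>x y.
      complex_of_real \<kappa> * of_bool (\<tau> p (x p) \<in> D p \<and> \<tau> p (y p) \<in> D p) * Q F (x(p := \<phi> p (x p))) (y(p := \<phi> p (y p))) +
      (of_bool (\<tau> p (x p) = \<tau> p (y p)) -
         complex_of_real \<kappa> * of_bool (\<tau> p (x p) \<in> D p \<and> \<tau> p (y p) \<in> D p \<and> h p (\<tau> p (x p)) = h p (\<tau> p (y p)))) *
      Qf (x(p := \<pi> p (x p))) (y(p := \<pi> p (y p))))"
    proof (intro effect_filter[where U = "U p" and \<pi> = "\<pi> p" and \<phi> = "\<phi> p" and D = "D p" and
          Q = "Q F" and Q' = Qf and C = "B p" and V = "V p" and \<tau> = "\<tau> p" and h = "h p"])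
      show "\<phi> p z = \<phi> p z' \<longleftrightarrow> \<pi> p z = \<pi> p z' \<and> h p (\<tau> p z) = h p (\<tau> p z')"
        if z: "z \<in> B p" "z' \<in> B p" for z z'
        using \<phi>[OF p z(1)] \<phi>[OF p z(2)] h\<phi>[OF p z(1)] h\<phi>[OF p z(2)]
        by (metis \<phi>_def)
    qed (simp_all add: p fin in_VU D inj \<phi> \<kappa> image_subset_iff)
    then show ?case
    proof (rule effect_cong)
      fix x y assume xy: "x \<in> Pi\<^sub>E P B" "y \<in> Pi\<^sub>E P B"
      then have p_in: "x p \<in> B p" "y p \<in> B p" using p by auto
      have hh: "hh (x(p := \<phi> p (x p))) = hh x" "hh (y(p := \<phi> p (y p))) = hh y"
        using h\<phi>(1)[OF p p_in(1)] h\<phi>(1)[OF p p_in(2)] by (auto simp: hh_def fun_eq_iff)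
      have pp: "pp (x(p := \<phi> p (x p))) = pp x" "pp (y(p := \<phi> p (y p))) = pp y"
        using \<phi>(2)[OF p p_in(1)] \<phi>(2)[OF p p_in(2)] by (auto simp: pp_def fun_eq_iff)
      have pf: "(\<lambda>g. if g \<in> P - {p} then \<pi> g ((x(p := \<pi> p (x p))) g) else (x(p := \<pi> p (x p))) g) = pp x"
        "(\<lambda>g. if g \<in> P - {p} then \<pi> g ((y(p := \<pi> p (y p))) g) else (y(p := \<pi> p (y p))) g) = pp y"
        using xy p by (auto simp: pp_def fun_eq_iff PiE_iff extensional_def)
      let ?d = "\<tau> p (x p) \<in> D p \<and> \<tau> p (y p) \<in> D p" and ?h = "h p (\<tau> p (x p)) = h p (\<tau> p (y p))"
      let ?o = "\<forall>g\<in>P - {p}. \<tau> g (x g) = \<tau> g (y g)"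
      have X: "X (insert p F) x y \<longleftrightarrow> ?d \<and> X F (x(p := \<phi> p (x p))) (y(p := \<phi> p (y p)))"
        using insert.hyps p \<phi>[OF p p_in(1)] \<phi>[OF p p_in(2)] h\<phi>[OF p p_in(1)] h\<phi>[OF p p_in(2)]
        unfolding X_def by (auto simp del: fun_upd_apply simp: fun_upd_def)
      have cc: "c p (h p (\<tau> p (x p))) = c p (h p (\<tau> p (y p))) \<longleftrightarrow> ?h"
        using h\<phi>(1)[OF p p_in(1)] h\<phi>(1)[OF p p_in(2)] \<phi>(3)[OF p p_in(1)] \<phi>(3)[OF p p_in(2)] by metis
      have all: "(\<forall>g\<in>P. \<tau> g ((x(p := \<phi> p (x p))) g) = \<tau> g ((y(p := \<phi> p (y p))) g)) \<longleftrightarrow> ?h \<and> ?o"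
        using p cc \<phi>(3)[OF p p_in(1)] \<phi>(3)[OF p p_in(2)] by auto
      have Y1: "Y F (x(p := \<phi> p (x p))) (y(p := \<phi> p (y p))) \<longleftrightarrow> ?h \<and>
          (\<forall>g\<in>P - insert p F. \<tau> g (x g) = \<tau> g (y g)) \<and>
          (\<forall>g\<in>F. \<tau> g (x g) \<in> D g \<and> \<tau> g (y g) \<in> D g \<and> h g (\<tau> g (x g)) = h g (\<tau> g (y g)))"
        using p insert.hyps cc \<phi>(3)[OF p p_in(1)] \<phi>(3)[OF p p_in(2)] unfolding Y_def by auto
      have Y: "Y (insert p F) x y \<longleftrightarrow> ?d \<and> Y F (x(p := \<phi> p (x p))) (y(p := \<phi> p (y p)))"
        unfolding Y1 unfolding Y_def by auto
      have all': "(\<forall>g\<in>P. \<tau> g (x g) = \<tau> g (y g)) \<longleftrightarrow> \<tau> p (x p) = \<tau> p (y p) \<and> ?o"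
        using p by auto
      have o: "(\<forall>g\<in>P - {p}. \<tau> g ((x(p := \<pi> p (x p))) g) = \<tau> g ((y(p := \<pi> p (y p))) g)) \<longleftrightarrow> ?o"
        by auto
      have card: "card (insert p F) = Suc (card F)" using insert.hyps by simp
      \<comment> \<open>The telescoping: on canonical labels equality of blocks at \<open>p\<close>
        reads \<open>?h\<close>, so the identity part of \<open>Q F\<close> cancels the term
        subtracted in the failure branch of \<open>p\<close>.\<close>
      show "complex_of_real \<kappa> * of_bool ?d * Q F (x(p := \<phi> p (x p))) (y(p := \<phi> p (y p))) +
          (of_bool (\<tau> p (x p) = \<tau> p (y p)) - complex_of_real \<kappa> * of_bool (\<tau> p (x p) \<in> D p \<and> \<tau> p (y p) \<in> D p \<and> ?h)) *
          Qf (x(p := \<pi> p (x p))) (y(p := \<pi> p (y p))) = Q (insert p F) x y"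
        unfolding Q_def Qf_def hh pp pf X Y all all' o card
        by (simp add: algebra_simps)
    qed
  qed
  from this[OF P subset_refl] show ?thesis
    unfolding Q_def X_def Y_def hh_def pp_def by simp
qed

subsection \<open>Repeating a trial until it succeeds\<close>

lemma sum_PiE_bij:
  assumes "\<And>g. g \<in> P \<Longrightarrow> bij_betw (\<lambda>z. (\<pi> g z, \<tau> g z)) (B g) (V g \<times> U g)"
  shows "(\<Sum>x\<in>Pi\<^sub>E P B. f (\<lambda>g\<in>P. \<pi> g (x g)) (\<lambda>g\<in>P. \<tau> g (x g))) =
         (\<Sum>v\<in>Pi\<^sub>E P V. \<Sum>u\<in>Pi\<^sub>E P U. f v u)"
proof -
  define \<iota> where "\<iota> g = inv_into (B g) (\<lambda>z. (\<pi> g z, \<tau> g z))" for g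
  have fwd: "\<pi> g z \<in> V g \<and> \<tau> g z \<in> U g \<and> \<iota> g (\<pi> g z, \<tau> g z) = z" if "g \<in> P" "z \<in> B g" for g z
    using bij_betwE[OF assms[OF that(1)]] that(2)
      inv_into_f_f[OF bij_betw_imp_inj_on[OF assms[OF that(1)]] that(2)]
    by (auto simp: \<iota>_def)
  have 2: "\<iota> g (v, u) \<in> B g \<and> \<pi> g (\<iota> g (v, u)) = v \<and> \<tau> g (\<iota> g (v, u)) = u"
    if "g \<in> P" "v \<in> V g" "u \<in> U g" for g v u
  proof -
    have "(v, u) \<in> (\<lambda>z. (\<pi> g z, \<tau> g z)) ` B g"
      using bij_betw_imp_surj_on[OF assms[OF that(1)]] that by auto
    from inv_into_into[OF this] f_inv_into_f[OF this] show ?thesis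
      by (simp add: \<iota>_def)
  qed
  show ?thesis
    unfolding sum.cartesian_product
  proof (rule sum.reindex_bij_witness[where j = "\<lambda>x. (\<lambda>g\<in>P. \<pi> g (x g), \<lambda>g\<in>P. \<tau> g (x g))"
          and i = "\<lambda>(v, u). \<lambda>g\<in>P. \<iota> g (v g, u g)"], goal_cases)
    case (1 x)
    have "(\<lambda>g\<in>P. \<iota> g (\<pi> g (x g), \<tau> g (x g))) i = x i" for i
      using fwd[of i "x i"] PiE_mem[OF 1, of i] PiE_arb[OF 1, of i] by (cases "i \<in> P") auto
    then have "(\<lambda>g\<in>P. \<iota> g (\<pi> g (x g), \<tau> g (x g))) = x" by blast
    then show ?case by (simp cong: restrict_cong)
  next
    case (2 x)
    then show ?case using fwd by auto
  next
    case (3 b)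
    then show ?case using 2 by (cases b) (auto simp: PiE_iff extensional_def fun_eq_iff)
  next
    case (4 b)
    then show ?case using 2 by (cases b) (auto simp: PiE_iff)
  qed auto
qed

lemma sum_of_bool_eq:
  "finite X \<Longrightarrow> x \<in> X \<Longrightarrow> (\<Sum>y\<in>X. of_bool (x = y) * f y) = f x" for f :: "'a \<Rightarrow> complex"
  by (subst sum.remove[of X x]) (auto intro!: sum.neutral)

lemma sum4_factor:
  fixes a :: "'v \<Rightarrow> 'v \<Rightarrow> complex"
  shows "(\<Sum>v\<in>X. \<Sum>u\<in>Y. \<Sum>v'\<in>X. \<Sum>u'\<in>Y. a v v' * A u u') =
    (\<Sum>v\<in>X. \<Sum>v'\<in>X. a v v') * (\<Sum>u\<in>Y. \<Sum>u'\<in>Y. A u u')"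
proof -
  have "(\<Sum>v\<in>X. \<Sum>u\<in>Y. \<Sum>v'\<in>X. \<Sum>u'\<in>Y. a v v' * A u u') =
     (\<Sum>v\<in>X. \<Sum>u\<in>Y. (\<Sum>v'\<in>X. a v v') * (\<Sum>u'\<in>Y. A u u'))"
    by (simp only: sum_product)
  also have "\<dots> = (\<Sum>v\<in>X. \<Sum>v'\<in>X. a v v') * (\<Sum>u\<in>Y. \<Sum>u'\<in>Y. A u u')"
    by (simp only: sum_product)
  finally show ?thesis .
qed

section \<open>Splitting a supply of copies\<close>

definition earlier_copies :: "nat \<Rightarrow> nat \<Rightarrow> (nat \<Rightarrow> nat) \<Rightarrow> nat \<Rightarrow> (nat \<times> nat \<Rightarrow> nat) \<Rightarrow> nat \<times> nat \<Rightarrow> nat" where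
  "earlier_copies m N grp g z = restrict z ({..<m} \<times> {q. q < N \<and> grp q = g})"

definition later_copies :: "nat \<Rightarrow> nat \<Rightarrow> nat \<Rightarrow> (nat \<Rightarrow> nat) \<Rightarrow> nat \<Rightarrow> (nat \<times> nat \<Rightarrow> nat) \<Rightarrow> nat \<times> nat \<Rightarrow> nat" where
  "later_copies m n N grp g z = (\<lambda>(c, q)\<in>{..<n} \<times> {q. q < N \<and> grp q = g}. z (m + c, q))"

lemma bij_betw_copies:
  "bij_betw (\<lambda>z. (earlier_copies m N grp g z, later_copies m n N grp g z))
     (party_basis (m + n) N grp g) (party_basis m N grp g \<times> party_basis n N grp g)"
proof -
  let ?Q = "{q. q < N \<and> grp q = g}"
  define J where "J = (\<lambda>(v, u). \<lambda>(c, q)\<in>{..<m + n} \<times> ?Q. if c < m then v (c, q) else u (c - m, q) :: nat)"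
  show ?thesis
  proof (rule bij_betw_byWitness[where f' = J])
    show "\<forall>z\<in>party_basis (m + n) N grp g. J (earlier_copies m N grp g z, later_copies m n N grp g z) = z"
    proof (intro ballI ext)
      fix z i assume "z \<in> party_basis (m + n) N grp g"
      then show "J (earlier_copies m N grp g z, later_copies m n N grp g z) i = z i"
        using PiE_arb[of z "{..<m + n} \<times> ?Q" _ i]
        by (cases i) (auto simp: J_def earlier_copies_def later_copies_def party_basis_def)
    qed
    show "\<forall>w\<in>party_basis m N grp g \<times> party_basis n N grp g.
        (earlier_copies m N grp g (J w), later_copies m n N grp g (J w)) = w"
    proof
      fix w assume w: "w \<in> party_basis m N grp g \<times> party_basis n N grp g"
      obtain v u where vu: "w = (v, u)" by (cases w)
      have v: "v i = undefined" if "i \<notin> {..<m} \<times> ?Q" for i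
        using w PiE_arb[OF _ that] by (auto simp: vu party_basis_def)
      have u: "u i = undefined" if "i \<notin> {..<n} \<times> ?Q" for i
        using w PiE_arb[OF _ that] by (auto simp: vu party_basis_def)
      have "earlier_copies m N grp g (J w) i = v i" for i
        using v[of i] by (cases i) (auto simp: vu J_def earlier_copies_def)
      moreover have "later_copies m n N grp g (J w) i = u i" for i
        using u[of i] by (cases i) (auto simp: vu J_def later_copies_def)
      ultimately show "(earlier_copies m N grp g (J w), later_copies m n N grp g (J w)) = w"
        by (auto simp: vu fun_eq_iff)
    qed
    show "(\<lambda>z. (earlier_copies m N grp g z, later_copies m n N grp g z)) ` party_basis (m + n) N grp g
        \<subseteq> party_basis m N grp g \<times> party_basis n N grp g"
    proof (rule image_subsetI)
      fix z assume "z \<in> party_basis (m + n) N grp g"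
      then have "z (c, q) \<in> {0, 1}" if "c < m + n" "q \<in> ?Q" for c q
        using that PiE_mem[of z "{..<m + n} \<times> ?Q" "\<lambda>_. {0, 1}" "(c, q)"] by (simp add: party_basis_def)
      then show "(earlier_copies m N grp g z, later_copies m n N grp g z)
          \<in> party_basis m N grp g \<times> party_basis n N grp g"
        by (simp add: earlier_copies_def later_copies_def party_basis_def Pi_def)
    qed
    show "J ` (party_basis m N grp g \<times> party_basis n N grp g) \<subseteq> party_basis (m + n) N grp g"
    proof (rule image_subsetI)
      fix w assume w: "w \<in> party_basis m N grp g \<times> party_basis n N grp g"
      have "fst w (c, q) \<in> {0, 1}" if "c < m" "q \<in> ?Q" for c q
        using w that PiE_mem[of "fst w" "{..<m} \<times> ?Q" "\<lambda>_. {0, 1}" "(c, q)"]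
        by (auto simp: party_basis_def)
      moreover have "snd w (c - m, q) \<in> {0, 1}" if "\<not> c < m" "c < m + n" "q \<in> ?Q" for c q
        using w that PiE_mem[of "snd w" "{..<n} \<times> ?Q" "\<lambda>_. {0, 1}" "(c - m, q)"]
        by (auto simp: party_basis_def)
      ultimately show "J w \<in> party_basis (m + n) N grp g"
        by (simp add: J_def split_beta party_basis_def Pi_def)
    qed
  qed
qed

text \<open>Indices are total functions on \<open>nat\<close>. This says that their values beyond
  the \<open>N\<close> qubits are irrelevant, so that restricted and unrestricted labels are
  interchangeable.\<close>

definition local_oper :: "nat \<Rightarrow> (nat, nat) oper \<Rightarrow> bool" where
  "local_oper N \<rho> \<longleftrightarrow> (\<forall>x y x' y'. (\<forall>q<N. x q = x' q \<and> y q = y' q) \<longrightarrow> \<rho> x y = \<rho> x' y')"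

lemma local_operD:
  "local_oper N \<rho> \<Longrightarrow> (\<And>q. q < N \<Longrightarrow> x q = x' q) \<Longrightarrow> (\<And>q. q < N \<Longrightarrow> y q = y' q) \<Longrightarrow> \<rho> x y = \<rho> x' y'"
  unfolding local_oper_def by blast

lemma prod_lessThan_add:
  "(\<Prod>c<m + n. f c) = (\<Prod>c<m. f c) * (\<Prod>c<n. f (m + c))" for f :: "nat \<Rightarrow> 'a::comm_monoid_mult"
  by (induction n) (simp_all add: mult.assoc)

lemma distribute_tensor_power_add:
  assumes "local_oper N \<rho>" and "\<And>q. q < N \<Longrightarrow> grp q \<in> P"
  shows "distribute grp (tensor_power (m + n) \<rho>) x y =
    distribute grp (tensor_power m \<rho>)
      (\<lambda>g\<in>P. earlier_copies m N grp g (x g)) (\<lambda>g\<in>P. earlier_copies m N grp g (y g)) *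
    distribute grp (tensor_power n \<rho>)
      (\<lambda>g\<in>P. later_copies m n N grp g (x g)) (\<lambda>g\<in>P. later_copies m n N grp g (y g))"
  unfolding distribute_def tensor_power_def prod_lessThan_add
  using assms(2)
  by (intro arg_cong2[where f = "(*)"] prod.cong refl local_operD[OF assms(1)])
     (auto simp: earlier_copies_def later_copies_def)

lemma finite_party_basis [simp]: "finite (party_basis n N grp g)"
proof -
  have "finite {q. q < N \<and> grp q = g}" by simp
  then show ?thesis
    unfolding party_basis_def by (intro finite_PiE finite_cartesian_product) auto
qed

text \<open>The transposed projector onto the cat state, in the index convention of
  \<open>effect\<close>.\<close>

definition cat_effect :: "nat \<Rightarrow> (nat, nat \<times> nat \<Rightarrow> nat) oper" where
  "cat_effect M x y = cnj (cat_vec M (\<lambda>g. x g (0, g))) * cat_vec M (\<lambda>g. y g (0, g))"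

lemma cat_fidelity_effect:
  "cat_fidelity M \<rho> = Re (\<Sum>x\<in>Pi\<^sub>E {..<M} (party_basis 1 M id).
      \<Sum>y\<in>Pi\<^sub>E {..<M} (party_basis 1 M id). cat_effect M x y * \<rho> x y)"
  unfolding cat_fidelity_def cat_effect_def by (simp add: mult_ac)

text \<open>The filter of party \<open>g\<close> maps a label \<open>u \<in> D g\<close> of \<open>n\<close> copies to \<open>h g u\<close> and annihilates the
  other labels; \<open>c g\<close> is a section of \<open>h g\<close>. Up to the scaling that makes the filters contractions,
  \<open>T\<^sub>0\<close> is the success probability and \<open>F\<^sub>0\<close> the unnormalised fidelity after success.\<close>

locale trial =
  fixes N M n :: nat and grp :: "nat \<Rightarrow> nat" and \<rho> :: "(nat, nat) oper"
    and D :: "nat \<Rightarrow> (nat \<times> nat \<Rightarrow> nat) set"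
    and h c :: "nat \<Rightarrow> (nat \<times> nat \<Rightarrow> nat) \<Rightarrow> nat \<times> nat \<Rightarrow> nat"
    and F\<^sub>0 T\<^sub>0 :: real
  assumes M: "0 < M"
    and grp: "grp ` {..<N} = {..<M}"
    and local_\<rho>: "local_oper N \<rho>"
    and D: "\<And>g. g < M \<Longrightarrow> D g \<subseteq> party_basis n N grp g"
    and h: "\<And>g u. g < M \<Longrightarrow> u \<in> party_basis n N grp g \<Longrightarrow> h g u \<in> party_basis 1 M id g"
    and c: "\<And>g u. g < M \<Longrightarrow> u \<in> party_basis n N grp g \<Longrightarrow>
      c g (h g u) \<in> party_basis n N grp g \<and> h g (c g (h g u)) = h g u"
    and trace: "(\<Sum>u\<in>Pi\<^sub>E {..<M} (party_basis n N grp). distribute grp (tensor_power n \<rho>) u u) = 1"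
    and F\<^sub>0: "(\<Sum>u\<in>Pi\<^sub>E {..<M} (party_basis n N grp). \<Sum>u'\<in>Pi\<^sub>E {..<M} (party_basis n N grp).
        of_bool (\<forall>g<M. u g \<in> D g \<and> u' g \<in> D g) *
        cat_effect M (\<lambda>g\<in>{..<M}. h g (u g)) (\<lambda>g\<in>{..<M}. h g (u' g)) *
        distribute grp (tensor_power n \<rho>) u u') = complex_of_real F\<^sub>0"
    and T\<^sub>0: "(\<Sum>u\<in>Pi\<^sub>E {..<M} (party_basis n N grp). \<Sum>u'\<in>Pi\<^sub>E {..<M} (party_basis n N grp).
        of_bool (\<forall>g<M. u g \<in> D g \<and> u' g \<in> D g \<and> h g (u g) = h g (u' g)) *
        distribute grp (tensor_power n \<rho>) u u') = complex_of_real T\<^sub>0"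
    and T\<^sub>0_pos: "0 < T\<^sub>0"
begin

abbreviation "P \<equiv> {..<M}"
abbreviation "B \<equiv> \<lambda>m. party_basis m N grp"
abbreviation "rho m \<equiv> distribute grp (tensor_power m \<rho>)"

lemma finite_labels: "finite (Pi\<^sub>E P (B m))"
  by (rule finite_PiE) simp_all

text \<open>\<open>locc\<close> compares families of label sets as total functions. Indices outside
  \<open>P\<close> hold no qubits, so all families agree there.\<close>

lemma party_basis_outside: "g \<notin> P \<Longrightarrow> party_basis m N grp g = party_basis m' M id g"
proof -
  assume "g \<notin> P"
  then have "{q. q < N \<and> grp q = g} = {}" "{q. q < M \<and> id q = g} = {}"
    using grp by auto
  then show ?thesis unfolding party_basis_def by (simp only: Times_empty Sigma_empty2 PiE_empty_domain)
qed

lemma rho_add: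
  "rho (m + n) x y =
    rho m (\<lambda>g\<in>P. earlier_copies m N grp g (x g)) (\<lambda>g\<in>P. earlier_copies m N grp g (y g)) *
    rho n (\<lambda>g\<in>P. later_copies m n N grp g (x g)) (\<lambda>g\<in>P. later_copies m n N grp g (y g))"
  by (rule distribute_tensor_power_add[OF local_\<rho>]) (use grp in auto)

lemma trace_rho: "(\<Sum>x\<in>Pi\<^sub>E P (B (T * n)). rho (T * n) x x) = 1"
proof (induction T)
  case 0
  show ?case by (simp add: party_basis_def distribute_def tensor_power_def card_PiE)
next
  case (Suc T)
  have "(\<Sum>x\<in>Pi\<^sub>E P (B (T * n + n)). rho (T * n + n) x x) =
      (\<Sum>v\<in>Pi\<^sub>E P (B (T * n)). \<Sum>u\<in>Pi\<^sub>E P (B n). rho (T * n) v v * rho n u u)"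
    unfolding rho_add[of "T * n"]
    by (rule sum_PiE_bij[where f = "\<lambda>v u. rho (T * n) v v * rho n u u"]) (rule bij_betw_copies)
  also have "\<dots> = (\<Sum>v\<in>Pi\<^sub>E P (B (T * n)). rho (T * n) v v) * (\<Sum>u\<in>Pi\<^sub>E P (B n). rho n u u)"
    by (simp only: sum_product)
  finally show ?case
    using Suc trace by (simp add: add.commute)
qed

text \<open>The newest \<open>n\<close> copies are filtered first and a failure falls back on the
  \<open>T * n\<close> earlier ones, which suits an induction on \<open>T\<close>. The constant
  \<open>b\<close> is the deviation of the value without any copies from the fixed point.\<close>

lemma effect_repeat:
  fixes \<kappa> :: real
  assumes \<kappa>: "0 \<le> \<kappa>" "\<And>g. g < M \<Longrightarrow> \<kappa> * card (B n g) \<le> 1"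
  shows "\<exists>b. \<forall>T. \<exists>Q. effect P (party_basis 1 M id) (cat_effect M) (B (T * n)) Q \<and>
     (\<Sum>x\<in>Pi\<^sub>E P (B (T * n)). \<Sum>y\<in>Pi\<^sub>E P (B (T * n)). Q x y * rho (T * n) x y) =
     of_real (F\<^sub>0 / T\<^sub>0) + (1 - of_real (\<kappa> ^ M * T\<^sub>0)) ^ T * b"
proof -
  \<comment> \<open>Without copies each party simply prepares the bit 0; the value obtained only
    enters \<open>b\<close>, whose weight decays with \<open>T\<close>.\<close>
  have "\<exists>Q. effect P (party_basis 1 M id) (cat_effect M) (B 0) Q"
  proof
    have *: "(\<lambda>g. if g \<in> P then party_basis 1 M id g else B 0 g) = party_basis 1 M id"
      using party_basis_outside by (auto simp: fun_eq_iff)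
    show "effect P (party_basis 1 M id) (cat_effect M) (B 0)
       (\<lambda>x y. of_bool (\<forall>g\<in>P. x g = y g) * cat_effect M
          (\<lambda>g. if g \<in> P then (\<lambda>i\<in>{(0, g)}. 0) else x g) (\<lambda>g. if g \<in> P then (\<lambda>i\<in>{(0, g)}. 0) else y g))"
    proof (rule effect_trace_out_all[where V = "party_basis 1 M id" and \<tau> = "\<lambda>_ z. z"
          and \<pi> = "\<lambda>g _. \<lambda>i\<in>{(0, g)}. 0" and Q = "cat_effect M"])
      show "effect P (party_basis 1 M id) (cat_effect M)
          (\<lambda>g. if g \<in> P then party_basis 1 M id g else B 0 g) (cat_effect M)"
        unfolding * by (rule effect_refl)
      show "(\<lambda>_. \<lambda>i\<in>{(0, g)}. 0) ` B 0 g \<subseteq> party_basis 1 M id g" if "g \<in> P" for g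
        using that by (auto simp: party_basis_def PiE_iff extensional_def)
    qed (auto simp: inj_on_def)
  qed
  then obtain Q\<^sub>0 where Q\<^sub>0: "effect P (party_basis 1 M id) (cat_effect M) (B 0) Q\<^sub>0" ..
  define b where "b = (\<Sum>x\<in>Pi\<^sub>E P (B 0). \<Sum>y\<in>Pi\<^sub>E P (B 0). Q\<^sub>0 x y * rho 0 x y) - of_real (F\<^sub>0 / T\<^sub>0)"
  have "\<exists>Q. effect P (party_basis 1 M id) (cat_effect M) (B (T * n)) Q \<and>
     (\<Sum>x\<in>Pi\<^sub>E P (B (T * n)). \<Sum>y\<in>Pi\<^sub>E P (B (T * n)). Q x y * rho (T * n) x y) =
     of_real (F\<^sub>0 / T\<^sub>0) + (1 - of_real (\<kappa> ^ M * T\<^sub>0)) ^ T * b" for T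
  proof (induction T)
    case 0
    show ?case
    proof (intro exI conjI)
      show "effect P (party_basis 1 M id) (cat_effect M) (B (0 * n)) Q\<^sub>0"
        using Q\<^sub>0 by (simp only: mult_zero_left)
    qed (simp add: b_def)
  next
    case (Suc T)
    let ?m = "T * n"
    from Suc obtain Q where Q: "effect P (party_basis 1 M id) (cat_effect M) (B ?m) Q"
      and val: "(\<Sum>x\<in>Pi\<^sub>E P (B ?m). \<Sum>y\<in>Pi\<^sub>E P (B ?m). Q x y * rho ?m x y) =
        of_real (F\<^sub>0 / T\<^sub>0) + (1 - of_real (\<kappa> ^ M * T\<^sub>0)) ^ T * b" by blast
    let ?e = "\<lambda>x. \<lambda>g\<in>P. earlier_copies ?m N grp g (x g)"
    let ?l = "\<lambda>x. \<lambda>g\<in>P. later_copies ?m n N grp g (x g)"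
    define A where "A u u' = of_bool (\<forall>g<M. u g \<in> D g \<and> u' g \<in> D g) *
        cat_effect M (\<lambda>g\<in>{..<M}. h g (u g)) (\<lambda>g\<in>{..<M}. h g (u' g))" for u u'
    define C where "C u u' = (of_bool (\<forall>g<M. u g \<in> D g \<and> u' g \<in> D g \<and> h g (u g) = h g (u' g)) :: complex)" for u u'
    define Q' where "Q' v u v' u' = complex_of_real (\<kappa> ^ M) * of_bool (v = v') * A u u' +
        (of_bool (u = u') - complex_of_real (\<kappa> ^ M) * C u u') * Q v v'"
      for v u v' u' :: "nat \<Rightarrow> nat \<times> nat \<Rightarrow> nat"
    have ext: "(\<lambda>g\<in>P. f g) = (\<lambda>g\<in>P. f' g) \<longleftrightarrow> (\<forall>g\<in>P. f g = f' g)" for f f' :: "nat \<Rightarrow> nat \<times> nat \<Rightarrow> nat"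
      by (auto simp: fun_eq_iff restrict_def)
    have "effect P (party_basis 1 M id) (cat_effect M) (B (?m + n)) (\<lambda>x y.
      complex_of_real \<kappa> ^ card P *
        of_bool ((\<forall>g\<in>P. later_copies ?m n N grp g (x g) \<in> D g \<and> later_copies ?m n N grp g (y g) \<in> D g) \<and>
          (\<forall>g\<in>P. earlier_copies ?m N grp g (x g) = earlier_copies ?m N grp g (y g))) *
        cat_effect M (\<lambda>g\<in>P. h g (later_copies ?m n N grp g (x g))) (\<lambda>g\<in>P. h g (later_copies ?m n N grp g (y g))) +
      (of_bool (\<forall>g\<in>P. later_copies ?m n N grp g (x g) = later_copies ?m n N grp g (y g)) -
        complex_of_real \<kappa> ^ card P *
        of_bool (\<forall>g\<in>P. later_copies ?m n N grp g (x g) \<in> D g \<and> later_copies ?m n N grp g (y g) \<in> D g \<and>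
           h g (later_copies ?m n N grp g (x g)) = h g (later_copies ?m n N grp g (y g)))) *
        Q (?e x) (?e y))"
      by (rule effect_trial[where \<pi> = "earlier_copies ?m N grp" and \<tau> = "later_copies ?m n N grp"
            and U = "B n" and V = "B ?m" and c = c and B = "B (?m + n)", OF _ _ _ _ _ _ _ _ bij_betw_copies])
         (use D h c \<kappa> Q party_basis_outside in \<open>simp_all\<close>)
    then have "effect P (party_basis 1 M id) (cat_effect M) (B (?m + n))
        (\<lambda>x y. Q' (?e x) (?l x) (?e y) (?l y))"
    proof (rule effect_cong, goal_cases)
      case (1 x y)
      have A: "A (?l x) (?l y) =
          of_bool (\<forall>g\<in>P. later_copies ?m n N grp g (x g) \<in> D g \<and> later_copies ?m n N grp g (y g) \<in> D g) *
          cat_effect M (\<lambda>g\<in>P. h g (later_copies ?m n N grp g (x g)))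
            (\<lambda>g\<in>P. h g (later_copies ?m n N grp g (y g)))"
        unfolding A_def by (auto simp: Ball_def cong: restrict_cong)
      have C: "C (?l x) (?l y) =
          of_bool (\<forall>g\<in>P. later_copies ?m n N grp g (x g) \<in> D g \<and> later_copies ?m n N grp g (y g) \<in> D g \<and>
           h g (later_copies ?m n N grp g (x g)) = h g (later_copies ?m n N grp g (y g)))"
        unfolding C_def by (auto simp: Ball_def)
      show ?case
        unfolding Q'_def A C ext card_lessThan of_real_power of_bool_conj by (simp only: mult_ac)
    qed
    moreover have "(\<Sum>x\<in>Pi\<^sub>E P (B (?m + n)). \<Sum>y\<in>Pi\<^sub>E P (B (?m + n)).
          Q' (?e x) (?l x) (?e y) (?l y) * rho (?m + n) x y) =
        of_real (F\<^sub>0 / T\<^sub>0) + (1 - of_real (\<kappa> ^ M * T\<^sub>0)) ^ Suc T * b"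
    proof -
      define G where "G v u v' u' = Q' v u v' u' * (rho ?m v v' * rho n u u')" for v u v' u'
      have diag: "(\<Sum>v\<in>Pi\<^sub>E P (B ?m). \<Sum>v'\<in>Pi\<^sub>E P (B ?m). of_bool (v = v') * rho ?m v v') =
          1"
        unfolding trace_rho[of T, symmetric]
        by (rule sum.cong[OF refl], rule sum_of_bool_eq[OF finite_labels])
      have succ: "(\<Sum>u\<in>Pi\<^sub>E P (B n). \<Sum>u'\<in>Pi\<^sub>E P (B n). complex_of_real (\<kappa> ^ M) * (A u u' * rho n u u')) =
          of_real (\<kappa> ^ M * F\<^sub>0)"
        by (simp only: A_def sum_distrib_left[symmetric] F\<^sub>0 of_real_mult)
      have fail: "(\<Sum>u\<in>Pi\<^sub>E P (B n). \<Sum>u'\<in>Pi\<^sub>E P (B n).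
              of_bool (u = u') * rho n u u' - complex_of_real (\<kappa> ^ M) * (C u u' * rho n u u')) =
          1 - of_real (\<kappa> ^ M * T\<^sub>0)"
      proof -
        have "(\<Sum>u\<in>Pi\<^sub>E P (B n). \<Sum>u'\<in>Pi\<^sub>E P (B n). of_bool (u = u') * rho n u u') = 1"
          unfolding trace[symmetric]
          by (rule sum.cong[OF refl], rule sum_of_bool_eq[OF finite_labels])
        then show ?thesis
          by (simp only: C_def sum_subtractf sum_distrib_left[symmetric] T\<^sub>0 of_real_mult)
      qed
      have "(\<Sum>x\<in>Pi\<^sub>E P (B (?m + n)). \<Sum>y\<in>Pi\<^sub>E P (B (?m + n)).
          Q' (?e x) (?l x) (?e y) (?l y) * rho (?m + n) x y) =
        (\<Sum>x\<in>Pi\<^sub>E P (B (?m + n)). \<Sum>y\<in>Pi\<^sub>E P (B (?m + n)). G (?e x) (?l x) (?e y) (?l y))"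
        unfolding rho_add G_def ..
      also have "\<dots> = (\<Sum>x\<in>Pi\<^sub>E P (B (?m + n)). \<Sum>v'\<in>Pi\<^sub>E P (B ?m). \<Sum>u'\<in>Pi\<^sub>E P (B n). G (?e x) (?l x) v' u')"
        by (rule sum.cong[OF refl]) (rule sum_PiE_bij[OF bij_betw_copies])
      also have "\<dots> = (\<Sum>v\<in>Pi\<^sub>E P (B ?m). \<Sum>u\<in>Pi\<^sub>E P (B n). \<Sum>v'\<in>Pi\<^sub>E P (B ?m). \<Sum>u'\<in>Pi\<^sub>E P (B n). G v u v' u')"
        by (rule sum_PiE_bij[OF bij_betw_copies])
      also have "\<dots> = (\<Sum>v\<in>Pi\<^sub>E P (B ?m). \<Sum>u\<in>Pi\<^sub>E P (B n). \<Sum>v'\<in>Pi\<^sub>E P (B ?m). \<Sum>u'\<in>Pi\<^sub>E P (B n).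
          (of_bool (v = v') * rho ?m v v') * (complex_of_real (\<kappa> ^ M) * (A u u' * rho n u u')) +
          (Q v v' * rho ?m v v') * (of_bool (u = u') * rho n u u' - complex_of_real (\<kappa> ^ M) * (C u u' * rho n u u')))"
        by (intro sum.cong refl) (simp add: G_def Q'_def algebra_simps)
      also have "\<dots> = (\<Sum>v\<in>Pi\<^sub>E P (B ?m). \<Sum>v'\<in>Pi\<^sub>E P (B ?m). of_bool (v = v') * rho ?m v v') *
            (\<Sum>u\<in>Pi\<^sub>E P (B n). \<Sum>u'\<in>Pi\<^sub>E P (B n). complex_of_real (\<kappa> ^ M) * (A u u' * rho n u u')) +
          (\<Sum>v\<in>Pi\<^sub>E P (B ?m). \<Sum>v'\<in>Pi\<^sub>E P (B ?m). Q v v' * rho ?m v v') *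
            (\<Sum>u\<in>Pi\<^sub>E P (B n). \<Sum>u'\<in>Pi\<^sub>E P (B n).
              of_bool (u = u') * rho n u u' - complex_of_real (\<kappa> ^ M) * (C u u' * rho n u u'))"
        by (simp only: sum.distrib sum4_factor)
      also have "\<dots> = 1 * of_real (\<kappa> ^ M * F\<^sub>0) + (of_real (F\<^sub>0 / T\<^sub>0) +
          (1 - of_real (\<kappa> ^ M * T\<^sub>0)) ^ T * b) * (1 - of_real (\<kappa> ^ M * T\<^sub>0))"
        unfolding diag succ fail val ..
      also have "\<dots> = of_real (F\<^sub>0 / T\<^sub>0) + (1 - of_real (\<kappa> ^ M * T\<^sub>0)) ^ Suc T * b"
        using T\<^sub>0_pos by (simp add: field_simps)
      finally show ?thesis .
    qed
    ultimately show ?case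
      unfolding mult_Suc add.commute[of n] by blast
  qed
  then show ?thesis by blast
qed

lemma locc_fidelity:
  assumes "0 < \<epsilon>"
  shows "\<exists>m \<Lambda>. locc P (B m) (party_basis 1 M id) \<Lambda> \<and> cat_fidelity M (\<Lambda> (rho m)) \<ge> F\<^sub>0 / T\<^sub>0 - \<epsilon>"
proof -
  define s where "s = (\<Sum>g<M. real (card (B n g)))"
  \<comment> \<open>One choice meets all constraints: \<open>\<kappa>\<close> is at most the inverse
    of every block dimension, at most one, and keeps \<open>\<kappa> * T\<^sub>0\<close> below one,
    so that the decay factor lies strictly between 0 and 1.\<close>
  define \<kappa> where "\<kappa> = 1 / (s + T\<^sub>0 + 1)"
  have s: "0 \<le> s" unfolding s_def by (intro sum_nonneg) simp
  have card_le: "card (B n g) \<le> s" if "g < M" for g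
    unfolding s_def using that by (intro member_le_sum[where f = "\<lambda>g. real (card (B n g))"]) auto
  have \<kappa>: "0 < \<kappa>" "\<kappa> \<le> 1" "\<kappa> * T\<^sub>0 < 1"
    using s T\<^sub>0_pos by (auto simp: \<kappa>_def field_simps)
  have "\<kappa> * card (B n g) \<le> 1" if "g < M" for g
    using card_le[OF that] s T\<^sub>0_pos by (simp add: \<kappa>_def field_simps)
  then obtain b where b: "\<And>T. \<exists>Q. effect P (party_basis 1 M id) (cat_effect M) (B (T * n)) Q \<and>
     (\<Sum>x\<in>Pi\<^sub>E P (B (T * n)). \<Sum>y\<in>Pi\<^sub>E P (B (T * n)). Q x y * rho (T * n) x y) =
     of_real (F\<^sub>0 / T\<^sub>0) + (1 - of_real (\<kappa> ^ M * T\<^sub>0)) ^ T * b"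
    using effect_repeat[OF less_imp_le[OF \<kappa>(1)]] by blast
  have w: "0 < \<kappa> ^ M * T\<^sub>0" "\<kappa> ^ M * T\<^sub>0 < 1"
  proof -
    have "\<kappa> ^ M \<le> \<kappa>" using \<kappa> M power_decreasing[of 1 M \<kappa>] by simp
    then have "\<kappa> ^ M * T\<^sub>0 \<le> \<kappa> * T\<^sub>0" using T\<^sub>0_pos by simp
    then show "\<kappa> ^ M * T\<^sub>0 < 1" using \<kappa>(3) by linarith
  qed (use \<kappa> T\<^sub>0_pos in simp)
  have "(\<lambda>T. (1 - \<kappa> ^ M * T\<^sub>0) ^ T * cmod b) \<longlonglongrightarrow> 0 * cmod b"
    using w by (intro tendsto_mult tendsto_const LIMSEQ_realpow_zero) auto
  then have "eventually (\<lambda>T. (1 - \<kappa> ^ M * T\<^sub>0) ^ T * cmod b < \<epsilon>) sequentially"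
    using \<open>0 < \<epsilon>\<close> by (intro order_tendstoD(2)[where y = "0 * cmod b"]) auto
  then obtain T where T: "(1 - \<kappa> ^ M * T\<^sub>0) ^ T * cmod b < \<epsilon>"
    by (auto simp: eventually_sequentially)
  from b obtain Q where "effect P (party_basis 1 M id) (cat_effect M) (B (T * n)) Q"
    and val: "(\<Sum>x\<in>Pi\<^sub>E P (B (T * n)). \<Sum>y\<in>Pi\<^sub>E P (B (T * n)). Q x y * rho (T * n) x y) =
     of_real (F\<^sub>0 / T\<^sub>0) + (1 - of_real (\<kappa> ^ M * T\<^sub>0)) ^ T * b" by blast
  then obtain \<Lambda> where "locc P (B (T * n)) (party_basis 1 M id) \<Lambda>"
    and pull: "\<And>\<rho>. (\<Sum>x\<in>Pi\<^sub>E P (party_basis 1 M id). \<Sum>y\<in>Pi\<^sub>E P (party_basis 1 M id).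
        cat_effect M x y * \<Lambda> \<rho> x y) = (\<Sum>x\<in>Pi\<^sub>E P (B (T * n)). \<Sum>y\<in>Pi\<^sub>E P (B (T * n)). Q x y * \<rho> x y)"
    unfolding effect_def by blast
  moreover have "cat_fidelity M (\<Lambda> (rho (T * n))) =
       Re (of_real (F\<^sub>0 / T\<^sub>0) + (1 - of_real (\<kappa> ^ M * T\<^sub>0)) ^ T * b)"
    unfolding cat_fidelity_effect pull val ..
  moreover have "Re ((1 - of_real (\<kappa> ^ M * T\<^sub>0)) ^ T * b) \<ge> - \<epsilon>"
  proof -
    have "cmod ((1 - of_real (\<kappa> ^ M * T\<^sub>0)) ^ T * b) = (1 - \<kappa> ^ M * T\<^sub>0) ^ T * cmod b"
    proof -
      have "1 - complex_of_real (\<kappa> ^ M * T\<^sub>0) = complex_of_real (1 - \<kappa> ^ M * T\<^sub>0)" by simp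
      then show ?thesis
        using w by (simp only: norm_mult norm_power norm_of_real abs_of_pos diff_gt_0_iff_gt)
    qed
    then show ?thesis
      using T abs_Re_le_cmod[of "(1 - of_real (\<kappa> ^ M * T\<^sub>0)) ^ T * b"] by linarith
  qed
  ultimately have "cat_fidelity M (\<Lambda> (rho (T * n))) \<ge> F\<^sub>0 / T\<^sub>0 - \<epsilon>"
    by simp
  with \<open>locc P (B (T * n)) (party_basis 1 M id) \<Lambda>\<close> show ?thesis by blast
qed

end

subsection \<open>Matrix entries of the noisy cat state\<close>

text \<open>Entry \<open>(i, j)\<close> of the single-qubit channel applied to the matrix unit with
  row \<open>s\<close> and column \<open>t\<close>. The minus signs are those picked up by
  off-diagonal units under the Pauli matrices 2 and 3.\<close>

definition noise :: "(nat \<Rightarrow> real) \<Rightarrow> nat \<Rightarrow> nat \<Rightarrow> nat \<Rightarrow> nat \<Rightarrow> real" where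
  "noise p s t i j =
     (if s = t then (if i = j then (if i = s then p 0 + p 3 else p 1 + p 2) else 0)
      else (if i = j then 0 else (if i = s then p 0 - p 3 else p 1 - p 2)))"

text \<open>The cat projector is half the sum of the four matrix units between constant strings, and
  the channel acts on each of them qubit by qubit.\<close>

definition cat_entry :: "(nat \<Rightarrow> real) \<Rightarrow> nat \<Rightarrow> (nat \<Rightarrow> nat) \<Rightarrow> (nat \<Rightarrow> nat) \<Rightarrow> real" where
  "cat_entry p N x y = (\<Sum>s\<in>{0, 1}. \<Sum>t\<in>{0, 1}. \<Prod>q<N. noise p s t (x q) (y q)) / 2"

lemma pauli_noise:
  assumes "s \<in> {0, 1}" "t \<in> {0, 1}" "i \<in> {0, 1}" "j \<in> {0, 1}"
  shows "(\<Sum>k<4. complex_of_real (p k) * (pauli k i s * cnj (pauli k j t))) = of_real (noise p s t i j)"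
  using assms by (auto simp: pauli_def noise_def numeral_eq_Suc)

text \<open>Invariant of the fold: treated qubits contribute \<open>noise\<close>, while untreated
  ones still carry the bits of the constant strings.\<close>

lemma fold_pauli_channel:
  assumes "m \<le> N" and "\<And>q. q < m \<Longrightarrow> x q \<in> {0, 1}" and "\<And>q. q < m \<Longrightarrow> y q \<in> {0, 1}"
  shows "fold (pauli_channel p) [0..<m] (cat_state N) x y =
    (\<Sum>s\<in>{0, 1}. \<Sum>t\<in>{0, 1}. complex_of_real
       ((\<Prod>q<m. noise p s t (x q) (y q)) * (\<Prod>q\<in>{m..<N}. of_bool (x q = s \<and> y q = t)) / 2))"
  using assms
proof (induction m arbitrary: x y)
  case 0
  define r :: "(nat \<Rightarrow> nat) \<Rightarrow> nat \<Rightarrow> real" where "r z s = (\<Prod>q<N. of_bool (z q = s))" for z s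
  have "complex_of_real (of_bool P) = of_bool P" for P
    by (cases P) simp_all
  then have cv: "cat_vec N z = complex_of_real ((r z 0 + r z 1) / sqrt 2)" for z
    by (simp add: cat_vec_def r_def)
  have half: "u / sqrt 2 * (v / sqrt 2) = u * v / 2" for u v :: real
    by simp
  have "cat_state N x y = complex_of_real ((r x 0 + r x 1) * (r y 0 + r y 1) / 2)"
    unfolding cat_state_def cv complex_cnj_complex_of_real of_real_mult[symmetric] half ..
  also have "\<dots> = (\<Sum>s\<in>{0, 1}. \<Sum>t\<in>{0, 1}. complex_of_real (r x s * r y t / 2))"
    by (simp add: field_simps)
  finally show ?case
    by (simp add: r_def atLeast0LessThan of_bool_conj prod.distrib)
next
  case (Suc m)
  define \<sigma> where "\<sigma> = fold (pauli_channel p) [0..<m] (cat_state N)"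
  define A where "A s t = (\<Prod>q<m. noise p s t (x q) (y q))" for s t
  define C where "C s t = (\<Prod>q\<in>{Suc m..<N}. of_bool (x q = s \<and> y q = t) :: real)" for s t
  have \<sigma>: "\<sigma> (x(m := a)) (y(m := b)) =
      (\<Sum>s\<in>{0, 1}. \<Sum>t\<in>{0, 1}. complex_of_real (A s t * (of_bool (a = s \<and> b = t) * C s t) / 2))" for a b
  proof -
    have "\<sigma> (x(m := a)) (y(m := b)) = (\<Sum>s\<in>{0, 1}. \<Sum>t\<in>{0, 1}. complex_of_real
       ((\<Prod>q<m. noise p s t ((x(m := a)) q) ((y(m := b)) q)) *
        (\<Prod>q\<in>{m..<N}. of_bool ((x(m := a)) q = s \<and> (y(m := b)) q = t)) / 2))"
      unfolding \<sigma>_def using Suc.prems by (intro Suc.IH) auto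
    moreover have "(\<Prod>q<m. noise p s t ((x(m := a)) q) ((y(m := b)) q)) = A s t" for s t
      unfolding A_def by (intro prod.cong) auto
    moreover have "(\<Prod>q\<in>{m..<N}. of_bool ((x(m := a)) q = s \<and> (y(m := b)) q = t) :: real) =
        of_bool (a = s \<and> b = t) * C s t" for s t
    proof -
      have "{m..<N} = insert m {Suc m..<N}" using Suc.prems(1) by auto
      then show ?thesis unfolding C_def by (auto intro!: prod.cong)
    qed
    ultimately show ?thesis by (simp only:)
  qed
  have bits: "x m \<in> {0, 1}" "y m \<in> {0, 1}" using Suc.prems by auto
  have "fold (pauli_channel p) [0..<Suc m] (cat_state N) x y = pauli_channel p m \<sigma> x y"
    by (simp add: \<sigma>_def)
  also have "\<dots> = (\<Sum>k<4. complex_of_real (p k) * (\<Sum>s\<in>{0, 1}. \<Sum>t\<in>{0, 1}.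
      pauli k (x m) s * cnj (pauli k (y m) t) * complex_of_real (A s t * C s t / 2)))"
    unfolding pauli_channel_def local_kraus_def \<sigma> by (simp add: algebra_simps)
  also have "\<dots> = (\<Sum>s\<in>{0, 1}. \<Sum>t\<in>{0, 1}. (\<Sum>k<4. complex_of_real (p k) *
      (pauli k (x m) s * cnj (pauli k (y m) t))) * complex_of_real (A s t * C s t / 2))"
    by (simp add: sum.distrib sum_distrib_left sum_distrib_right algebra_simps)
  also have "\<dots> = (\<Sum>s\<in>{0, 1}. \<Sum>t\<in>{0, 1}. complex_of_real (noise p s t (x m) (y m)) *
      complex_of_real (A s t * C s t / 2))"
    by (intro sum.cong refl arg_cong2[where f = "(*)"] pauli_noise bits)
  finally show ?case
    by (simp add: A_def C_def mult_ac)
qed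

lemma noisy_cat_entry:
  assumes "\<And>q. q < N \<Longrightarrow> x q \<in> {0, 1}" and "\<And>q. q < N \<Longrightarrow> y q \<in> {0, 1}"
  shows "noisy_cat p N x y = of_real (cat_entry p N x y)"
  unfolding noisy_cat_def
  by (subst fold_pauli_channel[OF order_refl assms]) (simp_all add: cat_entry_def add_divide_distrib)

lemma local_oper_noisy_cat: "local_oper N (noisy_cat p N)"
proof -
  have "local_oper N (fold (pauli_channel p) [0..<m] (cat_state N))" if "m \<le> N" for m
    using that
  proof (induction m)
    case 0
    have "cat_vec N x = cat_vec N x'" if "\<forall>q<N. x q = x' q" for x x'
      using that by (simp add: cat_vec_def)
    then show ?case
      unfolding local_oper_def cat_state_def by simp metis
  next
    case (Suc m)
    then have IH: "local_oper N (fold (pauli_channel p) [0..<m] (cat_state N))" by simp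
    show ?case
      unfolding local_oper_def
    proof (intro allI impI)
      fix x y x' y' :: "nat \<Rightarrow> nat" assume eq: "\<forall>q<N. x q = x' q \<and> y q = y' q"
      then have "fold (pauli_channel p) [0..<m] (cat_state N) (x(m := a)) (y(m := b)) =
          fold (pauli_channel p) [0..<m] (cat_state N) (x'(m := a)) (y'(m := b))" for a b
        by (intro local_operD[OF IH]) auto
      then show "fold (pauli_channel p) [0..<Suc m] (cat_state N) x y =
          fold (pauli_channel p) [0..<Suc m] (cat_state N) x' y'"
        using eq Suc.prems by (simp add: pauli_channel_def local_kraus_def)
    qed
  qed
  then show ?thesis unfolding noisy_cat_def by simp
qed

section \<open>Bounds on the matrix entries\<close>

lemma pauli_probsD:
  assumes "pauli_probs p"
  shows "0 \<le> p 0" "0 \<le> p 1" "0 \<le> p 2" "0 \<le> p 3" "p 0 + p 3 + (p 1 + p 2) = 1"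
  using assms by (auto simp: pauli_probs_def numeral_eq_Suc)

lemma prod_two_values:
  "(\<Prod>q<N. if x q = s then a else b) = a ^ card {q. q < N \<and> x q = s} * b ^ (N - card {q. q < N \<and> x q = s})"
  for a b :: real
proof -
  have "{..<N} \<inter> {q. x q = s} = {q. q < N \<and> x q = s}" by auto
  moreover have "card ({..<N} \<inter> - {q. x q = s}) = N - card {q. q < N \<and> x q = s}"
  proof -
    have "{..<N} \<inter> - {q. x q = s} = {..<N} - {q. q < N \<and> x q = s}" by auto
    then show ?thesis by (simp add: card_Diff_subset subset_eq)
  qed
  ultimately show ?thesis
    by (simp add: prod.If_cases)
qed

text \<open>Each nonzero factor has modulus at most \<open>p 0 + p 3\<close> or
  \<open>p 1 + p 2\<close>, according to whether the bit agrees with the constant string. Agreement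
  may be read off the row \<open>x\<close> or the column \<open>y\<close>, which gives the two
  bounds.\<close>

lemma abs_cat_entry_le:
  assumes p: "pauli_probs p" and "0 < N"
    and x: "\<And>q. q < N \<Longrightarrow> x q \<in> {0, 1}" and y: "\<And>q. q < N \<Longrightarrow> y q \<in> {0, 1}"
  shows "\<bar>cat_entry p N x y\<bar> \<le> lam p (card {q. q < N \<and> x q = 0}) (N - card {q. q < N \<and> x q = 0})"
    and "\<bar>cat_entry p N x y\<bar> \<le> lam p (card {q. q < N \<and> y q = 0}) (N - card {q. q < N \<and> y q = 0})"
proof -
  let ?a = "p 0 + p 3" and ?b = "p 1 + p 2"
  note p' = pauli_probsD[OF p]
  have le: "\<bar>noise p s t (x q) (y q)\<bar> \<le> (if x q = s then ?a else ?b)"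
    "\<bar>noise p s t (x q) (y q)\<bar> \<le> (if y q = t then ?a else ?b)"
    if "q < N" "s \<in> {0, 1}" "t \<in> {0, 1}" for q s t
    using that(2,3) x[OF that(1)] y[OF that(1)] p' by (auto simp: noise_def)
  define GG where "GG s t = (\<Prod>q<N. noise p s t (x q) (y q))" for s t
  have GGx: "\<bar>GG s t\<bar> \<le> (\<Prod>q<N. if x q = s then ?a else ?b)"
    and GGy: "\<bar>GG s t\<bar> \<le> (\<Prod>q<N. if y q = t then ?a else ?b)"
    if "s \<in> {0, 1}" "t \<in> {0, 1}" for s t
    unfolding GG_def abs_prod using le[OF _ that] by (auto intro!: prod_mono)
  have flip: "(\<Prod>q<N. if z q = 1 then ?a else ?b) = (\<Prod>q<N. if z q = 0 then ?b else ?a)"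
    if "\<And>q. q < N \<Longrightarrow> z q \<in> {0, 1}" for z :: "nat \<Rightarrow> nat"
    using that by (intro prod.cong) force+
  have lam: "((\<Prod>q<N. if z q = 0 then ?a else ?b) + (\<Prod>q<N. if z q = 1 then ?a else ?b)) / 2 =
      lam p (card {q. q < N \<and> z q = 0}) (N - card {q. q < N \<and> z q = 0})"
    if "\<And>q. q < N \<Longrightarrow> z q \<in> {0, 1}" for z :: "nat \<Rightarrow> nat"
  proof -
    have 1: "(\<Prod>q<N. if z q = 1 then ?a else ?b) = (\<Prod>q<N. if z q = 0 then ?b else ?a)"
      using that by (rule flip)
    show ?thesis
      unfolding 1 unfolding prod_two_values lam_def ..
  qed
  have entry: "cat_entry p N x y = (GG 0 0 + GG 0 1 + GG 1 0 + GG 1 1) / 2"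
    by (simp add: cat_entry_def GG_def)
  \<comment> \<open>Qubit 0 decides: equal bits kill the terms with \<open>s \<noteq> t\<close>,
    different bits those with \<open>s = t\<close>. Only two of the four products survive, which
    gives \<open>lam\<close> rather than twice its value.\<close>
  have zero: "GG 0 0 = 0 \<and> GG 1 1 = 0 \<or> GG 0 1 = 0 \<and> GG 1 0 = 0"
  proof (cases "x 0 = y 0")
    case True
    then have "noise p 0 1 (x 0) (y 0) = 0" "noise p 1 0 (x 0) (y 0) = 0" by (auto simp: noise_def)
    then show ?thesis unfolding GG_def using \<open>0 < N\<close> by (force intro: prod_zero)
  next
    case False
    then have "noise p 0 0 (x 0) (y 0) = 0" "noise p 1 1 (x 0) (y 0) = 0" by (auto simp: noise_def)
    then show ?thesis unfolding GG_def using \<open>0 < N\<close> by (force intro: prod_zero)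
  qed
  have avg: "\<bar>(u + v) / 2\<bar> \<le> (a + b) / 2" if "\<bar>u\<bar> \<le> a" "\<bar>v\<bar> \<le> b" for u v a b :: real
    using that by (simp add: abs_le_iff)
  have "\<bar>cat_entry p N x y\<bar> \<le>
      ((\<Prod>q<N. if x q = 0 then ?a else ?b) + (\<Prod>q<N. if x q = 1 then ?a else ?b)) / 2"
    using zero
  proof
    assume "GG 0 0 = 0 \<and> GG 1 1 = 0"
    then show ?thesis unfolding entry using avg[OF GGx[of 0 1] GGx[of 1 0]] by simp
  next
    assume "GG 0 1 = 0 \<and> GG 1 0 = 0"
    then show ?thesis unfolding entry using avg[OF GGx[of 0 0] GGx[of 1 1]] by simp
  qed
  moreover have "\<bar>cat_entry p N x y\<bar> \<le>
      ((\<Prod>q<N. if y q = 0 then ?a else ?b) + (\<Prod>q<N. if y q = 1 then ?a else ?b)) / 2"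
    using zero
  proof
    assume "GG 0 0 = 0 \<and> GG 1 1 = 0"
    then show ?thesis unfolding entry using avg[OF GGy[of 1 0] GGy[of 0 1]] by (simp add: add.commute)
  next
    assume "GG 0 1 = 0 \<and> GG 1 0 = 0"
    then show ?thesis unfolding entry using avg[OF GGy[of 0 0] GGy[of 1 1]] by simp
  qed
  ultimately show "\<bar>cat_entry p N x y\<bar> \<le> lam p (card {q. q < N \<and> x q = 0}) (N - card {q. q < N \<and> x q = 0})"
    and "\<bar>cat_entry p N x y\<bar> \<le> lam p (card {q. q < N \<and> y q = 0}) (N - card {q. q < N \<and> y q = 0})"
    using lam[of x, OF x] lam[of y, OF y] by simp_all
qed

text \<open>For nonnegative bases the two power differences have the same sign, so this
  factorisation yields monotonicity of \<open>lam\<close> towards the middle cut, and strict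
  monotonicity when both differences are nonzero and the bases positive.\<close>

lemma lam_diff:
  assumes "j \<le> w" "j + w \<le> N"
  shows "2 * (lam p j (N - j) - lam p w (N - w)) =
    (p 0 + p 3) ^ j * (p 1 + p 2) ^ j * (((p 0 + p 3) ^ (w - j) - (p 1 + p 2) ^ (w - j)) *
      ((p 0 + p 3) ^ (N - j - w) - (p 1 + p 2) ^ (N - j - w)))"
proof -
  define e m where "e = w - j" and "m = N - j - w"
  have "w = j + e" "N - j = j + e + m" "N - w = j + m" using assms by (auto simp: e_def m_def)
  then show ?thesis
    unfolding e_def[symmetric] m_def[symmetric] lam_def by (simp add: power_add field_simps)
qed

lemma lam_mono:
  assumes p: "pauli_probs p" and "j \<le> w" "w \<le> N - j" "j \<le> N"
  shows "lam p w (N - w) \<le> lam p j (N - j)"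
proof -
  note p' = pauli_probsD[OF p]
  let ?a = "p 0 + p 3" and ?b = "p 1 + p 2"
  have sum_le: "j + w \<le> N" using assms(3,4) by linarith
  have *: "0 \<le> (?a ^ e - ?b ^ e) * (?a ^ m - ?b ^ m)" for e m
  proof (cases "?a \<le> ?b")
    case True
    then have "?a ^ i \<le> ?b ^ i" for i using p' by (intro power_mono) auto
    then show ?thesis by (intro mult_nonpos_nonpos) auto
  next
    case False
    then have "?b ^ i \<le> ?a ^ i" for i using p' by (intro power_mono) auto
    then show ?thesis by (intro mult_nonneg_nonneg) auto
  qed
  have "0 \<le> 2 * (lam p j (N - j) - lam p w (N - w))"
    unfolding lam_diff[OF assms(2) sum_le]
    using p' by (intro mult_nonneg_nonneg[OF mult_nonneg_nonneg *]) auto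
  then show ?thesis by simp
qed

lemma cat_entry_const:
  assumes "0 < N" "s \<in> {0, 1}" "t \<in> {0, 1}" "\<And>q. q < N \<Longrightarrow> x q = s" "\<And>q. q < N \<Longrightarrow> y q = t"
  shows "cat_entry p N x y = (if s = t then lam p N 0
    else ((p 0 - p 3) ^ N + (p 1 - p 2) ^ N) / 2)"
proof -
  have "(\<Prod>q<N. noise p s' t' (x q) (y q)) = noise p s' t' s t ^ N" for s' t'
    using assms(4,5) by simp
  then show ?thesis
    using assms(1-3) by (auto simp: cat_entry_def noise_def lam_def)
qed

subsection \<open>Block sizes\<close>

text \<open>Write \<open>u\<close> and \<open>v\<close> for the powered diagonal entry and coherence
  of the constant strings; \<open>w\<close> is the total of the other powered entries. After
  division by \<open>(2 * (u + v)) ^ n\<^sub>2\<close> the two terms are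
  \<open>(1 + t) ^ n\<^sub>2\<close> and \<open>(1 - y) ^ n\<^sub>2\<close> with
  \<open>y \<ge> v / (2 * u)\<close>. Taking \<open>n\<^sub>2\<close> near \<open>L * u / v\<close>
  pushes the second below \<open>exp (- L / 2)\<close>, while \<open>n\<^sub>2 * t\<close> is at
  most \<open>(L + 1) / 2 * (w / v)\<close>, which becomes small with growing
  \<open>n\<^sub>1\<close> because \<open>l < v\<^sub>0\<close>.\<close>

lemma block_sizes_exist:
  fixes u\<^sub>0 v\<^sub>0 l C \<epsilon> :: real
  assumes "0 \<le> l" "l < v\<^sub>0" "v\<^sub>0 \<le> u\<^sub>0" "0 \<le> C" "0 < \<epsilon>" "\<epsilon> < 1"
  shows "\<exists>n\<^sub>1 n\<^sub>2. even n\<^sub>1 \<and> 0 < n\<^sub>1 \<and> 0 < n\<^sub>2 \<and> (\<forall>w. 0 \<le> w \<and> w \<le> C * l ^ n\<^sub>1 \<longrightarrow>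
    (1 - \<epsilon>) * ((2 * (u\<^sub>0 ^ n\<^sub>1 + v\<^sub>0 ^ n\<^sub>1) + w) ^ n\<^sub>2 + (2 * (u\<^sub>0 ^ n\<^sub>1 - v\<^sub>0 ^ n\<^sub>1) + w) ^ n\<^sub>2)
      \<le> (2 * (u\<^sub>0 ^ n\<^sub>1 + v\<^sub>0 ^ n\<^sub>1)) ^ n\<^sub>2)"
proof -
  define L where "L = 2 * ln (2 / \<epsilon>)"
  have "ln (2 / \<epsilon>) > 0" using assms by (intro ln_gt_zero) (simp add: field_simps)
  then have L: "0 < L" by (simp add: L_def)
  have exp_L: "exp (- L / 2) = \<epsilon> / 2"
    using assms by (simp add: L_def exp_minus ln_div flip: ln_div)
  \<comment> \<open>\<open>\<delta>\<close> will bound \<open>w / v\<close>: at most one, so that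
    \<open>w \<le> v\<close>, and small enough to keep the accumulated bit error
    \<open>exp ((L + 1) / 2 * \<delta>)\<close> within \<open>1 + \<epsilon> / 2\<close>.\<close>
  define \<delta> where "\<delta> = min 1 (ln (1 + \<epsilon> / 2) / ((L + 1) / 2))"
  have \<delta>: "0 < \<delta>" "\<delta> \<le> 1" "(L + 1) / 2 * \<delta> \<le> ln (1 + \<epsilon> / 2)"
  proof -
    have "0 < ln (1 + \<epsilon> / 2)" using assms by (intro ln_gt_zero) simp
    then show "0 < \<delta>" using L by (simp add: \<delta>_def)
    show "\<delta> \<le> 1" by (simp add: \<delta>_def)
    have "\<delta> \<le> ln (1 + \<epsilon> / 2) / ((L + 1) / 2)" by (simp add: \<delta>_def)
    then show "(L + 1) / 2 * \<delta> \<le> ln (1 + \<epsilon> / 2)" using L by (simp add: field_simps)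
  qed
  have v0: "0 < v\<^sub>0" using assms by simp
  have "(\<lambda>n. C * (l / v\<^sub>0) ^ n) \<longlonglongrightarrow> C * 0"
    using assms v0 by (intro tendsto_mult tendsto_const LIMSEQ_realpow_zero) auto
  then have "eventually (\<lambda>n. C * (l / v\<^sub>0) ^ n < \<delta>) sequentially"
    using \<delta>(1) by (intro order_tendstoD(2)[where y = "C * 0"]) auto
  then obtain n\<^sub>0 where n\<^sub>0: "\<And>n. n\<^sub>0 \<le> n \<Longrightarrow> C * (l / v\<^sub>0) ^ n < \<delta>"
    by (auto simp: eventually_sequentially)
  \<comment> \<open>Doubling makes \<open>n\<^sub>1\<close> even; the increment makes it
    positive.\<close>
  define n\<^sub>1 where "n\<^sub>1 = 2 * (n\<^sub>0 + 1)"
  define u where "u = u\<^sub>0 ^ n\<^sub>1"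
  define v where "v = v\<^sub>0 ^ n\<^sub>1"
  define n\<^sub>2 where "n\<^sub>2 = nat \<lceil>L * u / v\<rceil>"
  have uv: "0 < v" "v \<le> u" using v0 assms(3) by (auto simp: u_def v_def intro: power_mono)
  have n2_ge: "L * u / v \<le> n\<^sub>2" unfolding n\<^sub>2_def by (rule real_nat_ceiling_ge)
  have n2_le: "n\<^sub>2 \<le> (L + 1) * u / v"
  proof -
    have "0 \<le> L * u / v" using L uv by simp
    then have "n\<^sub>2 \<le> L * u / v + 1" unfolding n\<^sub>2_def by linarith
    also have "1 \<le> u / v" using uv by simp
    finally show ?thesis by (simp add: add_divide_distrib distrib_right)
  qed
  have "0 < L * u / v" using L uv by simp
  then have n2_pos: "0 < n\<^sub>2" using n2_ge by linarith
  have "(1 - \<epsilon>) * ((2 * (u + v) + w) ^ n\<^sub>2 + (2 * (u - v) + w) ^ n\<^sub>2) \<le> (2 * (u + v)) ^ n\<^sub>2"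
    if w: "0 \<le> w" "w \<le> C * l ^ n\<^sub>1" for w
  proof -
    have "w / v \<le> C * (l / v\<^sub>0) ^ n\<^sub>1" using w uv by (simp add: v_def power_divide divide_right_mono)
    then have wv: "w / v \<le> \<delta>" using n\<^sub>0[of n\<^sub>1] by (simp add: n\<^sub>1_def)
    then have "w / v \<le> 1" using \<delta>(2) by linarith
    then have "w \<le> v" using uv by simp
    define t where "t = w / (2 * (u + v))"
    have t: "0 \<le> t" using w uv by (simp add: t_def)
    have "n\<^sub>2 * t \<le> ((L + 1) * u / v) * (w / (2 * u))"
      unfolding t_def using n2_le uv w L by (intro mult_mono divide_left_mono) auto
    also have "\<dots> = (L + 1) / 2 * (w / v)" using uv by (simp add: field_simps)
    also have "\<dots> \<le> (L + 1) / 2 * \<delta>" using wv L by (intro mult_left_mono) auto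
    finally have nt: "n\<^sub>2 * t \<le> ln (1 + \<epsilon> / 2)" using \<delta>(3) by linarith
    have "(1 + t) ^ n\<^sub>2 \<le> exp t ^ n\<^sub>2" using t exp_ge_add_one_self[of t] by (intro power_mono) auto
    also have "\<dots> = exp (n\<^sub>2 * t)" by (simp add: exp_of_nat_mult)
    also have "\<dots> \<le> 1 + \<epsilon> / 2" using nt assms by (simp add: ln_ge_iff)
    finally have 1: "(1 + t) ^ n\<^sub>2 \<le> 1 + \<epsilon> / 2" .
    define y where "y = (4 * v - w) / (2 * (u + v))"
    have y1: "1 - y = (2 * (u - v) + w) / (2 * (u + v))" using uv by (simp add: y_def field_simps)
    have "v / (2 * u) \<le> (4 * v - w) / (4 * u)"
      using \<open>w \<le> v\<close> uv by (simp add: field_simps)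
    also have "\<dots> \<le> y" unfolding y_def using \<open>w \<le> v\<close> uv by (intro divide_left_mono) auto
    finally have y2: "v / (2 * u) \<le> y" .
    have "L / 2 = (L * u / v) * (v / (2 * u))" using uv by (simp add: field_simps)
    also have "\<dots> \<le> n\<^sub>2 * y" using n2_ge y2 uv L by (intro mult_mono) auto
    finally have ny: "L / 2 \<le> n\<^sub>2 * y" .
    have "0 \<le> 1 - y" unfolding y1 using uv w by simp
    then have "(1 - y) ^ n\<^sub>2 \<le> exp (- y) ^ n\<^sub>2"
      using exp_ge_add_one_self[of "- y"] by (intro power_mono) auto
    also have "\<dots> = exp (- (n\<^sub>2 * y))" using exp_of_nat_mult[of n\<^sub>2 "- y"] by simp
    also have "\<dots> \<le> exp (- L / 2)" using ny by simp
    finally have 2: "(1 - y) ^ n\<^sub>2 \<le> \<epsilon> / 2" using exp_L by simp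
    have "2 * (u + v) + w = 2 * (u + v) * (1 + t)" "2 * (u - v) + w = 2 * (u + v) * (1 - y)"
      unfolding y1 t_def using uv by (simp_all add: field_simps)
    then have "(2 * (u + v) + w) ^ n\<^sub>2 + (2 * (u - v) + w) ^ n\<^sub>2 =
        (2 * (u + v)) ^ n\<^sub>2 * ((1 + t) ^ n\<^sub>2 + (1 - y) ^ n\<^sub>2)"
      by (simp only: power_mult_distrib[of "2 * (u + v)"] distrib_left[of "(2 * (u + v)) ^ n\<^sub>2"])
    also have "\<dots> \<le> (2 * (u + v)) ^ n\<^sub>2 * (1 + \<epsilon>)"
      using 1 2 uv by (intro mult_left_mono) auto
    finally have "(1 - \<epsilon>) * ((2 * (u + v) + w) ^ n\<^sub>2 + (2 * (u - v) + w) ^ n\<^sub>2) \<le>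
        (1 - \<epsilon>) * ((2 * (u + v)) ^ n\<^sub>2 * (1 + \<epsilon>))"
      using assms by (intro mult_left_mono) auto
    also have "\<dots> = (2 * (u + v)) ^ n\<^sub>2 * (1 - \<epsilon> * \<epsilon>)" by (simp add: algebra_simps)
    also have "\<dots> \<le> (2 * (u + v)) ^ n\<^sub>2 * 1"
      using uv assms by (intro mult_left_mono) auto
    finally show ?thesis by simp
  qed
  moreover have "even n\<^sub>1" "0 < n\<^sub>1" by (simp_all add: n\<^sub>1_def)
  ultimately show ?thesis using n2_pos unfolding u_def v_def by blast
qed

section \<open>Parity sums over blocks\<close>

lemma sum_PiE_prod2:
  fixes f :: "'a \<Rightarrow> 'a \<Rightarrow> real"
  assumes "finite S"
  shows "(\<Sum>w\<in>{..<n} \<rightarrow>\<^sub>E S. \<Sum>w'\<in>{..<n} \<rightarrow>\<^sub>E S. \<Prod>i<n. f (w i) (w' i)) =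
    (\<Sum>s\<in>S. \<Sum>s'\<in>S. f s s') ^ n"
proof -
  have "(\<Sum>w'\<in>{..<n} \<rightarrow>\<^sub>E S. \<Prod>i<n. f (w i) (w' i)) = (\<Prod>i<n. \<Sum>s'\<in>S. f (w i) s')" for w :: "nat \<Rightarrow> 'a"
    using assms by (subst prod_sum_PiE) auto
  then have "(\<Sum>w\<in>{..<n} \<rightarrow>\<^sub>E S. \<Sum>w'\<in>{..<n} \<rightarrow>\<^sub>E S. \<Prod>i<n. f (w i) (w' i)) =
      (\<Sum>w\<in>{..<n} \<rightarrow>\<^sub>E S. \<Prod>i<n. \<Sum>s'\<in>S. f (w i) s')"
    by (intro sum.cong) auto
  also have "\<dots> = (\<Prod>i<n. \<Sum>s\<in>S. \<Sum>s'\<in>S. f s s')"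
    using assms by (subst prod_sum_PiE) auto
  finally show ?thesis by simp
qed

definition parity :: "nat \<Rightarrow> (nat \<Rightarrow> nat \<Rightarrow> nat) \<Rightarrow> nat \<Rightarrow> nat" where
  "parity n w g = (\<Sum>i<n. w i g) mod 2"

text \<open>Up to the factor \<open>1 / sqrt 2\<close> this is the amplitude of the cat vector at
  the string of the parties' parities.\<close>

definition parity_weight :: "nat \<Rightarrow> nat \<Rightarrow> (nat \<Rightarrow> nat \<Rightarrow> nat) \<Rightarrow> real" where
  "parity_weight M n w = of_bool (\<forall>g<M. parity n w g = 0) + of_bool (\<forall>g<M. parity n w g = 1)"

text \<open>\<open>f\<close> abstracts single-copy entries raised to the power
  \<open>n\<^sub>1\<close>, between patterns with one bit per party. The values \<open>u\<close> and
  \<open>v\<close> sit at the four pairs of constant patterns, and \<open>l\<close> bounds all other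
  entries.\<close>

locale nonneg_kernel =
  fixes M n :: nat and f :: "(nat \<Rightarrow> nat) \<Rightarrow> (nat \<Rightarrow> nat) \<Rightarrow> real" and u v l :: real
  assumes M: "0 < M"
    and f_nonneg: "\<And>s s'. s \<in> {..<M} \<rightarrow>\<^sub>E {0, 1} \<Longrightarrow> s' \<in> {..<M} \<rightarrow>\<^sub>E {0, 1} \<Longrightarrow> 0 \<le> f s s'"
    and f_const: "\<And>b b'. b \<in> {0, 1} \<Longrightarrow> b' \<in> {0, 1} \<Longrightarrow>
      f (\<lambda>g\<in>{..<M}. b) (\<lambda>g\<in>{..<M}. b') = (if b = b' then u else v)"
    and f_le: "\<And>s s'. s \<in> {..<M} \<rightarrow>\<^sub>E {0, 1} \<Longrightarrow> s' \<in> {..<M} \<rightarrow>\<^sub>E {0, 1} \<Longrightarrow>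
      \<not> (\<exists>b\<in>{0, 1}. \<exists>b'\<in>{0, 1}. s = (\<lambda>g\<in>{..<M}. b) \<and> s' = (\<lambda>g\<in>{..<M}. b')) \<Longrightarrow> f s s' \<le> l"
    and uv: "v \<le> u" and l_nonneg: "0 \<le> l"
begin

abbreviation "S \<equiv> {..<M} \<rightarrow>\<^sub>E {0, 1 :: nat}"
abbreviation "c b \<equiv> (\<lambda>g\<in>{..<M}. b) :: nat \<Rightarrow> nat"
abbreviation "W \<equiv> {..<n} \<rightarrow>\<^sub>E S"

lemma finite_S: "finite S" and finite_W: "finite W"
  by (intro finite_PiE; simp)+

lemma c_in_S: "b \<in> {0, 1} \<Longrightarrow> c b \<in> S"
  by auto

lemma c_neq: "c 0 \<noteq> c 1"
  using M by (metis lessThan_iff restrict_apply' zero_neq_one)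

lemma prod_nonneg: "w \<in> W \<Longrightarrow> w' \<in> W \<Longrightarrow> 0 \<le> (\<Prod>i<n. f (w i) (w' i))"
  by (intro Groups_Big.prod_nonneg ballI f_nonneg) (auto simp: PiE_iff)

text \<open>Sequences of constant patterns already give the bound: all parties then share one
  parity, so the weights are at least one, and the remaining terms are nonnegative.\<close>

lemma fidelity_ge:
  "(2 * (u + v)) ^ n \<le> (\<Sum>w\<in>W. \<Sum>w'\<in>W. parity_weight M n w * parity_weight M n w' * (\<Prod>i<n. f (w i) (w' i)))"
proof -
  let ?C = "{c 0, c 1}"
  let ?V = "{..<n} \<rightarrow>\<^sub>E ?C"
  have C: "?C \<subseteq> S" using c_in_S by simp
  have VW: "?V \<subseteq> W" by (rule PiE_mono) (use C in auto)
  have one: "1 \<le> parity_weight M n w" if "w \<in> ?V" for w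
  proof -
    have eq: "w i g = w i 0" if "i < n" "g < M" for i g
    proof -
      have "w i \<in> ?C" using \<open>w \<in> ?V\<close> that by (auto simp: PiE_iff)
      then show ?thesis using that M by auto
    qed
    have all: "parity n w g = parity n w 0" if "g < M" for g
    proof -
      have "(\<Sum>i<n. w i g) = (\<Sum>i<n. w i 0)"
        by (rule sum.cong[OF refl]) (rule eq[OF _ that], simp)
      then show ?thesis unfolding parity_def by (rule arg_cong)
    qed
    have "parity n w 0 = 0 \<or> parity n w 0 = 1" unfolding parity_def by presburger
    then have "(\<forall>g<M. parity n w g = 0) \<or> (\<forall>g<M. parity n w g = 1)" using all by metis
    then show ?thesis unfolding parity_weight_def by (elim disjE) simp_all
  qed
  have nonneg: "0 \<le> parity_weight M n w" for w by (simp add: parity_weight_def)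
  have "(2 * (u + v)) ^ n = (\<Sum>s\<in>?C. \<Sum>s'\<in>?C. f s s') ^ n"
    using c_neq f_const[of 0 0] f_const[of 0 1] f_const[of 1 0] f_const[of 1 1]
    by (simp add: add.commute)
  also have "\<dots> = (\<Sum>w\<in>?V. \<Sum>w'\<in>?V. \<Prod>i<n. f (w i) (w' i))"
    by (rule sum_PiE_prod2[symmetric]) simp
  also have "\<dots> \<le> (\<Sum>w\<in>?V. \<Sum>w'\<in>?V. parity_weight M n w * parity_weight M n w' * (\<Prod>i<n. f (w i) (w' i)))"
  proof (intro sum_mono)
    fix w w' assume ww: "w \<in> ?V" "w' \<in> ?V"
    have "1 * 1 \<le> parity_weight M n w * parity_weight M n w'"
      using one[OF ww(1)] one[OF ww(2)] by (intro mult_mono) (auto simp: nonneg)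
    then have le: "1 \<le> parity_weight M n w * parity_weight M n w'" by simp
    from mult_right_mono[OF le prod_nonneg[OF subsetD[OF VW ww(1)] subsetD[OF VW ww(2)]]]
    show "(\<Prod>i<n. f (w i) (w' i)) \<le>
        parity_weight M n w * parity_weight M n w' * (\<Prod>i<n. f (w i) (w' i))"
      by (simp only: mult_1)
  qed
  also have "\<dots> \<le> (\<Sum>w\<in>?V. \<Sum>w'\<in>W. parity_weight M n w * parity_weight M n w' * (\<Prod>i<n. f (w i) (w' i)))"
    by (rule sum_mono, rule sum_mono2[OF finite_W VW])
      (intro mult_nonneg_nonneg nonneg prod_nonneg; (rule subsetD[OF VW], assumption | erule DiffD1))
  also have "\<dots> \<le> (\<Sum>w\<in>W. \<Sum>w'\<in>W. parity_weight M n w * parity_weight M n w' * (\<Prod>i<n. f (w i) (w' i)))"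
    by (rule sum_mono2[OF finite_W VW], rule sum_nonneg)
      (intro mult_nonneg_nonneg nonneg prod_nonneg; (assumption | erule DiffD1))
  finally show ?thesis .
qed

text \<open>Equal parities at all parties imply equal parities at party 0, whose indicator is half
  of one plus a product of signs. Both resulting sums factorise over blocks, into powers of the
  plain total \<open>X\<close> and of the signed total \<open>Y\<close>; \<open>r\<close> collects
  the entries away from the constant patterns.\<close>

lemma trace_le:
  "\<exists>r. 0 \<le> r \<and> r \<le> card S ^ 2 * l \<and>
    2 * (\<Sum>w\<in>W. \<Sum>w'\<in>W. of_bool (\<forall>g<M. parity n w g = parity n w' g) * (\<Prod>i<n. f (w i) (w' i)))
      \<le> (2 * (u + v) + r) ^ n + (2 * (u - v) + r) ^ n"
proof -
  let ?C = "{c 0, c 1}"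
  define sg where "sg s s' = (-1 :: real) ^ (s 0 + s' 0)" for s s' :: "nat \<Rightarrow> nat"
  define X where "X = (\<Sum>s\<in>S. \<Sum>s'\<in>S. f s s')"
  define Y where "Y = (\<Sum>s\<in>S. \<Sum>s'\<in>S. sg s s' * f s s')"
  define r where "r = (\<Sum>(s, s')\<in>S \<times> S - ?C \<times> ?C. f s s')"
  have C: "?C \<times> ?C \<subseteq> S \<times> S" using c_in_S by auto
  have fin: "finite (S \<times> S)" using finite_S by simp
  have split: "(\<Sum>s\<in>S. \<Sum>s'\<in>S. F s s') = (\<Sum>s\<in>?C. \<Sum>s'\<in>?C. F s s') + (\<Sum>(s, s')\<in>S \<times> S - ?C \<times> ?C. F s s')"
    for F :: "_ \<Rightarrow> _ \<Rightarrow> real"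
    unfolding sum.cartesian_product using sum.subset_diff[OF C fin] by (simp add: add.commute)
  have X: "X = 2 * (u + v) + r"
    unfolding X_def split r_def
    using c_neq f_const[of 0 0] f_const[of 0 1] f_const[of 1 0] f_const[of 1 1] by simp
  have r_nonneg: "0 \<le> r"
    unfolding r_def using f_nonneg by (intro sum_nonneg) auto
  have "r \<le> (\<Sum>(s, s')\<in>S \<times> S - ?C \<times> ?C. l)"
    unfolding r_def
  proof (rule sum_mono)
    fix p assume p: "p \<in> S \<times> S - ?C \<times> ?C"
    obtain s s' where ss: "p = (s, s')" by (cases p)
    have "s \<in> S" "s' \<in> S" "(s, s') \<notin> ?C \<times> ?C" using p unfolding ss by blast+
    then have "f s s' \<le> l" by (intro f_le) auto
    then show "(case p of (s, s') \<Rightarrow> f s s') \<le> (case p of (s, s') \<Rightarrow> l)" by (simp add: ss)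
  qed
  also have "\<dots> \<le> card S ^ 2 * l"
  proof -
    have "card (S \<times> S - ?C \<times> ?C) \<le> card (S \<times> S)" by (intro card_mono fin) auto
    then have "real (card (S \<times> S - ?C \<times> ?C)) \<le> card S ^ 2"
      by (simp add: card_cartesian_product power2_eq_square flip: of_nat_mult)
    then show ?thesis using mult_right_mono[OF _ l_nonneg] by (simp add: case_prod_unfold)
  qed
  finally have r_le: "r \<le> card S ^ 2 * l" .
  have "\<bar>Y\<bar> \<le> 2 * (u - v) + r"
  proof -
    define r' where "r' = (\<Sum>(s, s')\<in>S \<times> S - ?C \<times> ?C. sg s s' * f s s')"
    have "Y = 2 * (u - v) + r'"
      unfolding r'_def Y_def split sg_def
      using c_neq M f_const[of 0 0] f_const[of 0 1] f_const[of 1 0] f_const[of 1 1] by simp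
    moreover have "\<bar>r'\<bar> \<le> r"
      unfolding r_def r'_def
    proof (rule order_trans[OF sum_abs], rule sum_mono)
      fix p assume p: "p \<in> S \<times> S - ?C \<times> ?C"
      obtain s s' where ss: "p = (s, s')" by (cases p)
      have "s \<in> S" "s' \<in> S" using p unfolding ss by blast+
      then have "0 \<le> f s s'" by (rule f_nonneg)
      then show "\<bar>case p of (s, s') \<Rightarrow> sg s s' * f s s'\<bar> \<le> (case p of (s, s') \<Rightarrow> f s s')"
        by (simp add: ss sg_def abs_mult power_abs)
    qed
    moreover have "\<bar>2 * (u - v)\<bar> = 2 * (u - v)" using uv by simp
    ultimately show ?thesis using abs_triangle_ineq[of "2 * (u - v)" r'] by linarith
  qed
  have "2 * (\<Sum>w\<in>W. \<Sum>w'\<in>W. of_bool (\<forall>g<M. parity n w g = parity n w' g) * (\<Prod>i<n. f (w i) (w' i))) =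
     (\<Sum>w\<in>W. \<Sum>w'\<in>W. 2 * of_bool (\<forall>g<M. parity n w g = parity n w' g) * (\<Prod>i<n. f (w i) (w' i)))"
    by (simp only: sum_distrib_left mult.assoc)
  also have "\<dots> \<le> (\<Sum>w\<in>W. \<Sum>w'\<in>W. (1 + (\<Prod>i<n. sg (w i) (w' i))) * (\<Prod>i<n. f (w i) (w' i)))"
  proof (intro sum_mono mult_right_mono prod_nonneg)
    fix w w' assume "w \<in> W" "w' \<in> W"
    have sg: "(\<Prod>i<n. sg (w i) (w' i)) = (-1) ^ ((\<Sum>i<n. w i 0) + (\<Sum>i<n. w' i 0))"
      by (simp add: sg_def power_add power_sum prod.distrib)
    have "(\<Prod>i<n. sg (w i) (w' i)) = 1" if "\<forall>g<M. parity n w g = parity n w' g"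
    proof -
      have "parity n w 0 = parity n w' 0" using that M by simp
      then have "even ((\<Sum>i<n. w i 0) + (\<Sum>i<n. w' i 0))"
        unfolding parity_def by presburger
      then show ?thesis by (simp add: sg)
    qed
    moreover have "- 1 \<le> (\<Prod>i<n. sg (w i) (w' i))"
      unfolding sg by (cases "even ((\<Sum>i<n. w i 0) + (\<Sum>i<n. w' i 0))") auto
    ultimately show "2 * of_bool (\<forall>g<M. parity n w g = parity n w' g) \<le> 1 + (\<Prod>i<n. sg (w i) (w' i))"
      by auto
  qed
  also have "\<dots> = (\<Sum>w\<in>W. \<Sum>w'\<in>W. \<Prod>i<n. f (w i) (w' i)) +
      (\<Sum>w\<in>W. \<Sum>w'\<in>W. \<Prod>i<n. sg (w i) (w' i) * f (w i) (w' i))"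
    by (simp add: distrib_right sum.distrib prod.distrib)
  also have "\<dots> = X ^ n + Y ^ n"
    unfolding X_def Y_def by (simp only: sum_PiE_prod2[OF finite_S, where f = f]
        sum_PiE_prod2[OF finite_S, where f = "\<lambda>s s'. sg s s' * f s s'"])
  also have "Y ^ n \<le> \<bar>Y\<bar> ^ n" using abs_ge_self[of "Y ^ n"] by (simp add: power_abs)
  also have "\<bar>Y\<bar> ^ n \<le> (2 * (u - v) + r) ^ n"
    using \<open>\<bar>Y\<bar> \<le> 2 * (u - v) + r\<close> by (intro power_mono) auto
  finally show ?thesis
    using r_nonneg r_le unfolding X by (intro exI[of _ r]) simp
qed

text \<open>The diagonal term of the all-zero sequence alone contributes
  \<open>u ^ n\<close>.\<close>

lemma trace_pos:
  assumes "0 < u"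
  shows "0 < (\<Sum>w\<in>W. \<Sum>w'\<in>W. of_bool (\<forall>g<M. parity n w g = parity n w' g) * (\<Prod>i<n. f (w i) (w' i)))"
proof -
  define z where "z = (\<lambda>i\<in>{..<n}. c 0)"
  have z: "z \<in> W"
    unfolding z_def using c_in_S[of 0] by (intro restrict_PiE_iff[THEN iffD2]) blast
  have "0 < u ^ n" using assms by simp
  also have "\<dots> = of_bool (\<forall>g<M. parity n z g = parity n z g) * (\<Prod>i<n. f (z i) (z i))"
    using f_const[of 0 0] by (simp add: z_def)
  also have "\<dots> \<le> (\<Sum>w'\<in>W. of_bool (\<forall>g<M. parity n z g = parity n w' g) * (\<Prod>i<n. f (z i) (w' i)))"
    by (rule member_le_sum[OF z _ finite_W]) (rule mult_nonneg_nonneg, simp, rule prod_nonneg[OF z], blast)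
  also have "\<dots> \<le> (\<Sum>w\<in>W. \<Sum>w'\<in>W. of_bool (\<forall>g<M. parity n w g = parity n w' g) * (\<Prod>i<n. f (w i) (w' i)))"
    by (rule member_le_sum[OF z _ finite_W])
      (rule sum_nonneg, rule mult_nonneg_nonneg, simp, rule prod_nonneg, blast)
  finally show ?thesis .
qed

end

subsection \<open>The local filter\<close>

locale blocks =
  fixes N M n\<^sub>1 n\<^sub>2 :: nat and grp :: "nat \<Rightarrow> nat"
  assumes M: "0 < M" and grp: "grp ` {..<N} = {..<M}" and n\<^sub>1: "0 < n\<^sub>1" and n\<^sub>2: "0 < n\<^sub>2"
begin

definition members :: "nat \<Rightarrow> nat set" where
  "members g = {q. q < N \<and> grp q = g}"

definition rep :: "nat \<Rightarrow> nat" where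
  "rep g = (SOME q. q \<in> members g)"

text \<open>Constancy on a block is expressed by comparison with the representative qubit in the
  first copy of that block.\<close>

definition D :: "nat \<Rightarrow> (nat \<times> nat \<Rightarrow> nat) set" where
  "D g = {u \<in> party_basis (n\<^sub>2 * n\<^sub>1) N grp g.
     \<forall>c<n\<^sub>2 * n\<^sub>1. \<forall>q\<in>members g. u (c, q) = u (c div n\<^sub>1 * n\<^sub>1, rep g)}"

definition h :: "nat \<Rightarrow> (nat \<times> nat \<Rightarrow> nat) \<Rightarrow> nat \<times> nat \<Rightarrow> nat" where
  "h g u = (\<lambda>i\<in>{(0, g)}. (\<Sum>\<beta><n\<^sub>2. u (\<beta> * n\<^sub>1, rep g)) mod 2)"

text \<open>A preimage of a parity bit: the first block carries the bit and all other blocks carry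
  zeros.\<close>

definition canon :: "nat \<Rightarrow> (nat \<times> nat \<Rightarrow> nat) \<Rightarrow> nat \<times> nat \<Rightarrow> nat" where
  "canon g l = (\<lambda>(c, q)\<in>{..<n\<^sub>2 * n\<^sub>1} \<times> members g. if c div n\<^sub>1 = 0 then l (0, g) else 0)"

text \<open>This parametrises the labels that pass the filter by one bit per block and
  party.\<close>

definition spread :: "(nat \<Rightarrow> nat \<Rightarrow> nat) \<Rightarrow> nat \<Rightarrow> nat \<times> nat \<Rightarrow> nat" where
  "spread w = (\<lambda>g\<in>{..<M}. \<lambda>(c, q)\<in>{..<n\<^sub>2 * n\<^sub>1} \<times> members g. w (c div n\<^sub>1) g)"

lemma rep: "g < M \<Longrightarrow> rep g \<in> members g"
proof -
  assume "g < M"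
  then have "g \<in> grp ` {..<N}" using grp by simp
  then have "\<exists>q. q \<in> members g" unfolding members_def by blast
  then show ?thesis unfolding rep_def by (rule someI_ex)
qed

lemma block_less: "\<beta> < n\<^sub>2 \<Longrightarrow> \<beta> * n\<^sub>1 < n\<^sub>2 * n\<^sub>1" and div_block: "\<beta> * n\<^sub>1 div n\<^sub>1 = \<beta>"
  and block_div: "c < n\<^sub>2 * n\<^sub>1 \<Longrightarrow> c div n\<^sub>1 < n\<^sub>2"
  using n\<^sub>1 by (simp_all add: less_mult_imp_div_less)

lemma party_basis_members:
  "party_basis (n\<^sub>2 * n\<^sub>1) N grp g = {..<n\<^sub>2 * n\<^sub>1} \<times> members g \<rightarrow>\<^sub>E {0, 1}"
  by (simp add: party_basis_def members_def)

lemma party_basis_bit: "g < M \<Longrightarrow> party_basis 1 M id g = {(0, g)} \<rightarrow>\<^sub>E {0, 1}"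
proof -
  assume "g < M"
  then have "{..<1::nat} \<times> {q. q < M \<and> id q = g} = {(0, g)}" by auto
  then show ?thesis by (simp only: party_basis_def)
qed

lemma h_in: "g < M \<Longrightarrow> h g u \<in> party_basis 1 M id g"
  unfolding party_basis_bit h_def restrict_PiE_iff by auto

lemma canon_h:
  assumes "g < M"
  shows "canon g (h g u) \<in> party_basis (n\<^sub>2 * n\<^sub>1) N grp g \<and> h g (canon g (h g u)) = h g u"
proof -
  let ?l = "(\<Sum>\<beta><n\<^sub>2. u (\<beta> * n\<^sub>1, rep g)) mod 2"
  have l: "h g u (0, g) = ?l" by (simp add: h_def)
  have "canon g (h g u) \<in> party_basis (n\<^sub>2 * n\<^sub>1) N grp g"
    unfolding party_basis_members canon_def restrict_PiE_iff l by auto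
  moreover have "h g (canon g (h g u)) = h g u"
  proof -
    have "canon g (h g u) (\<beta> * n\<^sub>1, rep g) = (if \<beta> = 0 then ?l else 0)" if "\<beta> < n\<^sub>2" for \<beta>
      using rep[OF assms] block_less[OF that] l by (simp add: canon_def div_block)
    then have "(\<Sum>\<beta><n\<^sub>2. canon g (h g u) (\<beta> * n\<^sub>1, rep g)) = (\<Sum>\<beta><n\<^sub>2. if \<beta> = 0 then ?l else 0)"
      by (intro sum.cong) auto
    also have "\<dots> = ?l" using n\<^sub>2 by simp
    finally show ?thesis unfolding h_def[of g "canon g (h g u)"] by (simp add: h_def)
  qed
  ultimately show ?thesis ..
qed

abbreviation "W \<equiv> {..<n\<^sub>2} \<rightarrow>\<^sub>E ({..<M} \<rightarrow>\<^sub>E {0, 1 :: nat})"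

lemma W_bit: "w \<in> W \<Longrightarrow> \<beta> < n\<^sub>2 \<Longrightarrow> g < M \<Longrightarrow> w \<beta> g \<in> {0, 1}"
  by (metis PiE_mem lessThan_iff)

lemma spread_apply:
  "g < M \<Longrightarrow> c < n\<^sub>2 * n\<^sub>1 \<Longrightarrow> q \<in> members g \<Longrightarrow> spread w g (c, q) = w (c div n\<^sub>1) g"
  by (simp add: spread_def)

lemma spread_in_D:
  assumes "w \<in> W" "g < M"
  shows "spread w g \<in> D g"
proof -
  have "spread w g \<in> party_basis (n\<^sub>2 * n\<^sub>1) N grp g"
    unfolding party_basis_members using assms(2) W_bit[OF assms(1) block_div assms(2)]
    by (simp add: spread_def Pi_def)
  moreover have "spread w g (c, q) = spread w g (c div n\<^sub>1 * n\<^sub>1, rep g)"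
    if "c < n\<^sub>2 * n\<^sub>1" "q \<in> members g" for c q
    using that assms(2) rep[OF assms(2)] block_less[OF block_div[OF that(1)]]
    by (simp add: spread_apply div_block)
  ultimately show ?thesis by (simp add: D_def)
qed

lemma D_subset: "D g \<subseteq> party_basis (n\<^sub>2 * n\<^sub>1) N grp g"
  by (auto simp: D_def)

text \<open>\<open>collapse\<close> reads the representative bit of each block and inverts
  \<open>spread\<close> on the labels in \<open>D\<close>.\<close>

lemma sum_filtered:
  "(\<Sum>u\<in>Pi\<^sub>E {..<M} (party_basis (n\<^sub>2 * n\<^sub>1) N grp). of_bool (\<forall>g<M. u g \<in> D g) * F u) = (\<Sum>w\<in>W. F (spread w))"
  for F :: "_ \<Rightarrow> complex"
proof -
  let ?X = "Pi\<^sub>E {..<M} (party_basis (n\<^sub>2 * n\<^sub>1) N grp)"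
  define collapse where "collapse u = (\<lambda>\<beta>\<in>{..<n\<^sub>2}. \<lambda>g\<in>{..<M}. u g (\<beta> * n\<^sub>1, rep g))"
    for u :: "nat \<Rightarrow> nat \<times> nat \<Rightarrow> nat"
  have X: "?X \<inter> {u. \<forall>g<M. u g \<in> D g} = Pi\<^sub>E {..<M} D"
  proof (intro equalityI subsetI)
    fix u assume "u \<in> ?X \<inter> {u. \<forall>g<M. u g \<in> D g}"
    then show "u \<in> Pi\<^sub>E {..<M} D" by (simp add: PiE_iff)
  next
    fix u assume "u \<in> Pi\<^sub>E {..<M} D"
    then show "u \<in> ?X \<inter> {u. \<forall>g<M. u g \<in> D g}" using D_subset by (simp add: PiE_iff subset_iff)
  qed
  have "(\<Sum>u\<in>?X. of_bool (\<forall>g<M. u g \<in> D g) * F u) = (\<Sum>u\<in>Pi\<^sub>E {..<M} D. F u)"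
    unfolding X[symmetric] by (rule sum_of_bool_mult_eq, rule finite_PiE) simp_all
  also have "\<dots> = (\<Sum>w\<in>W. F (spread w))"
  proof (rule sum.reindex_bij_witness[where i = spread and j = collapse])
    fix u assume u: "u \<in> Pi\<^sub>E {..<M} D"
    have uD: "u g \<in> D g" if "g < M" for g using PiE_mem[OF u, of g] that by simp
    have uP: "u g \<in> {..<n\<^sub>2 * n\<^sub>1} \<times> members g \<rightarrow>\<^sub>E {0, 1}" if "g < M" for g
      using subsetD[OF D_subset uD[OF that]] unfolding party_basis_members .
    have sc: "spread (collapse u) = u"
    proof (intro ext)
      fix g i
      show "spread (collapse u) g i = u g i"
      proof (cases "g < M")
        case True
        have ext: "u g i = undefined" if "i \<notin> {..<n\<^sub>2 * n\<^sub>1} \<times> members g"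
          by (rule PiE_arb[OF uP[OF True] that])
        show ?thesis
        proof (cases "i \<in> {..<n\<^sub>2 * n\<^sub>1} \<times> members g")
          case in_dom: True
          obtain c q where i: "i = (c, q)" by (cases i)
          with in_dom have cq: "c < n\<^sub>2 * n\<^sub>1" "q \<in> members g" by auto
          have "u g (c, q) = u g (c div n\<^sub>1 * n\<^sub>1, rep g)" using uD[OF True] cq by (simp add: D_def)
          then show ?thesis
            using True cq block_div[OF cq(1)] by (simp add: i spread_apply collapse_def)
        next
          case False
          then show ?thesis using True ext by (simp add: spread_def)
        qed
      next
        case False
        then show ?thesis using PiE_arb[OF u, of g] by (simp add: spread_def)
      qed
    qed
    from sc show "spread (collapse u) = u" .
    from sc show "F (spread (collapse u)) = F u" by simp
    show "collapse u \<in> W"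
      unfolding collapse_def restrict_PiE_iff
    proof (intro ballI)
      fix \<beta> g assume "\<beta> \<in> {..<n\<^sub>2}" "g \<in> {..<M}"
      then show "u g (\<beta> * n\<^sub>1, rep g) \<in> {0, 1}"
        using block_less[of \<beta>] by (intro PiE_mem[OF uP]) (auto simp: rep)
    qed
  next
    fix w assume w: "w \<in> W"
    have w_und: "w \<beta> = undefined" if "\<not> \<beta> < n\<^sub>2" for \<beta> using PiE_arb[OF w, of \<beta>] that by simp
    have w_und': "w \<beta> g = undefined" if "\<beta> < n\<^sub>2" "\<not> g < M" for \<beta> g
      using PiE_arb[OF PiE_mem[OF w, of \<beta>], of g] that by simp
    show "collapse (spread w) = w"
    proof (intro ext)
      fix \<beta> g
      show "collapse (spread w) \<beta> g = w \<beta> g"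
        using w_und[of \<beta>] w_und'[of \<beta> g] rep[of g] block_less[of \<beta>]
        by (cases "\<beta> < n\<^sub>2"; cases "g < M") (simp_all add: collapse_def spread_apply div_block)
    qed
    show "spread w \<in> Pi\<^sub>E {..<M} D"
      by (rule PiE_I) (use spread_in_D[OF w] in \<open>auto simp: spread_def\<close>)
  qed
  finally show ?thesis .
qed

lemma sum_filtered2:
  "(\<Sum>u\<in>Pi\<^sub>E {..<M} (party_basis (n\<^sub>2 * n\<^sub>1) N grp). \<Sum>u'\<in>Pi\<^sub>E {..<M} (party_basis (n\<^sub>2 * n\<^sub>1) N grp).
     of_bool (\<forall>g<M. u g \<in> D g) * (of_bool (\<forall>g<M. u' g \<in> D g) * F u u')) =
   (\<Sum>w\<in>W. \<Sum>w'\<in>W. F (spread w) (spread w'))" for F :: "_ \<Rightarrow> _ \<Rightarrow> complex"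
  unfolding sum_distrib_left[symmetric] sum_filtered ..

lemma h_spread: "w \<in> W \<Longrightarrow> g < M \<Longrightarrow> h g (spread w g) = (\<lambda>i\<in>{(0, g)}. parity n\<^sub>2 w g)"
  unfolding h_def parity_def using rep[of g] block_less
  by (intro restrict_ext arg_cong[where f = "\<lambda>m. m mod 2"] sum.cong) (auto simp: spread_apply div_block)

lemma h_spread_eq_iff:
  assumes "w \<in> W" "w' \<in> W"
  shows "(\<forall>g<M. h g (spread w g) = h g (spread w' g)) \<longleftrightarrow> (\<forall>g<M. parity n\<^sub>2 w g = parity n\<^sub>2 w' g)"
proof -
  have "h g (spread w g) = h g (spread w' g) \<longleftrightarrow> parity n\<^sub>2 w g = parity n\<^sub>2 w' g" if "g < M" for g
    unfolding h_spread[OF assms(1) that] h_spread[OF assms(2) that]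
    by (metis insertI1 restrict_apply')
  then show ?thesis by blast
qed

lemma cat_effect_spread:
  assumes "w \<in> W" "w' \<in> W"
  shows "cat_effect M (\<lambda>g\<in>{..<M}. h g (spread w g)) (\<lambda>g\<in>{..<M}. h g (spread w' g)) =
    of_real (parity_weight M n\<^sub>2 w * parity_weight M n\<^sub>2 w' / 2)"
proof -
  have prod: "(\<Prod>g<M. of_bool (b g = s) :: complex) = of_bool (\<forall>g<M. b g = s)" for b :: "nat \<Rightarrow> nat" and s
    by (auto intro!: prod.neutral)
  have "cat_vec M (\<lambda>g. (\<lambda>g\<in>{..<M}. h g (spread w g)) g (0, g)) =
      of_real (parity_weight M n\<^sub>2 w / sqrt 2)" if "w \<in> W" for w
  proof -
    have "(\<Prod>g<M. of_bool ((\<lambda>g\<in>{..<M}. h g (spread w g)) g (0, g) = s) :: complex) =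
        of_bool (\<forall>g<M. parity n\<^sub>2 w g = s)" for s
      unfolding prod[symmetric] by (intro prod.cong) (simp_all add: h_spread[OF that])
    then show ?thesis
      by (simp add: cat_vec_def parity_weight_def)
  qed
  then show ?thesis
    unfolding cat_effect_def using assms
    by (simp flip: of_real_mult)
qed

text \<open>The \<open>n\<^sub>1\<close> copies of a block carry the same bits, so their equal
  entries multiply to a power.\<close>

lemma distribute_spread:
  assumes "local_oper N \<rho>"
  shows "distribute grp (tensor_power (n\<^sub>2 * n\<^sub>1) \<rho>) (spread w) (spread w') =
    (\<Prod>\<beta><n\<^sub>2. \<rho> (\<lambda>q. w \<beta> (grp q)) (\<lambda>q. w' \<beta> (grp q)) ^ n\<^sub>1)"
proof -
  have g: "grp q < M" "q \<in> members (grp q)" if "q < N" for q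
    using that grp by (auto simp: members_def)
  have "distribute grp (tensor_power (n\<^sub>2 * n\<^sub>1) \<rho>) (spread w) (spread w') =
    (\<Prod>c<n\<^sub>2 * n\<^sub>1. \<rho> (\<lambda>q. w (c div n\<^sub>1) (grp q)) (\<lambda>q. w' (c div n\<^sub>1) (grp q)))"
    unfolding distribute_def tensor_power_def
    by (intro prod.cong refl local_operD[OF assms]) (simp_all add: spread_apply g)
  also have "\<dots> = (\<Prod>\<beta><n\<^sub>2. \<Prod>c\<in>{\<beta> * n\<^sub>1..<\<beta> * n\<^sub>1 + n\<^sub>1}. \<rho> (\<lambda>q. w (c div n\<^sub>1) (grp q)) (\<lambda>q. w' (c div n\<^sub>1) (grp q)))"
    by (rule prod.nat_group[symmetric])
  also have "\<dots> = (\<Prod>\<beta><n\<^sub>2. \<Prod>c\<in>{\<beta> * n\<^sub>1..<\<beta> * n\<^sub>1 + n\<^sub>1}. \<rho> (\<lambda>q. w \<beta> (grp q)) (\<lambda>q. w' \<beta> (grp q)))"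
  proof (intro prod.cong refl)
    fix \<beta> c assume "c \<in> {\<beta> * n\<^sub>1..<\<beta> * n\<^sub>1 + n\<^sub>1}"
    then have "c div n\<^sub>1 = \<beta>"
      by (intro div_nat_eqI) (auto simp: mult.commute)
    then show "\<rho> (\<lambda>q. w (c div n\<^sub>1) (grp q)) (\<lambda>q. w' (c div n\<^sub>1) (grp q)) =
        \<rho> (\<lambda>q. w \<beta> (grp q)) (\<lambda>q. w' \<beta> (grp q))" by simp
  qed
  finally show ?thesis by simp
qed

end

section \<open>Success probability and fidelity of the filter\<close>

text \<open>Labels grouped by party are traded for bit strings grouped by copy, so that the trace
  factorises over the copies.\<close>

lemma sum_flatten:
  fixes F :: "(nat \<Rightarrow> nat \<Rightarrow> nat) \<Rightarrow> complex"
  assumes grp: "grp ` {..<N} = {..<M}"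
  shows "(\<Sum>u\<in>Pi\<^sub>E {..<M} (party_basis n N grp). F (\<lambda>c\<in>{..<n}. \<lambda>q\<in>{..<N}. u (grp q) (c, q))) =
    (\<Sum>x\<in>{..<n} \<rightarrow>\<^sub>E ({..<N} \<rightarrow>\<^sub>E {0, 1}). F x)"
proof (rule sum.reindex_bij_witness[where j = "\<lambda>u. \<lambda>c\<in>{..<n}. \<lambda>q\<in>{..<N}. u (grp q) (c, q)"
      and i = "\<lambda>x. \<lambda>g\<in>{..<M}. \<lambda>(c, q)\<in>{..<n} \<times> {q. q < N \<and> grp q = g}. x c q"])
  have g: "grp q < M" if "q < N" for q using grp that by auto
  fix u assume u: "u \<in> Pi\<^sub>E {..<M} (party_basis n N grp)"
  have ug: "u g \<in> {..<n} \<times> {q. q < N \<and> grp q = g} \<rightarrow>\<^sub>E {0, 1}" if "g < M" for g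
    using PiE_mem[OF u, of g] that by (simp add: party_basis_def)
  show "(\<lambda>g\<in>{..<M}. \<lambda>(c, q)\<in>{..<n} \<times> {q. q < N \<and> grp q = g}.
      (\<lambda>c\<in>{..<n}. \<lambda>q\<in>{..<N}. u (grp q) (c, q)) c q) = u"
  proof (intro ext)
    fix g and i :: "nat \<times> nat"
    obtain c q where i: "i = (c, q)" by (cases i)
    show "(\<lambda>g\<in>{..<M}. \<lambda>(c, q)\<in>{..<n} \<times> {q. q < N \<and> grp q = g}.
      (\<lambda>c\<in>{..<n}. \<lambda>q\<in>{..<N}. u (grp q) (c, q)) c q) g i = u g i"
      using PiE_arb[OF u, of g] PiE_arb[OF ug, of g i]
      by (cases "g < M"; cases "c < n \<and> q < N \<and> grp q = g") (auto simp: i)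
  qed
  show "(\<lambda>c\<in>{..<n}. \<lambda>q\<in>{..<N}. u (grp q) (c, q)) \<in> {..<n} \<rightarrow>\<^sub>E ({..<N} \<rightarrow>\<^sub>E {0, 1})"
    unfolding restrict_PiE_iff
  proof (intro ballI)
    fix c q assume "c \<in> {..<n}" "q \<in> {..<N}"
    then show "u (grp q) (c, q) \<in> {0, 1}"
      using PiE_mem[OF ug[OF g], of q "(c, q)"] by simp
  qed
next
  have g: "grp q < M" if "q < N" for q using grp that by auto
  fix x assume x: "x \<in> {..<n} \<rightarrow>\<^sub>E ({..<N} \<rightarrow>\<^sub>E {0, 1 :: nat})"
  have xc: "x c \<in> {..<N} \<rightarrow>\<^sub>E {0, 1}" if "c < n" for c
    using PiE_mem[OF x, of c] that by simp
  show "(\<lambda>c\<in>{..<n}. \<lambda>q\<in>{..<N}. (\<lambda>g\<in>{..<M}. \<lambda>(c, q)\<in>{..<n} \<times> {q. q < N \<and> grp q = g}. x c q)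
      (grp q) (c, q)) = x"
  proof (intro ext)
    fix c q
    show "(\<lambda>c\<in>{..<n}. \<lambda>q\<in>{..<N}. (\<lambda>g\<in>{..<M}. \<lambda>(c, q)\<in>{..<n} \<times> {q. q < N \<and> grp q = g}. x c q)
      (grp q) (c, q)) c q = x c q"
      using PiE_arb[OF x, of c] PiE_arb[OF xc, of c q] g[of q]
      by (cases "c < n"; cases "q < N") auto
  qed
  show "(\<lambda>g\<in>{..<M}. \<lambda>(c, q)\<in>{..<n} \<times> {q. q < N \<and> grp q = g}. x c q)
      \<in> Pi\<^sub>E {..<M} (party_basis n N grp)"
    unfolding restrict_PiE_iff party_basis_def
  proof (intro ballI)
    fix g i assume "i \<in> {..<n} \<times> {q. q < N \<and> grp q = g}"
    then show "(case i of (c, q) \<Rightarrow> x c q) \<in> {0, 1}"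
      using PiE_mem[OF xc, of "fst i" "snd i"] by (cases i) simp
  qed
qed simp

lemma trace_noisy_cat:
  assumes grp: "grp ` {..<N} = {..<M}" and p: "pauli_probs p" and N: "0 < N"
  shows "(\<Sum>u\<in>Pi\<^sub>E {..<M} (party_basis n N grp). distribute grp (tensor_power n (noisy_cat p N)) u u) = 1"
proof -
  let ?S = "{..<N} \<rightarrow>\<^sub>E {0, 1 :: nat}"
  have finS: "finite ?S" by (intro finite_PiE) auto
  have "distribute grp (tensor_power n (noisy_cat p N)) u u =
      (\<Prod>c<n. noisy_cat p N ((\<lambda>c\<in>{..<n}. \<lambda>q\<in>{..<N}. u (grp q) (c, q)) c)
         ((\<lambda>c\<in>{..<n}. \<lambda>q\<in>{..<N}. u (grp q) (c, q)) c))" for u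
    unfolding distribute_def tensor_power_def
    by (intro prod.cong refl local_operD[OF local_oper_noisy_cat]) simp_all
  then have "(\<Sum>u\<in>Pi\<^sub>E {..<M} (party_basis n N grp). distribute grp (tensor_power n (noisy_cat p N)) u u) =
     (\<Sum>x\<in>{..<n} \<rightarrow>\<^sub>E ?S. \<Prod>c<n. noisy_cat p N (x c) (x c))"
    by (simp only: sum_flatten[OF grp, where F = "\<lambda>x. \<Prod>c<n. noisy_cat p N (x c) (x c)"])
  also have "\<dots> = (\<Prod>c<n. \<Sum>s\<in>?S. noisy_cat p N s s)"
    using finS by (subst prod_sum_PiE) simp_all
  also have "(\<Sum>s\<in>?S. noisy_cat p N s s) = of_real (\<Sum>s\<in>?S. cat_entry p N s s)"
    unfolding of_real_sum by (intro sum.cong refl noisy_cat_entry) (drule PiE_mem; simp)+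
  also have "(\<Sum>s\<in>?S. cat_entry p N s s) = 1"
  proof -
    have G: "(\<Sum>x\<in>?S. \<Prod>q<N. noise p s t (x q) (x q)) = (noise p s t 0 0 + noise p s t 1 1) ^ N" for s t
    proof -
      have "(\<Sum>x\<in>?S. \<Prod>q<N. noise p s t (x q) (x q)) = (\<Prod>q<N. \<Sum>b\<in>{0, 1}. noise p s t b b)"
        by (subst prod_sum_PiE) simp_all
      then show ?thesis by simp
    qed
    have "(\<Sum>s\<in>?S. cat_entry p N s s) =
        (\<Sum>s\<in>{0, 1}. \<Sum>t\<in>{0, 1}. \<Sum>x\<in>?S. \<Prod>q<N. noise p s t (x q) (x q)) / 2"
      unfolding cat_entry_def by (simp add: sum.distrib flip: sum_divide_distrib)
    \<comment> \<open>For \<open>s \<noteq> t\<close> the diagonal sum is \<open>0 ^ N\<close>,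
      which vanishes because \<open>N\<close> is positive; each of the two terms with
      \<open>s = t\<close> gives one half.\<close>
    also have "\<dots> = 1"
      unfolding G using pauli_probsD(5)[OF p] N by (simp add: noise_def add.commute)
    finally show ?thesis .
  qed
  finally show ?thesis by simp
qed

text \<open>This identifies the two numbers that govern a trial with the parity sums of the kernel.
  The factor \<open>1 / 2\<close> stems from the two normalisations \<open>1 / sqrt 2\<close> of the
  cat vector.\<close>

lemma (in blocks) trial_noisy_cat:
  fixes p :: "nat \<Rightarrow> real"
  defines "f \<equiv> \<lambda>s s'. cat_entry p N (\<lambda>q. s (grp q)) (\<lambda>q. s' (grp q)) ^ n\<^sub>1"
  assumes p: "pauli_probs p"
    and T: "0 < (\<Sum>w\<in>W. \<Sum>w'\<in>W. of_bool (\<forall>g<M. parity n\<^sub>2 w g = parity n\<^sub>2 w' g) * (\<Prod>i<n\<^sub>2. f (w i) (w' i)))"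
  shows "trial N M (n\<^sub>2 * n\<^sub>1) grp (noisy_cat p N) D h canon
    ((\<Sum>w\<in>W. \<Sum>w'\<in>W. parity_weight M n\<^sub>2 w * parity_weight M n\<^sub>2 w' * (\<Prod>i<n\<^sub>2. f (w i) (w' i))) / 2)
    (\<Sum>w\<in>W. \<Sum>w'\<in>W. of_bool (\<forall>g<M. parity n\<^sub>2 w g = parity n\<^sub>2 w' g) * (\<Prod>i<n\<^sub>2. f (w i) (w' i)))"
proof
  let ?rho = "distribute grp (tensor_power (n\<^sub>2 * n\<^sub>1) (noisy_cat p N))"
  have N: "0 < N" using M grp by (cases N) auto
  have rho: "?rho (spread w) (spread w') = of_real (\<Prod>i<n\<^sub>2. f (w i) (w' i))"
    if "w \<in> W" "w' \<in> W" for w w'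
  proof -
    have "noisy_cat p N (\<lambda>q. w i (grp q)) (\<lambda>q. w' i (grp q)) =
        of_real (cat_entry p N (\<lambda>q. w i (grp q)) (\<lambda>q. w' i (grp q)))" if "i < n\<^sub>2" for i
    proof (rule noisy_cat_entry)
      fix q assume "q < N"
      then have "grp q < M" using grp by auto
      then show "w i (grp q) \<in> {0, 1}" "w' i (grp q) \<in> {0, 1}"
        using W_bit[OF \<open>w \<in> W\<close> that] W_bit[OF \<open>w' \<in> W\<close> that] by auto
    qed
    then show ?thesis
      unfolding distribute_spread[OF local_oper_noisy_cat] f_def of_real_prod of_real_power
      by (intro prod.cong refl) simp
  qed
  show "0 < M" "grp ` {..<N} = {..<M}" by (fact M grp)+
  show "local_oper N (noisy_cat p N)" by (rule local_oper_noisy_cat)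
  show "D g \<subseteq> party_basis (n\<^sub>2 * n\<^sub>1) N grp g" for g by (rule D_subset)
  show "h g u \<in> party_basis 1 M id g" if "g < M" for g u by (rule h_in[OF that])
  show "canon g (h g u) \<in> party_basis (n\<^sub>2 * n\<^sub>1) N grp g \<and> h g (canon g (h g u)) = h g u"
    if "g < M" for g u by (rule canon_h[OF that])
  show "(\<Sum>u\<in>Pi\<^sub>E {..<M} (party_basis (n\<^sub>2 * n\<^sub>1) N grp). ?rho u u) = 1"
    by (rule trace_noisy_cat[OF grp p N])
  let ?X = "Pi\<^sub>E {..<M} (party_basis (n\<^sub>2 * n\<^sub>1) N grp)"
  show "(\<Sum>u\<in>?X. \<Sum>u'\<in>?X. of_bool (\<forall>g<M. u g \<in> D g \<and> u' g \<in> D g) *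
        cat_effect M (\<lambda>g\<in>{..<M}. h g (u g)) (\<lambda>g\<in>{..<M}. h g (u' g)) * ?rho u u') =
      complex_of_real ((\<Sum>w\<in>W. \<Sum>w'\<in>W.
        parity_weight M n\<^sub>2 w * parity_weight M n\<^sub>2 w' * (\<Prod>i<n\<^sub>2. f (w i) (w' i))) / 2)"
  proof -
    have "(\<Sum>u\<in>?X. \<Sum>u'\<in>?X. of_bool (\<forall>g<M. u g \<in> D g \<and> u' g \<in> D g) *
        cat_effect M (\<lambda>g\<in>{..<M}. h g (u g)) (\<lambda>g\<in>{..<M}. h g (u' g)) * ?rho u u') =
      (\<Sum>u\<in>?X. \<Sum>u'\<in>?X. of_bool (\<forall>g<M. u g \<in> D g) * (of_bool (\<forall>g<M. u' g \<in> D g) *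
        (cat_effect M (\<lambda>g\<in>{..<M}. h g (u g)) (\<lambda>g\<in>{..<M}. h g (u' g)) * ?rho u u')))"
      by (simp only: imp_conjR all_conj_distrib of_bool_conj mult.assoc)
    also have "\<dots> = (\<Sum>w\<in>W. \<Sum>w'\<in>W.
        cat_effect M (\<lambda>g\<in>{..<M}. h g (spread w g)) (\<lambda>g\<in>{..<M}. h g (spread w' g)) *
        ?rho (spread w) (spread w'))"
      by (rule sum_filtered2)
    also have "\<dots> = (\<Sum>w\<in>W. \<Sum>w'\<in>W. complex_of_real
        (parity_weight M n\<^sub>2 w * parity_weight M n\<^sub>2 w' * (\<Prod>i<n\<^sub>2. f (w i) (w' i)) / 2))"
      by (rule sum.cong[OF refl], rule sum.cong[OF refl]) (simp add: cat_effect_spread rho)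
    finally show ?thesis
      by (simp only: of_real_sum sum_divide_distrib)
  qed
  show "(\<Sum>u\<in>?X. \<Sum>u'\<in>?X. of_bool (\<forall>g<M. u g \<in> D g \<and> u' g \<in> D g \<and> h g (u g) = h g (u' g)) * ?rho u u') =
      complex_of_real (\<Sum>w\<in>W. \<Sum>w'\<in>W.
        of_bool (\<forall>g<M. parity n\<^sub>2 w g = parity n\<^sub>2 w' g) * (\<Prod>i<n\<^sub>2. f (w i) (w' i)))"
  proof -
    have "(\<Sum>u\<in>?X. \<Sum>u'\<in>?X. of_bool (\<forall>g<M. u g \<in> D g \<and> u' g \<in> D g \<and> h g (u g) = h g (u' g)) * ?rho u u') =
      (\<Sum>u\<in>?X. \<Sum>u'\<in>?X. of_bool (\<forall>g<M. u g \<in> D g) * (of_bool (\<forall>g<M. u' g \<in> D g) *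
        (of_bool (\<forall>g<M. h g (u g) = h g (u' g)) * ?rho u u')))"
      by (simp only: imp_conjR all_conj_distrib of_bool_conj mult.assoc)
    also have "\<dots> = (\<Sum>w\<in>W. \<Sum>w'\<in>W.
        of_bool (\<forall>g<M. h g (spread w g) = h g (spread w' g)) * ?rho (spread w) (spread w'))"
      by (rule sum_filtered2)
    also have "\<dots> = (\<Sum>w\<in>W. \<Sum>w'\<in>W. complex_of_real
        (of_bool (\<forall>g<M. parity n\<^sub>2 w g = parity n\<^sub>2 w' g) * (\<Prod>i<n\<^sub>2. f (w i) (w' i))))"
      by (rule sum.cong[OF refl], rule sum.cong[OF refl]) (simp add: h_spread_eq_iff rho)
    finally show ?thesis
      by (simp only: of_real_sum)
  qed
  show "0 < (\<Sum>w\<in>W. \<Sum>w'\<in>W.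
        of_bool (\<forall>g<M. parity n\<^sub>2 w g = parity n\<^sub>2 w' g) * (\<Prod>i<n\<^sub>2. f (w i) (w' i)))"
    by (rule T)
qed

section \<open>Distillation for a given grouping\<close>

text \<open>Away from the four pairs of constant patterns, an entry has a non-constant row or column
  pattern. Bounding the entry by \<open>lam\<close> at the number of zeros in that pattern brings it
  under the hypothesis \<open>cut\<close>.\<close>

lemma cat_distillable_of_groups:
  fixes p :: "nat \<Rightarrow> real"
  assumes p: "pauli_probs p" and M: "2 \<le> M" and grp: "grp ` {..<N} = {..<M}"
    and l: "0 \<le> l" "2 * l < Delta p N"
    and cut: "\<And>s g. s \<in> {..<M} \<rightarrow>\<^sub>E {0, 1 :: nat} \<Longrightarrow> s 0 \<noteq> s g \<Longrightarrow> g < M \<Longrightarrow>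
      lam p (card {q. q < N \<and> s (grp q) = 0}) (N - card {q. q < N \<and> s (grp q) = 0}) \<le> l"
  shows "cat_distillable M N (noisy_cat p N)"
  unfolding cat_distillable_def
proof (intro conjI exI[of _ grp] allI impI)
  show "2 \<le> M" "grp ` {..<N} = {..<M}" by fact+
  fix \<epsilon> :: real assume "0 < \<epsilon>"
  \<comment> \<open>Half of \<open>\<epsilon>\<close> is spent on the quality of the filtered state
    and half on stopping after finitely many trials; the cap \<open>1 / 2\<close> keeps
    \<open>\<epsilon>'\<close> below one.\<close>
  define \<epsilon>' where "\<epsilon>' = min (\<epsilon> / 2) (1 / 2)"
  have \<epsilon>': "0 < \<epsilon>'" "\<epsilon>' < 1" "\<epsilon>' \<le> \<epsilon> / 2" using \<open>0 < \<epsilon>\<close> by (auto simp: \<epsilon>'_def)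
  let ?S = "{..<M} \<rightarrow>\<^sub>E {0, 1 :: nat}"
  have "0 \<in> grp ` {..<N}" using M unfolding grp by simp
  then have N: "0 < N" by (cases N) auto
  have grpM: "grp q < M" if "q < N" for q using grp that by auto
  define r where "r s s' = cat_entry p N (\<lambda>q. s (grp q)) (\<lambda>q. s' (grp q))" for s s' :: "nat \<Rightarrow> nat"
  have bits: "s (grp q) \<in> {0, 1}" if "s \<in> ?S" "q < N" for s q
    using PiE_mem[OF that(1), of "grp q"] grpM[OF that(2)] by simp
  have r_const: "r (\<lambda>g\<in>{..<M}. b) (\<lambda>g\<in>{..<M}. b') =
      (if b = b' then lam p N 0 else ((p 0 - p 3) ^ N + (p 1 - p 2) ^ N) / 2)"
    if "b \<in> {0, 1}" "b' \<in> {0, 1}" for b b' :: nat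
    unfolding r_def using that grpM by (intro cat_entry_const N) auto
  \<comment> \<open>The coherence lies in the row of the zero string, so the bound for that row
    compares it with the diagonal entry there.\<close>
  have v_le_u: "Delta p N / 2 \<le> lam p N 0"
  proof -
    have "\<bar>cat_entry p N (\<lambda>_. 0) (\<lambda>_. 1)\<bar> \<le>
        lam p (card {q. q < N \<and> (0::nat) = 0}) (N - card {q. q < N \<and> (0::nat) = 0})"
      by (rule abs_cat_entry_le(1)[OF p N]) auto
    moreover have "cat_entry p N (\<lambda>_. 0) (\<lambda>_. 1) = ((p 0 - p 3) ^ N + (p 1 - p 2) ^ N) / 2"
      using cat_entry_const[OF N, of 0 1 "\<lambda>_. 0" "\<lambda>_. 1" p] by simp
    ultimately show ?thesis by (simp add: Delta_def)
  qed
  have r_le: "\<bar>r s s'\<bar> \<le> l" if s: "s \<in> ?S" "s' \<in> ?S"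
    and "\<not> (\<exists>b\<in>{0, 1}. \<exists>b'\<in>{0, 1}. s = (\<lambda>g\<in>{..<M}. b) \<and> s' = (\<lambda>g\<in>{..<M}. b'))" for s s'
  proof -
    have const: "s = (\<lambda>g\<in>{..<M}. s 0)" if "s \<in> ?S" "\<And>g. g < M \<Longrightarrow> s 0 = s g" for s
      using that(2) PiE_arb[OF that(1)] by (auto simp: fun_eq_iff restrict_def)
    have "s 0 \<in> {0, 1}" "s' 0 \<in> {0, 1}" using s M by (auto dest!: PiE_mem[where x = 0])
    then have "\<not> (s = (\<lambda>g\<in>{..<M}. s 0) \<and> s' = (\<lambda>g\<in>{..<M}. s' 0))"
      using that(3) by blast
    then have "(\<exists>g<M. s 0 \<noteq> s g) \<or> (\<exists>g<M. s' 0 \<noteq> s' g)"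
      using const[OF s(1)] const[OF s(2)] by blast
    then show ?thesis
    proof
      assume "\<exists>g<M. s 0 \<noteq> s g"
      then obtain g where g: "s 0 \<noteq> s g" "g < M" by blast
      have "\<bar>r s s'\<bar> \<le> lam p (card {q. q < N \<and> s (grp q) = 0}) (N - card {q. q < N \<and> s (grp q) = 0})"
        unfolding r_def by (rule abs_cat_entry_le(1)[OF p N]) (erule bits[OF s(1)] bits[OF s(2)])+
      also have "\<dots> \<le> l" by (rule cut[OF s(1) g])
      finally show ?thesis .
    next
      assume "\<exists>g<M. s' 0 \<noteq> s' g"
      then obtain g where g: "s' 0 \<noteq> s' g" "g < M" by blast
      have "\<bar>r s s'\<bar> \<le> lam p (card {q. q < N \<and> s' (grp q) = 0}) (N - card {q. q < N \<and> s' (grp q) = 0})"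
        unfolding r_def by (rule abs_cat_entry_le(2)[OF p N]) (erule bits[OF s(1)] bits[OF s(2)])+
      also have "\<dots> \<le> l" by (rule cut[OF s(2) g])
      finally show ?thesis .
    qed
  qed
  have "0 \<le> real (card ?S ^ 2)" "l < Delta p N / 2" using l by auto
  from block_sizes_exist[OF l(1) this(2) v_le_u this(1) \<epsilon>'(1,2)]
  obtain n\<^sub>1 n\<^sub>2 where n: "even n\<^sub>1" "0 < n\<^sub>1" "0 < n\<^sub>2"
    and sizes: "\<And>w. 0 \<le> w \<Longrightarrow> w \<le> real (card ?S ^ 2) * l ^ n\<^sub>1 \<Longrightarrow>
      (1 - \<epsilon>') * ((2 * (lam p N 0 ^ n\<^sub>1 + (Delta p N / 2) ^ n\<^sub>1) + w) ^ n\<^sub>2 +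
        (2 * (lam p N 0 ^ n\<^sub>1 - (Delta p N / 2) ^ n\<^sub>1) + w) ^ n\<^sub>2)
      \<le> (2 * (lam p N 0 ^ n\<^sub>1 + (Delta p N / 2) ^ n\<^sub>1)) ^ n\<^sub>2" by blast
  define f where "f = (\<lambda>s s'. cat_entry p N (\<lambda>q. s (grp q)) (\<lambda>q. s' (grp q)) ^ n\<^sub>1)"
  have f: "f s s' = \<bar>r s s'\<bar> ^ n\<^sub>1" for s s' using n(1) by (simp add: f_def r_def power_even_abs)
  interpret blocks N M n\<^sub>1 n\<^sub>2 grp
    by unfold_locales (use M grp n in auto)
  interpret K: nonneg_kernel M n\<^sub>2 f "lam p N 0 ^ n\<^sub>1" "(Delta p N / 2) ^ n\<^sub>1" "l ^ n\<^sub>1"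
  proof
    show "0 < M" using M by simp
    show "0 \<le> f s s'" for s s' by (simp add: f)
    show "f s s' \<le> l ^ n\<^sub>1" if "s \<in> ?S" "s' \<in> ?S"
      "\<not> (\<exists>b\<in>{0, 1}. \<exists>b'\<in>{0, 1}. s = (\<lambda>g\<in>{..<M}. b) \<and> s' = (\<lambda>g\<in>{..<M}. b'))" for s s'
      unfolding f using r_le[OF that] by (intro power_mono) auto
    show "(Delta p N / 2) ^ n\<^sub>1 \<le> lam p N 0 ^ n\<^sub>1"
      by (rule power_mono[OF v_le_u]) (simp add: Delta_def)
    show "0 \<le> l ^ n\<^sub>1" using l by simp
    show "f (\<lambda>g\<in>{..<M}. b) (\<lambda>g\<in>{..<M}. b') = (if b = b' then lam p N 0 ^ n\<^sub>1 else (Delta p N / 2) ^ n\<^sub>1)"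
      if "b \<in> {0, 1}" "b' \<in> {0, 1}" for b b'
      unfolding f r_const[OF that] using n(1) by (simp add: Delta_def power_even_abs power_divide)
  qed
  define F where "F = (\<Sum>w\<in>W. \<Sum>w'\<in>W. parity_weight M n\<^sub>2 w * parity_weight M n\<^sub>2 w' * (\<Prod>i<n\<^sub>2. f (w i) (w' i))) / 2"
  define T where "T = (\<Sum>w\<in>W. \<Sum>w'\<in>W. of_bool (\<forall>g<M. parity n\<^sub>2 w g = parity n\<^sub>2 w' g) * (\<Prod>i<n\<^sub>2. f (w i) (w' i)))"
  have "0 < lam p N 0" using l v_le_u by linarith
  then have T: "0 < T" unfolding T_def by (intro K.trace_pos) simp
  interpret trial N M "n\<^sub>2 * n\<^sub>1" grp "noisy_cat p N" D h canon F T
    unfolding F_def T_def f_def by (rule trial_noisy_cat[OF p]) (fact T[unfolded T_def f_def])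
  from K.trace_le[folded T_def] obtain w where w: "0 \<le> w" "w \<le> real (card ?S ^ 2) * l ^ n\<^sub>1"
    and T_le: "2 * T \<le> (2 * (lam p N 0 ^ n\<^sub>1 + (Delta p N / 2) ^ n\<^sub>1) + w) ^ n\<^sub>2 +
        (2 * (lam p N 0 ^ n\<^sub>1 - (Delta p N / 2) ^ n\<^sub>1) + w) ^ n\<^sub>2"
    by (elim exE conjE)
  have "(1 - \<epsilon>') * (2 * T) \<le> (1 - \<epsilon>') * ((2 * (lam p N 0 ^ n\<^sub>1 + (Delta p N / 2) ^ n\<^sub>1) + w) ^ n\<^sub>2 +
        (2 * (lam p N 0 ^ n\<^sub>1 - (Delta p N / 2) ^ n\<^sub>1) + w) ^ n\<^sub>2)"
    using T_le \<epsilon>' by (intro mult_left_mono) auto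
  also have "\<dots> \<le> (2 * (lam p N 0 ^ n\<^sub>1 + (Delta p N / 2) ^ n\<^sub>1)) ^ n\<^sub>2"
    by (rule sizes[OF w])
  also have "\<dots> \<le> 2 * F"
    using K.fidelity_ge by (simp add: F_def)
  finally have "1 - \<epsilon>' \<le> F / T" using T by (simp add: field_simps)
  have "0 < \<epsilon> / 2" using \<open>0 < \<epsilon>\<close> by simp
  from locc_fidelity[OF this]
  obtain m \<Lambda> where \<Lambda>: "locc {..<M} (party_basis m N grp) (party_basis 1 M id) \<Lambda>"
    and "F / T - \<epsilon> / 2 \<le> cat_fidelity M (\<Lambda> (distribute grp (tensor_power m (noisy_cat p N))))"
    by (elim exE conjE)
  then have "1 - \<epsilon> \<le> cat_fidelity M (\<Lambda> (distribute grp (tensor_power m (noisy_cat p N))))"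
    using \<open>1 - \<epsilon>' \<le> F / T\<close> \<epsilon>'(3) by linarith
  with \<Lambda> show "\<exists>n \<Lambda>. locc {..<M} (party_basis n N grp) (party_basis 1 M id) \<Lambda> \<and>
      1 - \<epsilon> \<le> cat_fidelity M (\<Lambda> (distribute grp (tensor_power n (noisy_cat p N))))"
    by blast
qed

text \<open>When every group has at least \<open>k\<close> qubits, a non-constant pattern puts at
  least \<open>k\<close> qubits on either side, so its number of zeros lies between \<open>k\<close>
  and \<open>N - k\<close>.\<close>

lemma cat_distillable_div:
  assumes k: "1 \<le> k" "k \<le> N div 2" and p: "pauli_probs p" and \<Delta>: "2 * lam p k (N - k) < Delta p N"
  shows "cat_distillable (N div k) N (noisy_cat p N)"
proof -
  define M where "M = N div k"
  \<comment> \<open>The last group absorbs the remainder of \<open>N\<close> modulo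
    \<open>k\<close>.\<close>
  define grp where "grp q = min (q div k) (M - 1)" for q
  have M: "2 \<le> M" unfolding M_def using k by (simp add: less_eq_div_iff_mult_less_eq)
  have Mk: "M * k \<le> N" by (simp add: M_def)
  have block: "grp q = g" if "g < M" "q \<in> {g * k..<g * k + k}" for g q
  proof -
    have "q div k = g" using that(2) by (intro div_nat_eqI) (auto simp: mult.commute)
    then show ?thesis using that(1) by (simp add: grp_def)
  qed
  have block_N: "{g * k..<g * k + k} \<subseteq> {..<N}" if "g < M" for g
  proof -
    have "g * k + k \<le> M * k" using mult_le_mono1[of "Suc g" M k] that by simp
    then show ?thesis using Mk by auto
  qed
  have grp: "grp ` {..<N} = {..<M}"
  proof (intro equalityI subsetI)
    fix g assume "g \<in> grp ` {..<N}"
    then show "g \<in> {..<M}" using M by (auto simp: grp_def)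
  next
    fix g assume "g \<in> {..<M}"
    then have "grp (g * k) = g" "g * k \<in> {..<N}"
      using block[of g "g * k"] subsetD[OF block_N[of g], of "g * k"] k by auto
    then show "g \<in> grp ` {..<N}" by (metis imageI)
  qed
  have big: "k \<le> card {q. q < N \<and> s (grp q) = b}" if "g < M" "b = s g" for s :: "nat \<Rightarrow> nat" and g b
  proof -
    have "{g * k..<g * k + k} \<subseteq> {q. q < N \<and> s (grp q) = b}"
      using block[OF that(1)] block_N[OF that(1)] that(2) by auto
    from card_mono[OF _ this] show ?thesis by simp
  qed
  have "cat_distillable M N (noisy_cat p N)"
  proof (rule cat_distillable_of_groups[OF p M grp _ \<Delta>])
    show "0 \<le> lam p k (N - k)" using pauli_probsD[OF p] by (auto simp: lam_def)
    fix s g assume s: "s \<in> {..<M} \<rightarrow>\<^sub>E {0, 1 :: nat}" and g: "s 0 \<noteq> s g" "g < M"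
    let ?w = "card {q. q < N \<and> s (grp q) = 0}"
    have "s 0 \<in> {0, 1}" "s g \<in> {0, 1}" using PiE_mem[OF s, of 0] PiE_mem[OF s, of g] g M by auto
    then obtain g\<^sub>0 g\<^sub>1 where g01: "g\<^sub>0 < M" "s g\<^sub>0 = 0" "g\<^sub>1 < M" "s g\<^sub>1 = 1"
      using g M that by (cases "s 0 = 0") (metis One_nat_def insertE less_le_trans pos2 singletonD)+
    have "?w + card {q. q < N \<and> s (grp q) = 1} \<le> N"
    proof -
      have "?w + card {q. q < N \<and> s (grp q) = 1} =
          card ({q. q < N \<and> s (grp q) = 0} \<union> {q. q < N \<and> s (grp q) = 1})"
        by (rule card_Un_disjoint[symmetric]) auto
      also have "\<dots> \<le> card {..<N}" by (rule card_mono) auto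
      finally show ?thesis by simp
    qed
    then have "?w \<le> N - k" using big[where s = s, OF g01(3) g01(4)[symmetric]] by linarith
    then show "lam p ?w (N - ?w) \<le> lam p k (N - k)"
      using big[where s = s, OF g01(1) g01(2)[symmetric]] k by (intro lam_mono p) auto
  qed
  then show ?thesis by (simp add: M_def)
qed

subsection \<open>States with positive partial transpose are not distillable\<close>

definition gram :: "('x \<Rightarrow> complex) list \<Rightarrow> 'x \<Rightarrow> 'x \<Rightarrow> complex" where
  "gram vs x y = (\<Sum>v\<leftarrow>vs. v x * cnj (v y))"

text \<open>Positivity of the transpose in the label of party \<open>g\<close> is witnessed by a Gram decomposition,
  which is what tensor powers and Kraus operators preserve most directly.\<close>

definition ppt :: "'s set \<Rightarrow> ('s \<Rightarrow> 'b set) \<Rightarrow> 's \<Rightarrow> ('s, 'b) oper \<Rightarrow> bool" where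
  "ppt P B g \<rho> \<longleftrightarrow> (\<exists>vs. \<forall>x\<in>Pi\<^sub>E P B. \<forall>y\<in>Pi\<^sub>E P B. \<rho> (x(g := y g)) (y(g := x g)) = gram vs x y)"

lemma gram_simps [simp]:
  "gram [] x y = 0" "gram (v # vs) x y = v x * cnj (v y) + gram vs x y"
  "gram (vs @ ws) x y = gram vs x y + gram ws x y"
  by (simp_all add: gram_def)

text \<open>The products of the vectors of both families decompose the product kernel; in its
  application \<open>f\<close> extracts the bits of the next copy.\<close>

lemma gram_tensor:
  "gram (concat (map (\<lambda>v. map (\<lambda>w x. v x * w (f x)) ws) vs)) x y = gram vs x y * gram ws (f x) (f y)"
proof (induction vs)
  case (Cons v vs)
  have "gram (map (\<lambda>w x. v x * w (f x)) ws) x y = v x * cnj (v y) * gram ws (f x) (f y)"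
    by (induction ws) (simp_all add: algebra_simps)
  with Cons show ?case by (simp add: algebra_simps)
qed simp

lemma gram_kraus:
  "gram (map (\<lambda>v x. \<Sum>i\<in>B. K x i * v (f x i)) vs) x y =
    (\<Sum>i\<in>B. \<Sum>j\<in>B. K x i * gram vs (f x i) (f y j) * cnj (K y j))"
  by (induction vs)
    (simp_all add: distrib_left distrib_right sum.distrib sum_product mult_ac)

lemma PiE_upd: "p \<in> P \<Longrightarrow> x \<in> Pi\<^sub>E P (B(p := C)) \<Longrightarrow> i \<in> B p \<Longrightarrow> x(p := i) \<in> Pi\<^sub>E P B"
  by (auto simp: PiE_iff extensional_def split: if_splits)

text \<open>Under transposition at \<open>g\<close>, a Kraus operator of \<open>g\<close> turns into
  its complex conjugate, and those of other parties are unchanged. The operator \<open>K'\<close>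
  obtained in this way acts on the Gram vectors.\<close>

lemma ppt_local_kraus:
  assumes "p \<in> P" and "ppt P B g \<rho>"
  shows "ppt P (B(p := C)) g (local_kraus p (B p) K \<rho>)"
proof -
  obtain vs where vs: "\<And>x y. x \<in> Pi\<^sub>E P B \<Longrightarrow> y \<in> Pi\<^sub>E P B \<Longrightarrow>
      \<rho> (x(g := y g)) (y(g := x g)) = gram vs x y"
    using assms(2) unfolding ppt_def by blast
  define K' where "K' x i = (if p = g then cnj (K (x p) i) else K (x p) i)" for x :: "'a \<Rightarrow> 'b" and i
  define ws where "ws = map (\<lambda>v x. \<Sum>i\<in>B p. K' x i * v (x(p := i))) vs"
  have "local_kraus p (B p) K \<rho> (x(g := y g)) (y(g := x g)) = gram ws x y"
    if x: "x \<in> Pi\<^sub>E P (B(p := C))" and y: "y \<in> Pi\<^sub>E P (B(p := C))" for x y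
  proof -
    have "gram ws x y = (\<Sum>i\<in>B p. \<Sum>j\<in>B p. K' x i *
        \<rho> ((x(p := i))(g := (y(p := j)) g)) ((y(p := j))(g := (x(p := i)) g)) * cnj (K' y j))"
      unfolding ws_def gram_kraus
      by (rule sum.cong[OF refl], rule sum.cong[OF refl])
        (simp only: vs[OF PiE_upd[OF assms(1) x] PiE_upd[OF assms(1) y]])
    also have "\<dots> = local_kraus p (B p) K \<rho> (x(g := y g)) (y(g := x g))"
    proof (cases "p = g")
      case True
      have "(\<Sum>i\<in>B p. \<Sum>j\<in>B p. K' x i *
        \<rho> ((x(p := i))(g := (y(p := j)) g)) ((y(p := j))(g := (x(p := i)) g)) * cnj (K' y j)) =
        (\<Sum>i\<in>B p. \<Sum>j\<in>B p. cnj (K (x p) i) * \<rho> (x(g := j)) (y(g := i)) * K (y p) j)"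
        using True by (simp add: K'_def)
      \<comment> \<open>The transposition at \<open>g\<close> interchanges the roles of the two
        summation indices.\<close>
      also have "\<dots> = (\<Sum>j\<in>B p. \<Sum>i\<in>B p. cnj (K (x p) i) * \<rho> (x(g := j)) (y(g := i)) * K (y p) j)"
        by (rule sum.swap)
      finally show ?thesis
        using True by (simp add: local_kraus_def mult_ac)
    next
      case False
      then show ?thesis
        by (simp add: local_kraus_def K'_def fun_upd_twist)
    qed
    finally show ?thesis ..
  qed
  then show ?thesis unfolding ppt_def by blast
qed

lemma ppt_sum:
  fixes \<rho> :: "nat \<Rightarrow> ('s, 'b) oper"
  assumes "\<And>m. m < r \<Longrightarrow> ppt P B g (\<rho> m)"
  shows "ppt P B g (\<lambda>x y. \<Sum>m<r. \<rho> m x y)"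
  using assms
proof (induction r)
  case 0
  show ?case unfolding ppt_def by (intro exI[of _ "[]"]) simp
next
  case (Suc r)
  obtain vs where vs: "\<forall>x\<in>Pi\<^sub>E P B. \<forall>y\<in>Pi\<^sub>E P B. (\<Sum>m<r. \<rho> m (x(g := y g)) (y(g := x g))) = gram vs x y"
    using Suc unfolding ppt_def by fastforce
  obtain ws where ws: "\<forall>x\<in>Pi\<^sub>E P B. \<forall>y\<in>Pi\<^sub>E P B. \<rho> r (x(g := y g)) (y(g := x g)) = gram ws x y"
    using Suc.prems[of r] unfolding ppt_def by auto
  show ?case
    unfolding ppt_def by (intro exI[of _ "vs @ ws"] ballI) (simp add: vs ws)
qed

lemma ppt_locc:
  assumes "locc P B B' \<Lambda>" and "ppt P B g \<rho>"
  shows "ppt P B' g (\<Lambda> \<rho>)"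
  using assms
proof (induction arbitrary: \<rho> rule: locc.induct)
  case (step p r C B K B' \<Lambda>)
  show ?case
    by (rule ppt_sum, rule step.IH, assumption, rule ppt_local_kraus[OF step.hyps(1) step.prems])
qed

text \<open>Completeness of the Kraus operators collapses the sum over outcomes and new labels to a
  Kronecker delta between the old labels of the acting party.\<close>

lemma trace_locc:
  assumes "locc P B B' \<Lambda>" and "\<And>p. p \<in> P \<Longrightarrow> finite (B p)"
  shows "(\<Sum>x\<in>Pi\<^sub>E P B'. \<Lambda> \<rho> x x) = (\<Sum>x\<in>Pi\<^sub>E P B. \<rho> x x)"
  using assms
proof (induction arbitrary: \<rho> rule: locc.induct)
  case (step p r C B K B' \<Lambda>)
  have "(\<Sum>x\<in>Pi\<^sub>E P B'. \<Sum>m<r. \<Lambda> m (local_kraus p (B p) (K m) \<rho>) x x) =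
      (\<Sum>m<r. \<Sum>x\<in>Pi\<^sub>E P B'. \<Lambda> m (local_kraus p (B p) (K m) \<rho>) x x)"
    by (rule sum.swap)
  also have "\<dots> = (\<Sum>m<r. \<Sum>x\<in>Pi\<^sub>E P (B(p := C m)). local_kraus p (B p) (K m) \<rho> x x)"
  proof (rule sum.cong[OF refl])
    fix m assume "m \<in> {..<r}"
    then have m: "m < r" by simp
    show "(\<Sum>x\<in>Pi\<^sub>E P B'. \<Lambda> m (local_kraus p (B p) (K m) \<rho>) x x) =
        (\<Sum>x\<in>Pi\<^sub>E P (B(p := C m)). local_kraus p (B p) (K m) \<rho> x x)"
      by (rule step.IH[OF m]) (use step.prems step.hyps(2)[OF m] in auto)
  qed
  also have "\<dots> = (\<Sum>m<r. \<Sum>x\<in>Pi\<^sub>E P B. \<Sum>l\<in>C m. \<Sum>j\<in>B p.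
      K m l (x p) * \<rho> x (x(p := j)) * cnj (K m l j))"
  proof (rule sum.cong[OF refl])
    fix m
    define F where "F x x' = (\<Sum>j\<in>B p. K m (x p) (x' p) * \<rho> x' (x'(p := j)) * cnj (K m (x p) j))" for x x'
    have "(\<Sum>x\<in>Pi\<^sub>E P (B(p := C m)). local_kraus p (B p) (K m) \<rho> x x) =
        (\<Sum>x\<in>Pi\<^sub>E P (B(p := C m)). \<Sum>i\<in>B p. F x (x(p := i)))"
      by (simp add: local_kraus_def F_def)
    also have "\<dots> = (\<Sum>x\<in>Pi\<^sub>E P B. \<Sum>l\<in>C m. F (x(p := l)) x)"
      by (rule sum_PiE_upd[OF step.hyps(1)])
    finally show "(\<Sum>x\<in>Pi\<^sub>E P (B(p := C m)). local_kraus p (B p) (K m) \<rho> x x) =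
        (\<Sum>x\<in>Pi\<^sub>E P B. \<Sum>l\<in>C m. \<Sum>j\<in>B p. K m l (x p) * \<rho> x (x(p := j)) * cnj (K m l j))"
      by (simp add: F_def)
  qed
  also have "\<dots> = (\<Sum>x\<in>Pi\<^sub>E P B. \<Sum>m<r. \<Sum>l\<in>C m. \<Sum>j\<in>B p.
      K m l (x p) * \<rho> x (x(p := j)) * cnj (K m l j))"
    by (rule sum.swap)
  also have "\<dots> = (\<Sum>x\<in>Pi\<^sub>E P B. \<rho> x x)"
  proof (rule sum.cong[OF refl])
    fix x assume "x \<in> Pi\<^sub>E P B"
    then have xp: "x p \<in> B p" using step.hyps(1) by auto
    have fin: "finite (B p)" using step.prems step.hyps(1) by simp
    have "(\<Sum>m<r. \<Sum>l\<in>C m. \<Sum>j\<in>B p. K m l (x p) * \<rho> x (x(p := j)) * cnj (K m l j)) =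
        (\<Sum>m<r. \<Sum>j\<in>B p. \<Sum>l\<in>C m. K m l (x p) * \<rho> x (x(p := j)) * cnj (K m l j))"
      by (rule sum.cong[OF refl sum.swap])
    also have "\<dots> = (\<Sum>j\<in>B p. \<Sum>m<r. \<Sum>l\<in>C m. K m l (x p) * \<rho> x (x(p := j)) * cnj (K m l j))"
      by (rule sum.swap)
    also have "\<dots> = (\<Sum>j\<in>B p. \<rho> x (x(p := j)) * (\<Sum>m<r. \<Sum>l\<in>C m. cnj (K m l j) * K m l (x p)))"
      by (simp add: sum_distrib_left mult_ac)
    also have "\<dots> = (\<Sum>j\<in>B p. if j = x p then \<rho> x (x(p := j)) else 0)"
      by (rule sum.cong[OF refl]) (simp add: step.hyps(3) xp)
    also have "\<dots> = \<rho> x x" using fin xp by simp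
    finally show "(\<Sum>m<r. \<Sum>l\<in>C m. \<Sum>j\<in>B p. K m l (x p) * \<rho> x (x(p := j)) * cnj (K m l j)) = \<rho> x x" .
  qed
  finally show ?case .
qed simp

lemma gram_diag: "gram vs x x = of_real (\<Sum>v\<leftarrow>vs. (cmod (v x))\<^sup>2)"
  by (induction vs) (simp_all add: complex_norm_square[symmetric])

lemma gram_cross: "2 * Re (gram vs x y) \<le> Re (gram vs x x) + Re (gram vs y y)"
proof (induction vs)
  case (Cons v vs)
  have "0 \<le> Re ((v x - v y) * cnj (v x - v y))"
    by (simp only: complex_norm_square[symmetric] Re_complex_of_real) simp
  then have "2 * Re (v x * cnj (v y)) \<le> Re (v x * cnj (v x)) + Re (v y * cnj (v y))"
    by (simp add: algebra_simps)
  with Cons show ?case by simp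
qed simp

lemma gram_cnj: "gram vs y x = cnj (gram vs x y)"
  by (induction vs) (simp_all add: mult.commute)

section \<open>Fidelity under positive partial transpose\<close>

text \<open>Partial transposition carries the coherence between the constant labels
  \<open>e 0\<close> and \<open>e 1\<close> to the pair \<open>f 0\<close>, \<open>f 1\<close>, in
  which the bit of \<open>g\<close> is flipped. There positivity bounds it by diagonal entries.
  Together with those at \<open>e 0\<close> and \<open>e 1\<close> these are four distinct diagonal
  entries, whose sum is at most the trace.\<close>

lemma cat_fidelity_le_half:
  assumes M: "2 \<le> M" and g: "g < M" and ppt: "ppt {..<M} (party_basis 1 M id) g \<sigma>"
    and tr: "(\<Sum>x\<in>Pi\<^sub>E {..<M} (party_basis 1 M id). \<sigma> x x) = 1"
  shows "cat_fidelity M \<sigma> \<le> 1 / 2"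
proof -
  let ?X = "Pi\<^sub>E {..<M} (party_basis 1 M id)"
  have finX: "finite ?X" by (rule finite_PiE) simp_all
  define e where "e b = (\<lambda>g\<in>{..<M}. \<lambda>i\<in>{(0::nat, g)}. b)" for b :: nat
  have basis: "party_basis 1 M id g = {(0, g)} \<rightarrow>\<^sub>E {0, 1}" if "g < M" for g
  proof -
    have "{..<1::nat} \<times> {q. q < M \<and> id q = g} = {(0, g)}" using that by auto
    then show ?thesis by (simp only: party_basis_def)
  qed
  have eX: "e b \<in> ?X" if "b \<in> {0, 1}" for b
    unfolding e_def restrict_PiE_iff
    by (intro ballI) (simp only: basis lessThan_iff restrict_PiE_iff that ball_simps)
  have e_eq: "x = e b" if "x \<in> ?X" "\<forall>g<M. x g (0, g) = b" for x b
  proof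
    fix g
    show "x g = e b g"
    proof (cases "g < M")
      case True
      then have "x g \<in> {(0, g)} \<rightarrow>\<^sub>E {0, 1}" using PiE_mem[OF that(1), of g] basis by simp
      then show ?thesis
        using True that(2) PiE_arb[of "x g" "{(0, g)}"] by (auto simp: e_def fun_eq_iff)
    next
      case False
      then show ?thesis using PiE_arb[OF that(1), of g] by (simp add: e_def)
    qed
  qed
  have e01: "e 0 \<noteq> e 1"
    using M by (auto simp: e_def fun_eq_iff restrict_def intro!: exI[of _ 0])
  have vec: "cat_vec M (\<lambda>g. x g (0, g)) = of_real (1 / sqrt 2) * of_bool (x \<in> {e 0, e 1})" if "x \<in> ?X" for x
  proof -
    have "(\<Prod>g<M. of_bool (x g (0, g) = b) :: complex) = of_bool (x = e b)" for b
    proof (cases "x = e b")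
      case True
      then show ?thesis by (simp add: e_def)
    next
      case False
      then have "\<exists>g<M. x g (0, g) \<noteq> b" using e_eq[OF that] by blast
      then show ?thesis using False by (auto intro!: prod_zero)
    qed
    then show ?thesis using e01 by (auto simp: cat_vec_def)
  qed
  let ?E = "{e 0, e 1}"
  have EX: "?E \<subseteq> ?X" using eX by simp
  have delta: "(\<Sum>x\<in>?X. of_bool (x \<in> ?E) * F x) = F (e 0) + F (e 1)" for F :: "_ \<Rightarrow> complex"
  proof -
    have "(\<Sum>x\<in>?X. of_bool (x \<in> ?E) * F x) = sum F (?X \<inter> {x. x \<in> ?E})"
      by (rule sum_of_bool_mult_eq[OF finX])
    also have "?X \<inter> {x. x \<in> ?E} = ?E" using EX by blast
    finally show ?thesis by (rule trans) (use e01 in simp)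
  qed
  have effect: "cat_effect M x y = of_bool (x \<in> ?E) * (of_bool (y \<in> ?E) * (1 / 2))"
    if "x \<in> ?X" "y \<in> ?X" for x y
  proof -
    have half: "complex_of_real (1 / sqrt 2) * complex_of_real (1 / sqrt 2) = 1 / 2"
      unfolding of_real_mult[symmetric] by simp
    have "cat_effect M x y = (complex_of_real (1 / sqrt 2) * complex_of_real (1 / sqrt 2)) *
        (of_bool (x \<in> ?E) * of_bool (y \<in> ?E))"
      unfolding cat_effect_def vec[OF that(1)] vec[OF that(2)] by (simp add: of_bool_def)
    then show ?thesis unfolding half by (simp only: mult_ac)
  qed
  have "(\<Sum>x\<in>?X. \<Sum>y\<in>?X. cat_effect M x y * \<sigma> x y) =
      (\<Sum>x\<in>?X. of_bool (x \<in> ?E) * (\<Sum>y\<in>?X. of_bool (y \<in> ?E) * (\<sigma> x y / 2)))"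
    unfolding sum_distrib_left
    by (rule sum.cong[OF refl], rule sum.cong[OF refl]) (simp add: effect)
  then have F: "cat_fidelity M \<sigma> =
      Re (\<sigma> (e 0) (e 0) + \<sigma> (e 0) (e 1) + \<sigma> (e 1) (e 0) + \<sigma> (e 1) (e 1)) / 2"
    unfolding cat_fidelity_effect by (simp only: delta) (simp add: add_divide_distrib)
  obtain vs where vs: "\<And>x y. x \<in> ?X \<Longrightarrow> y \<in> ?X \<Longrightarrow> \<sigma> (x(g := y g)) (y(g := x g)) = gram vs x y"
    using ppt unfolding ppt_def by blast
  define f where "f b = (e b)(g := e (1 - b) g)" for b
  have fX: "f b \<in> ?X" if "b \<in> {0, 1}" for b
  proof -
    have "1 - b \<in> {0, 1}" using that by auto
    from PiE_mem[OF eX[OF this], of g] have "e (1 - b) g \<in> party_basis 1 M id g"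
      using g by (simp del: One_nat_def)
    then show ?thesis
      unfolding f_def using PiE_fun_upd[OF _ eX[OF that], of "e (1 - b) g" g] g by (simp add: insert_absorb)
  qed
  have ff: "(f 0)(g := f 1 g) = e 0" "(f 1)(g := f 0 g) = e 1"
    by (simp_all add: f_def)
  have cross: "\<sigma> (e 0) (e 1) = gram vs (f 0) (f 1)" "\<sigma> (e 1) (e 0) = gram vs (f 1) (f 0)"
    using vs[OF fX[of 0] fX[of 1]] vs[OF fX[of 1] fX[of 0]] unfolding ff by simp_all
  have diag: "\<sigma> x x = gram vs x x" if "x \<in> ?X" for x
    using vs[OF that that] by simp
  have nonneg: "0 \<le> Re (\<sigma> x x)" if "x \<in> ?X" for x
    unfolding diag[OF that] gram_diag by (auto intro!: sum_list_nonneg)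
  have "Re (\<sigma> (e 0) (e 1) + \<sigma> (e 1) (e 0)) = 2 * Re (gram vs (f 0) (f 1))"
    unfolding cross gram_cnj[of vs "f 1"] by simp
  also have "\<dots> \<le> Re (\<sigma> (f 0) (f 0)) + Re (\<sigma> (f 1) (f 1))"
    using gram_cross[of vs "f 0" "f 1"] diag[OF fX] by simp
  finally have "2 * cat_fidelity M \<sigma> \<le>
      Re (\<sigma> (e 0) (e 0)) + Re (\<sigma> (e 1) (e 1)) + Re (\<sigma> (f 0) (f 0)) + Re (\<sigma> (f 1) (f 1))"
    unfolding F by simp
  also have "\<dots> = (\<Sum>x\<in>{e 0, e 1, f 0, f 1}. Re (\<sigma> x x))"
  proof -
    \<comment> \<open>A second party tells flipped labels from constant ones; with a single party
      \<open>f 0\<close> would coincide with \<open>e 1\<close>.\<close>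
    obtain g' where g': "g' < M" "g' \<noteq> g"
      using M by (cases "g = 0") (auto intro: that[of 0] that[of 1])
    have vals: "e b g (0, g) = b" "e b g' (0, g') = b" "f b g (0, g) = 1 - b" "f b g' (0, g') = b" for b
      using g g' by (simp_all add: e_def f_def)
    have ne: "x \<noteq> y" if "x g (0, g) \<noteq> y g (0, g) \<or> x g' (0, g') \<noteq> y g' (0, g')"
      for x y :: "nat \<Rightarrow> nat \<times> nat \<Rightarrow> nat" using that by auto
    have "e 0 \<noteq> f 0" "e 0 \<noteq> f 1" "e 1 \<noteq> f 0" "e 1 \<noteq> f 1" "f 0 \<noteq> f 1"
      by (rule ne, simp add: vals)+
    with e01 show ?thesis by (simp add: add.assoc)
  qed
  also have "\<dots> \<le> (\<Sum>x\<in>?X. Re (\<sigma> x x))"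
    by (rule sum_mono2[OF finX]) (use eX fX nonneg in auto)
  also have "\<dots> = Re (\<Sum>x\<in>?X. \<sigma> x x)" by simp
  also have "\<dots> = 1" unfolding tr by simp
  finally show ?thesis by simp
qed

lemma not_distillable_of_ppt:
  assumes M: "2 \<le> M" and g: "g < M" and grp: "grp ` {..<N} = {..<M}" and p: "pauli_probs p" and N: "0 < N"
    and ppt: "\<And>n. ppt {..<M} (party_basis n N grp) g (distribute grp (tensor_power n (noisy_cat p N)))"
    and locc: "locc {..<M} (party_basis n N grp) (party_basis 1 M id) \<Lambda>"
  shows "cat_fidelity M (\<Lambda> (distribute grp (tensor_power n (noisy_cat p N)))) \<le> 1 / 2"
proof (rule cat_fidelity_le_half[OF M g ppt_locc[OF locc ppt]])
  show "(\<Sum>x\<in>Pi\<^sub>E {..<M} (party_basis 1 M id). \<Lambda> (distribute grp (tensor_power n (noisy_cat p N))) x x) = 1"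
    by (simp only: trace_locc[OF locc finite_party_basis] trace_noisy_cat[OF grp p N])
qed

text \<open>Partial transposition acts copy by copy, so a decomposition for one copy multiplies up.
  The induction is over the first \<open>m\<close> of \<open>n\<close> copies, with the labels of
  all \<open>n\<close> kept fixed.\<close>

lemma ppt_tensor_power:
  assumes grp: "grp ` {..<N} = {..<M}"
    and single: "\<And>a b. (\<And>q. q < N \<Longrightarrow> a q \<in> {0, 1}) \<Longrightarrow> (\<And>q. q < N \<Longrightarrow> b q \<in> {0, 1}) \<Longrightarrow>
      \<rho> (\<lambda>q. if grp q = g then b q else a q) (\<lambda>q. if grp q = g then a q else b q) = gram ws a b"
  shows "ppt {..<M} (party_basis n N grp) g (distribute grp (tensor_power n \<rho>))"
proof -
  let ?a = "\<lambda>(x :: nat \<Rightarrow> nat \<times> nat \<Rightarrow> nat) c q. x (grp q) (c, q)"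
  have "\<exists>vs. \<forall>x\<in>Pi\<^sub>E {..<M} (party_basis n N grp). \<forall>y\<in>Pi\<^sub>E {..<M} (party_basis n N grp).
      (\<Prod>c<m. \<rho> (?a (x(g := y g)) c) (?a (y(g := x g)) c)) = gram vs x y" if "m \<le> n" for m
    using that
  proof (induction m)
    case 0
    show ?case by (rule exI[of _ "[\<lambda>_. 1]"]) simp
  next
    case (Suc m)
    then obtain vs where vs: "\<And>x y. x \<in> Pi\<^sub>E {..<M} (party_basis n N grp) \<Longrightarrow>
        y \<in> Pi\<^sub>E {..<M} (party_basis n N grp) \<Longrightarrow>
        (\<Prod>c<m. \<rho> (?a (x(g := y g)) c) (?a (y(g := x g)) c)) = gram vs x y" by auto
    have bit: "x (grp q) (m, q) \<in> {0, 1}" if x: "x \<in> Pi\<^sub>E {..<M} (party_basis n N grp)" and "q < N" for x q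
    proof -
      have "x (grp q) \<in> party_basis n N grp (grp q)"
        using PiE_mem[OF x, of "grp q"] grp \<open>q < N\<close> by auto
      then show ?thesis
        using PiE_mem[of "x (grp q)" "{..<n} \<times> {q'. q' < N \<and> grp q' = grp q}" "\<lambda>_. {0, 1}" "(m, q)"]
          Suc.prems \<open>q < N\<close> unfolding party_basis_def by simp
    qed
    have upd: "?a (x(g := y g)) m = (\<lambda>q. if grp q = g then y (grp q) (m, q) else x (grp q) (m, q))" for x y
      by auto
    show ?case
    proof (intro exI ballI)
      fix x y assume x: "x \<in> Pi\<^sub>E {..<M} (party_basis n N grp)" and y: "y \<in> Pi\<^sub>E {..<M} (party_basis n N grp)"
      have "\<rho> (?a (x(g := y g)) m) (?a (y(g := x g)) m) = gram ws (?a x m) (?a y m)"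
        unfolding upd by (rule single) (rule bit[OF x] bit[OF y], assumption)+
      then show "(\<Prod>c<Suc m. \<rho> (?a (x(g := y g)) c) (?a (y(g := x g)) c)) =
          gram (concat (map (\<lambda>v. map (\<lambda>w x. v x * w (?a x m)) ws) vs)) x y"
        by (simp only: prod.lessThan_Suc vs[OF x y] gram_tensor)
    qed
  qed
  from this[of n] show ?thesis
    unfolding ppt_def distribute_def tensor_power_def by simp
qed

section \<open>Positivity across a small group\<close>

lemma gram_of_set:
  assumes "finite I"
  shows "\<exists>vs. \<forall>x y. gram vs x y = (\<Sum>i\<in>I. v i x * cnj (v i y))"
proof -
  obtain js where "set js = I" "distinct js" using finite_distinct_list[OF assms] by blast
  then show ?thesis
    by (intro exI[of _ "map v js"]) (simp add: gram_def comp_def sum_list_distinct_conv_sum_set)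
qed

text \<open>For \<open>p 1 = p 2\<close> the only coherence of the noisy state is between the two constant bit strings.
  Transposing the bits of one group moves it to the two strings that are constant on the group and
  on its complement, where the diagonal entries are \<open>lam p j (N - j)\<close>.\<close>

lemma single_copy_gram:
  assumes p: "pauli_probs p" and eq: "p 1 = p 2" and c: "0 \<le> p 0 - p 3" and N: "0 < N"
    and j: "j = card {q. q < N \<and> grp q = g}"
    and le: "(p 0 - p 3) ^ N / 2 \<le> lam p j (N - j)"
  shows "\<exists>ws. \<forall>a b. (\<forall>q<N. a q \<in> {0, 1}) \<longrightarrow> (\<forall>q<N. b q \<in> {0, 1}) \<longrightarrow>
      noisy_cat p N (\<lambda>q. if grp q = g then b q else a q) (\<lambda>q. if grp q = g then a q else b q) = gram ws a b"
proof -
  let ?a = "p 0 + p 3" and ?b = "p 1 + p 2"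
  let ?S = "{..<N} \<rightarrow>\<^sub>E {0, 1 :: nat}"
  have finS: "finite ?S" by (rule finite_PiE) simp_all
  define \<kappa> where "\<kappa> = (p 0 - p 3) ^ N / 2"
  have \<kappa>: "0 \<le> \<kappa>" using c by (simp add: \<kappa>_def)
  define \<phi> where "\<phi> s = (\<lambda>q\<in>{..<N}. if grp q = g then 1 - s else s)" for s :: nat
  define R where "R a = restrict a {..<N}" for a :: "nat \<Rightarrow> nat"
  have R_eq: "R a = R b \<longleftrightarrow> (\<forall>q<N. a q = b q)" for a b
    by (auto simp: R_def fun_eq_iff restrict_def)
  have R\<phi>: "R a = \<phi> s \<longleftrightarrow> (\<forall>q<N. a q = (if grp q = g then 1 - s else s))" for a s
    by (auto simp: R_def \<phi>_def fun_eq_iff restrict_def)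
  have \<phi>_ne: "\<phi> 0 \<noteq> \<phi> 1"
    using N by (auto simp: \<phi>_def fun_eq_iff restrict_def intro!: exI[of _ 0])
  define d where "d t = ((\<Prod>q<N. if t q = 0 then ?a else ?b) + (\<Prod>q<N. if t q = 1 then ?a else ?b)) / 2"
    for t :: "nat \<Rightarrow> nat"
  have d_R: "d (R a) = d a" for a by (simp add: d_def R_def)
  have d_nonneg: "0 \<le> d t" for t
    unfolding d_def using pauli_probsD[OF p] by (auto intro!: add_nonneg_nonneg prod_nonneg)
  have d_\<phi>: "d (\<phi> s) = lam p j (N - j)" if "s \<in> {0, 1}" for s
  proof -
    have 1: "{q. q < N \<and> (if grp q = g then 1 - s else s) = s} = {..<N} - {q. q < N \<and> grp q = g}"
      "{q. q < N \<and> (if grp q = g then 1 - s else s) = 1 - s} = {q. q < N \<and> grp q = g}"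
      using that by auto
    have "card {q. q < N \<and> grp q = g} \<le> card {..<N}" by (rule card_mono) auto
    then have jN: "j \<le> N" using j by simp
    have 2: "card ({..<N} - {q. q < N \<and> grp q = g}) = N - j"
      unfolding j by (subst card_Diff_subset) auto
    have P: "(\<Prod>q<N. if \<phi> s q = b then ?a else ?b) =
        (\<Prod>q<N. if (if grp q = g then 1 - s else s) = b then ?a else ?b)" for b
      by (simp add: \<phi>_def)
    have "(\<Prod>q<N. if \<phi> s q = s then ?a else ?b) = ?a ^ (N - j) * ?b ^ j"
      "(\<Prod>q<N. if \<phi> s q = 1 - s then ?a else ?b) = ?a ^ j * ?b ^ (N - j)"
      unfolding P unfolding prod_two_values 1 2 j[symmetric] using jN by simp_all
    then show ?thesis
      using that unfolding d_def lam_def by (auto simp: algebra_simps)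
  qed
  have entry: "cat_entry p N (\<lambda>q. if grp q = g then b q else a q) (\<lambda>q. if grp q = g then a q else b q) =
      of_bool (R a = R b) * d a + \<kappa> * (of_bool (R a = \<phi> 0 \<and> R b = \<phi> 1) + of_bool (R a = \<phi> 1 \<and> R b = \<phi> 0))"
    if a: "\<forall>q<N. a q \<in> {0, 1}" and b: "\<forall>q<N. b q \<in> {0, 1}" for a b
  proof -
    define x where "x q = (if grp q = g then b q else a q)" for q
    define y where "y q = (if grp q = g then a q else b q)" for q
    have diag: "(\<Prod>q<N. noise p s s (x q) (y q)) = of_bool (R a = R b) * (\<Prod>q<N. if a q = s then ?a else ?b)" for s
    proof (cases "R a = R b")
      case True
      then have "\<forall>q<N. a q = b q" by (simp add: R_eq)
      then show ?thesis using True by (auto simp: noise_def x_def y_def intro!: prod.cong)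
    next
      case False
      then obtain q where "q < N" "a q \<noteq> b q" by (auto simp: R_eq)
      then have "noise p s s (x q) (y q) = 0" by (auto simp: noise_def x_def y_def)
      then show ?thesis using False \<open>q < N\<close> by (auto intro!: prod_zero)
    qed
    have off: "(\<Prod>q<N. noise p s (1 - s) (x q) (y q)) = (p 0 - p 3) ^ N * of_bool (R a = \<phi> s \<and> R b = \<phi> (1 - s))"
      if s: "s \<in> {0, 1}" for s
    proof (cases "R a = \<phi> s \<and> R b = \<phi> (1 - s)")
      case True
      then have "noise p s (1 - s) (x q) (y q) = p 0 - p 3" if "q < N" for q
        using that s by (auto simp: R\<phi> noise_def x_def y_def)
      then show ?thesis using True by simp
    next
      case False
      then obtain q where q: "q < N" "a q \<noteq> (if grp q = g then 1 - s else s) \<or>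
          b q \<noteq> (if grp q = g then 1 - (1 - s) else 1 - s)"
        unfolding R\<phi> by blast
      \<comment> \<open>A wrong bit kills a factor in one of two ways: the row and column bits
        coincide, or the factor is \<open>p 1 - p 2 = 0\<close>.\<close>
      then have "noise p s (1 - s) (x q) (y q) = 0"
        using s a b eq by (auto simp: noise_def x_def y_def)
      then show ?thesis using False q(1) by (auto intro!: prod_zero)
    qed
    show ?thesis
      unfolding cat_entry_def x_def[symmetric] y_def[symmetric]
      using diag[of 0] diag[of 1] off[of 0] off[of 1]
      by (simp add: d_def \<kappa>_def field_simps)
  qed
  \<comment> \<open>Subtracting \<open>\<kappa>\<close> from the diagonal at the two strings makes
    room for the rank-one term of \<open>u\<close>, which carries the coherence and restores
    \<open>\<kappa>\<close> on the diagonal. The remaining diagonal \<open>E\<close> is nonnegative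
    by the hypothesis \<open>le\<close>.\<close>
  define E where "E t = d t - \<kappa> * of_bool (t = \<phi> 0 \<or> t = \<phi> 1)" for t
  have E: "0 \<le> E t" for t
    using d_nonneg[of t] d_\<phi>[of 0] d_\<phi>[of 1] le by (auto simp: E_def \<kappa>_def)
  define v where "v t a = complex_of_real (sqrt (E t) * of_bool (R a = t))" for t a
  define u where "u a = complex_of_real (sqrt \<kappa> * (of_bool (R a = \<phi> 0) + of_bool (R a = \<phi> 1)))" for a
  obtain vs where vs: "\<And>a b. gram vs a b = (\<Sum>t\<in>?S. v t a * cnj (v t b))"
    using gram_of_set[OF finS, of v] by blast
  have "noisy_cat p N (\<lambda>q. if grp q = g then b q else a q) (\<lambda>q. if grp q = g then a q else b q) =
      gram (u # vs) a b" if a: "\<forall>q<N. a q \<in> {0, 1}" and b: "\<forall>q<N. b q \<in> {0, 1}" for a b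
  proof -
    have RS: "R a \<in> ?S" using a by (simp add: R_def Pi_def)
    have "(\<Sum>t\<in>?S. v t a * cnj (v t b)) = (\<Sum>t\<in>?S. if t = R a then complex_of_real (E t * of_bool (R a = R b)) else 0)"
      by (rule sum.cong[OF refl]) (auto simp: v_def E simp flip: of_real_mult)
    also have "\<dots> = complex_of_real (E (R a) * of_bool (R a = R b))"
      using RS finS by simp
    finally have sum: "gram vs a b = complex_of_real (E (R a) * of_bool (R a = R b))" unfolding vs .
    have square: "sqrt \<kappa> * X * (sqrt \<kappa> * Y) = \<kappa> * (X * Y)" for X Y
    proof -
      have "sqrt \<kappa> * X * (sqrt \<kappa> * Y) = (sqrt \<kappa> * sqrt \<kappa>) * (X * Y)" by (simp only: mult_ac)
      then show ?thesis using \<kappa> by simp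
    qed
    have "cat_entry p N (\<lambda>q. if grp q = g then b q else a q) (\<lambda>q. if grp q = g then a q else b q) =
      sqrt \<kappa> * (of_bool (R a = \<phi> 0) + of_bool (R a = \<phi> 1)) * (sqrt \<kappa> * (of_bool (R b = \<phi> 0) + of_bool (R b = \<phi> 1))) +
      E (R a) * of_bool (R a = R b)"
      unfolding entry[OF a b] square E_def d_R using \<phi>_ne by (auto simp: of_bool_def)
    moreover have "noisy_cat p N (\<lambda>q. if grp q = g then b q else a q) (\<lambda>q. if grp q = g then a q else b q) =
      complex_of_real (cat_entry p N (\<lambda>q. if grp q = g then b q else a q) (\<lambda>q. if grp q = g then a q else b q))"
      by (rule noisy_cat_entry) (use a b in auto)
    ultimately have "noisy_cat p N (\<lambda>q. if grp q = g then b q else a q) (\<lambda>q. if grp q = g then a q else b q) =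
        complex_of_real (sqrt \<kappa> * (of_bool (R a = \<phi> 0) + of_bool (R a = \<phi> 1))) *
        complex_of_real (sqrt \<kappa> * (of_bool (R b = \<phi> 0) + of_bool (R b = \<phi> 1))) +
        complex_of_real (E (R a) * of_bool (R a = R b))"
      by (simp only: of_real_add of_real_mult)
    then show ?thesis
      unfolding gram_simps u_def sum complex_cnj_complex_of_real .
  qed
  then show ?thesis by blast
qed

text \<open>Pigeonhole: if \<open>M * k\<close> exceeded \<open>N\<close>, some group would have
  between 1 and \<open>k - 1\<close> qubits, and \<open>le\<close> would give positive partial
  transpose across it. Fidelity \<open>3 / 4\<close> would then contradict the bound
  \<open>1 / 2\<close>.\<close>

lemma small_group_not_distillable:
  assumes p: "pauli_probs p" and eq: "p 1 = p 2" and c: "0 \<le> p 0 - p 3"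
    and dist: "cat_distillable M N (noisy_cat p N)"
    and le: "\<And>j. 1 \<le> j \<Longrightarrow> j < k \<Longrightarrow> (p 0 - p 3) ^ N / 2 \<le> lam p j (N - j)"
  shows "M * k \<le> N"
proof (rule ccontr)
  assume "\<not> M * k \<le> N"
  obtain grp where M: "2 \<le> M" and grp: "grp ` {..<N} = {..<M}"
    and reach: "\<And>\<epsilon>. 0 < \<epsilon> \<Longrightarrow> \<exists>n \<Lambda>. locc {..<M} (party_basis n N grp) (party_basis 1 M id) \<Lambda> \<and>
      1 - \<epsilon> \<le> cat_fidelity M (\<Lambda> (distribute grp (tensor_power n (noisy_cat p N))))"
    using dist unfolding cat_distillable_def by (elim conjE exE) blast
  have "0 \<in> grp ` {..<N}" using M unfolding grp by simp
  then have N: "0 < N" by (cases N) auto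
  define sz where "sz g = card {q. q < N \<and> grp q = g}" for g
  have "(\<Sum>g<M. sz g) = card (\<Union>g<M. {q. q < N \<and> grp q = g})"
    unfolding sz_def by (rule card_UN_disjoint[symmetric]) auto
  also have "\<dots> \<le> card {..<N}" by (rule card_mono) auto
  finally have "(\<Sum>g<M. sz g) < M * k" using \<open>\<not> M * k \<le> N\<close> by simp
  then obtain g where g: "g < M" "sz g < k"
    using sum_bounded_below[of "{..<M}" k sz] by (force simp: not_le)
  have "1 \<le> sz g"
  proof -
    have "g \<in> grp ` {..<N}" using g grp by simp
    then have "{q. q < N \<and> grp q = g} \<noteq> {}" by auto
    then show ?thesis unfolding sz_def by (simp add: Suc_le_eq card_gt_0_iff)
  qed
  from single_copy_gram[OF p eq c N sz_def le[OF this g(2)]]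
  obtain ws where ws: "\<And>a b. (\<And>q. q < N \<Longrightarrow> a q \<in> {0, 1}) \<Longrightarrow> (\<And>q. q < N \<Longrightarrow> b q \<in> {0, 1}) \<Longrightarrow>
      noisy_cat p N (\<lambda>q. if grp q = g then b q else a q) (\<lambda>q. if grp q = g then a q else b q) = gram ws a b"
    by blast
  have ppt: "ppt {..<M} (party_basis n N grp) g (distribute grp (tensor_power n (noisy_cat p N)))" for n
    by (rule ppt_tensor_power[OF grp]) (rule ws)
  obtain n \<Lambda> where "locc {..<M} (party_basis n N grp) (party_basis 1 M id) \<Lambda>"
    and "1 - 1 / 4 \<le> cat_fidelity M (\<Lambda> (distribute grp (tensor_power n (noisy_cat p N))))"
    using reach[of "1 / 4"] by auto
  with not_distillable_of_ppt[OF M g(1) grp p N ppt this(1)] show False by simp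
qed

section \<open>Optimality of the number of groups\<close>

text \<open>The coherence is tuned to the boundary of the cut \<open>k - 1\<close>, that is
  \<open>Delta p N = 2 * lam p (k - 1) (N - (k - 1))\<close>. It then beats the cut \<open>k\<close>
  strictly but no smaller cut. The weights \<open>2 / 3\<close> and \<open>1 / 3\<close> are unequal
  and positive, which makes \<open>lam\<close> strictly decreasing up to the middle; with
  \<open>p 1 = p 2\<close> the difference \<open>p 0 - p 3 = c\<close> alone determines
  \<open>Delta\<close>.\<close>

lemma threshold_probs_exist:
  assumes "2 \<le> k" "k \<le> N div 2"
  shows "\<exists>p. pauli_probs p \<and> p 1 = p 2 \<and> 0 \<le> p 0 - p 3 \<and> 2 * lam p k (N - k) < Delta p N \<and>
    (\<forall>j. 1 \<le> j \<longrightarrow> j < k \<longrightarrow> (p 0 - p 3) ^ N / 2 \<le> lam p j (N - j))"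
proof -
  define L where "L i = (2 / 3 :: real) ^ i * (1 / 3) ^ (N - i) + (1 / 3) ^ i * (2 / 3) ^ (N - i)" for i
  define c where "c = root N (L (k - 1))"
  have N: "0 < N" "2 * k \<le> N" using assms by auto
  have L: "0 \<le> L i" for i by (simp add: L_def)
  then have c: "0 \<le> c" "c ^ N = L (k - 1)" using N by (simp_all add: c_def)
  have third: "(1 / 3 :: real) ^ i = (2 / 3) ^ i * (1 / 2) ^ i" for i
    by (simp flip: power_mult_distrib)
  \<comment> \<open>This bound on \<open>c\<close> is what makes \<open>p 3\<close>
    nonnegative.\<close>
  have "c ^ N \<le> (2 / 3) ^ N"
  proof -
    have "(1 / 2 :: real) ^ m \<le> 1 / 2" if "1 \<le> m" for m
      using power_decreasing[OF that, of "1 / 2 :: real"] by simp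
    from this[of "k - 1"] this[of "N - (k - 1)"]
    have "(1 / 2 :: real) ^ (k - 1) + (1 / 2) ^ (N - (k - 1)) \<le> 1" using assms N by fastforce
    then have "(2 / 3 :: real) ^ N * ((1 / 2) ^ (k - 1) + (1 / 2) ^ (N - (k - 1))) \<le> (2 / 3) ^ N * 1"
      by (intro mult_left_mono) auto
    moreover have "(2 / 3 :: real) ^ N = (2 / 3) ^ (k - 1) * (2 / 3) ^ (N - (k - 1))"
      using assms N by (simp flip: power_add)
    ultimately show ?thesis
      unfolding c(2) L_def third by (simp add: algebra_simps)
  qed
  then have c_le: "c \<le> 2 / 3" using c(1) N by (simp add: power_mono_iff)
  define p where "p i = (if i = 0 then (2 / 3 + c) / 2 else if i = 3 then (2 / 3 - c) / 2 else 1 / 6)" for i :: nat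
  have vals: "p 0 + p 3 = 2 / 3" "p 1 + p 2 = 1 / 3" "p 0 - p 3 = c" "p 1 = p 2"
    by (simp_all add: p_def field_simps)
  have p: "pauli_probs p"
    using c c_le by (auto simp: pauli_probs_def p_def numeral_eq_Suc field_simps)
  have lam: "2 * lam p i (N - i) = L i" for i unfolding lam_def vals(1,2) L_def by simp
  have Delta: "Delta p N = L (k - 1)" using N L[of "k - 1"] unfolding Delta_def vals(3,4) c(2) by simp
  \<comment> \<open>The second exponent \<open>N - (k - 1) - k\<close> is at least one because
    \<open>2 * k \<le> N\<close>, so the drop is strict even when \<open>k\<close> is the middle
    cut.\<close>
  have "0 < 2 * (lam p (k - 1) (N - (k - 1)) - lam p k (N - k))"
  proof -
    have pos: "0 < (2 / 3 :: real) ^ m - (1 / 3) ^ m" if "0 < m" for m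
      using power_strict_mono[of "1 / 3 :: real" "2 / 3" m] that by simp
    have "k - 1 \<le> k" "k - 1 + k \<le> N" using N by auto
    then show ?thesis
      unfolding lam_diff[OF \<open>k - 1 \<le> k\<close> \<open>k - 1 + k \<le> N\<close>] vals(1,2)
      using assms(1) N(2) by (intro mult_pos_pos pos) auto
  qed
  then have "2 * lam p k (N - k) < Delta p N" using lam[of "k - 1"] Delta by simp
  moreover have "(p 0 - p 3) ^ N / 2 \<le> lam p j (N - j)" if "1 \<le> j" "j < k" for j
  proof -
    have "lam p (k - 1) (N - (k - 1)) \<le> lam p j (N - j)"
      using that N by (intro lam_mono p) auto
    then show ?thesis using lam[of "k - 1"] by (simp add: vals c)
  qed
  ultimately show ?thesis using p vals c by (intro exI[of _ p]) auto
qed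

lemma max_parties_eq_div: "1 \<le> k \<Longrightarrow> k \<le> N \<Longrightarrow> max_parties N k = N div k"
  by (auto simp: max_parties_def le_div_geq)

theorem lemma3:
  fixes N k :: nat
  assumes "1 \<le> k" and "k \<le> N div 2"
  shows "(\<forall>p. pauli_probs p \<and> Delta p N > 2 * lam p k (N - k) \<longrightarrow>
            cat_distillable (max_parties N k) N (noisy_cat p N)) \<and>
         (\<forall>M. (\<forall>p. pauli_probs p \<and> Delta p N > 2 * lam p k (N - k) \<longrightarrow>
                 cat_distillable M N (noisy_cat p N)) \<longrightarrow> M \<le> max_parties N k)"
proof (intro conjI allI impI)
  have max: "max_parties N k = N div k" using assms by (intro max_parties_eq_div) auto
  show "cat_distillable (max_parties N k) N (noisy_cat p N)"
    if "pauli_probs p \<and> Delta p N > 2 * lam p k (N - k)" for p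
    unfolding max using that assms by (intro cat_distillable_div) auto
  \<comment> \<open>\<open>M\<close> is assumed to serve every admissible \<open>p\<close>, so one
    well chosen \<open>p\<close> bounds it.\<close>
  fix M assume all: "\<forall>p. pauli_probs p \<and> Delta p N > 2 * lam p k (N - k) \<longrightarrow>
                 cat_distillable M N (noisy_cat p N)"
  have "M * k \<le> N"
  proof (cases "k = 1")
    case True
    have "2 \<le> N" using assms by auto
    \<comment> \<open>For \<open>k = 1\<close> there is no smaller cut to respect, and the noiseless
      state satisfies the condition; the bound then expresses that groups are nonempty.\<close>
    define p :: "nat \<Rightarrow> real" where "p i = of_bool (i = 0)" for i
    have p: "pauli_probs p" "p 1 = p 2" "0 \<le> p 0 - p 3"
      by (auto simp: pauli_probs_def p_def numeral_eq_Suc)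
    have "2 * lam p k (N - k) < Delta p N"
      using True \<open>2 \<le> N\<close> by (simp add: lam_def Delta_def p_def power_0_left)
    with all p(1) have "cat_distillable M N (noisy_cat p N)" by blast
    from small_group_not_distillable[OF p this, of k] True show ?thesis by simp
  next
    case False
    with assms threshold_probs_exist[of k N]
    obtain p where p: "pauli_probs p" "p 1 = p 2" "0 \<le> p 0 - p 3" and "2 * lam p k (N - k) < Delta p N"
      and le: "\<And>j. 1 \<le> j \<Longrightarrow> j < k \<Longrightarrow> (p 0 - p 3) ^ N / 2 \<le> lam p j (N - j)" by auto
    with all have "cat_distillable M N (noisy_cat p N)" by blast
    from small_group_not_distillable[OF p this le] show ?thesis .
  qed
  then show "M \<le> max_parties N k"
    unfolding max using assms by (simp add: less_eq_div_iff_mult_less_eq)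
qed

end
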